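(* Fix an integer $d\ge 2$ and $a>0$. Let $p=\frac{9}{4}\left(2+\frac{a}{d}\right)$, $A=\frac{3}{4}\left(2+\frac{a}{d}\right)$, and let $x_0\ge 3$ be the real solution of $\frac{x}{p\ln x}=3$. Let $f\ge \frac{3^{3/d}}{(3^{1/d}-1)^2}$ and $n\ge\lceil x_0\rceil$. Assume that $n$ sensors with $d$-dimensional cube sensing radius $r=\frac{f}{2n^{1/d}}$ are placed independently at random with the uniform distribution in $[0,1]^d$. Then algorithm $LV_d(n)$ moves the sensors to positions covering $[0,1]^d$, and its expected $a$-total movement is in $O\left(n^{1-\frac{a}{2d}}\left(\frac{\ln n}{n}\right)^{\frac{a}{2d}}\right)$ (the implied constant depending only on $d$ and $a$).
   Context: A sensor located at $(x_1,\dots,x_d)$ with $d$-dimensional cube sensing radius $r$ covers the axis-parallel cube with vertices $(x_1\pm r,\dots,x_d\pm r)$; the cube is covered if every point lies in the range of some sensor. If sensor $i$ is displaced a total distance $d_i$ (sum of the Euclidean lengths of its moves), the $a$-total movement is $M_a=\sum_{i=1}^n d_i^a$; the expected $a$-total movement is its expectation over the random initial placement and the random choices of the algorithm. Algorithm $MV_D(N,y)$, for $N=m^D$ sensors in a cube of side $y$ (taken as $[0,y]^D$ after translation), is defined recursively. For $D=1$: sort the sensors so that $x_1\le\dots\le x_N$ and move the $i$-th to $\frac{yi}{N}-\frac{y}{2N}$. For $D\ge 2$: sort by first coordinate, $S_1,\dots,S_N$; for $j=1,\dots,N^{1/D}$ the sensors $S_i$ with $(j-1)N^{(D-1)/D}<i\le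 jN^{(D-1)/D}$ form block $j$ and get first coordinate $\frac{jy}{N^{1/D}}-\frac{y}{2N^{1/D}}$ (other coordinates unchanged); then $MV_{D-1}(N^{(D-1)/D},y)$ is run on the remaining coordinates of each block. The final positions are the grid points $\left(\frac{yl_1}{N^{1/D}}-\frac{y}{2N^{1/D}},\dots,\frac{yl_D}{N^{1/D}}-\frac{y}{2N^{1/D}}\right)$, $l_k\in\{1,\dots,N^{1/D}\}$. Algorithm $LV_d(n)$: let $k=\left\lfloor\left(\frac{n}{p\ln n}\right)^{1/d}\right\rfloor$ and divide $[0,1]^d$ into $k^d$ subcubes of side $1/k$. If some subcube contains fewer than $\frac{1}{3}\frac{n}{k^d}$ sensors, choose $\lfloor n^{1/d}\rfloor^d$ of the sensors uniformly at random and apply $MV_d(\lfloor n^{1/d}\rfloor^d,1)$ to them (the others are not moved). Otherwise, in each subcube choose $\lfloor (A\ln n)^{1/d}\rfloor^d$ of its sensors uniformly at random and apply $MV_d(\lfloor (A\ln n)^{1/d}\rfloor^d, 1/k)$ to them within that subcube (the others are not moved). *)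

theory Defs
  imports "HOL-Probability.Probability"
begin

text \<open>A point of \<open>d\<close>-dimensional space is given by its coordinates \<open>0, \<dots>, d - 1\<close>.
  Sensors are numbered \<open>0, \<dots>, n - 1\<close>. A state of the algorithm records, for every sensor,
  its current position and the total length of the moves it has made so far.\<close>

type_synonym point = "nat \<Rightarrow> real"
type_synonym state = "nat \<Rightarrow> point \<times> real"

definition euclid_dist :: "nat \<Rightarrow> point \<Rightarrow> point \<Rightarrow> real" where
  "euclid_dist d x y = L2_set (\<lambda>j. x j - y j) {..<d}"

definition unit_cube :: "nat \<Rightarrow> point set" where
  "unit_cube d = {..<d} \<rightarrow>\<^sub>E {0..1}"

definition uniform_cube :: "nat \<Rightarrow> point measure" where
  "uniform_cube d = uniform_measure (\<Pi>\<^sub>M j\<in>{..<d}. lborel) (unit_cube d)"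

definition placement :: "nat \<Rightarrow> nat \<Rightarrow> (nat \<Rightarrow> point) measure" where
  "placement d n = (\<Pi>\<^sub>M i\<in>{..<n}. uniform_cube d)"

definition covers :: "nat \<Rightarrow> nat \<Rightarrow> real \<Rightarrow> (nat \<Rightarrow> point) \<Rightarrow> bool" where
  "covers d n r P \<longleftrightarrow> (\<forall>x\<in>unit_cube d. \<exists>i<n. \<forall>j<d. \<bar>x j - P i j\<bar> \<le> r)"

definition start :: "(nat \<Rightarrow> point) \<Rightarrow> state" where
  "start X = (\<lambda>i. (X i, 0))"

definition positions :: "state \<Rightarrow> nat \<Rightarrow> point" where
  "positions S = (\<lambda>i. fst (S i))"

definition displacement :: "state \<Rightarrow> nat \<Rightarrow> real" where
  "displacement S = (\<lambda>i. snd (S i))"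

definition total_movement :: "real \<Rightarrow> nat \<Rightarrow> state \<Rightarrow> real" where
  "total_movement a n S = (\<Sum>i<n. displacement S i powr a)"

text \<open>Sensor \<open>i\<close> moves so that its coordinate \<open>c\<close> becomes \<open>t\<close>.\<close>

definition move_coord :: "nat \<Rightarrow> nat \<Rightarrow> real \<Rightarrow> nat \<Rightarrow> state \<Rightarrow> state" where
  "move_coord d c t i S =
     (let x = positions S i; x' = x(c := t)
      in S(i := (x', displacement S i + euclid_dist d x x')))"

text \<open>\<open>MV d m y b D I S\<close> is the algorithm $MV_D(m^D,y)$ applied to the $m^D$ sensors listed
  in \<open>I\<close>, starting from the state \<open>S\<close>. The ambient dimension is \<open>d\<close>, and the call acts on the
  last \<open>D\<close> coordinates \<open>d - D, \<dots>, d - 1\<close>, so its first coordinate is \<open>d - D\<close>. The cube has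
  side \<open>y\<close> and lowest corner \<open>b\<close>. Since $N = m^D$, one has $N^{1/D} = m$ and
  $N^{(D-1)/D} = m^{D-1}$. The equation for \<open>D = 0\<close> only makes the function total. Sorting is
  stable, so ties are broken by the order of \<open>I\<close>.\<close>

fun MV :: "nat \<Rightarrow> nat \<Rightarrow> real \<Rightarrow> point \<Rightarrow> nat \<Rightarrow> nat list \<Rightarrow> state \<Rightarrow> state" where
  "MV d m y b 0 I S = S"
| "MV d m y b (Suc 0) I S =
     (let c = d - 1; xs = sort_key (\<lambda>i. positions S i c) I
      in fold (\<lambda>l. move_coord d c (b c + (y * real l / real m - y / (2 * real m))) (xs ! (l - 1)))
           [1..<Suc m] S)"
| "MV d m y b (Suc (Suc D)) I S =
     (let c = d - Suc (Suc D); xs = sort_key (\<lambda>i. positions S i c) I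
      in fold (\<lambda>j S.
             let B = take (m ^ Suc D) (drop ((j - 1) * m ^ Suc D) xs)
             in MV d m y b (Suc D) B
                  (fold (move_coord d c (b c + (real j * y / real m - y / (2 * real m)))) B S))
           [1..<Suc m] S)"

text \<open>The unit cube is divided into $k^d$ subcubes indexed by \<open>cells d k\<close>. The subcube of
  index \<open>c\<close> is the product of the intervals $[c_j/k, (c_j+1)/k)$, closed on the right when
  $c_j = k-1$, so that the subcubes partition $[0,1]^d$; \<open>cell_of d k x\<close> is the index of the
  subcube containing \<open>x\<close>.\<close>

definition cells :: "nat \<Rightarrow> nat \<Rightarrow> (nat \<Rightarrow> nat) set" where
  "cells d k = {..<d} \<rightarrow>\<^sub>E {..<k}"

definition cell_of :: "nat \<Rightarrow> nat \<Rightarrow> point \<Rightarrow> nat \<Rightarrow> nat" where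
  "cell_of d k x = (\<lambda>j\<in>{..<d}. min (nat \<lfloor>real k * x j\<rfloor>) (k - 1))"

definition corner :: "nat \<Rightarrow> (nat \<Rightarrow> nat) \<Rightarrow> point" where
  "corner k c = (\<lambda>j. real (c j) / real k)"

definition sensors_in :: "nat \<Rightarrow> nat \<Rightarrow> nat \<Rightarrow> (nat \<Rightarrow> point) \<Rightarrow> (nat \<Rightarrow> nat) \<Rightarrow> nat set" where
  "sensors_in d k n X c = {i. i < n \<and> cell_of d k (X i) = c}"

definition choose_uniformly :: "nat \<Rightarrow> nat set \<Rightarrow> nat set pmf" where
  "choose_uniformly N I = pmf_of_set {T. T \<subseteq> I \<and> card T = N}"

definition floor_root :: "nat \<Rightarrow> real \<Rightarrow> nat" where
  "floor_root d x = nat \<lfloor>x powr (1 / real d)\<rfloor>"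

text \<open>The distribution of the final state of $LV_d(n)$ on the initial placement \<open>X\<close>. In the
  second case \<open>F c\<close> is the set of sensors chosen in subcube \<open>c\<close>; sensor \<open>i\<close> can only be moved by
  the call for its own subcube, and that call leaves it in place if it was not chosen.\<close>

definition LV :: "nat \<Rightarrow> real \<Rightarrow> real \<Rightarrow> nat \<Rightarrow> (nat \<Rightarrow> point) \<Rightarrow> state pmf" where
  "LV d p A n X =
     (let k = floor_root d (real n / (p * ln (real n)))
      in if \<exists>c\<in>cells d k. real (card (sensors_in d k n X c)) < 1 / 3 * (real n / real k ^ d)
         then let m = floor_root d (real n)
              in map_pmf (\<lambda>T. MV d m 1 (\<lambda>_. 0) d (sorted_list_of_set T) (start X))
                   (choose_uniformly (m ^ d) {..<n})
         else let m = floor_root d (A * ln (real n))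
              in map_pmf
                   (\<lambda>F i. let c = cell_of d k (X i)
                          in MV d m (1 / real k) (corner k c) d
                               (sorted_list_of_set (F c)) (start X) i)
                   (Pi_pmf (cells d k) {}
                      (\<lambda>c. choose_uniformly (m ^ d) (sensors_in d k n X c))))"

text \<open>The mean of the total movement over the random choices of the algorithm, for a fixed
  initial placement, and then its mean over the placement.\<close>

definition mean_movement ::
    "nat \<Rightarrow> real \<Rightarrow> real \<Rightarrow> real \<Rightarrow> nat \<Rightarrow> (nat \<Rightarrow> point) \<Rightarrow> real" where
  "mean_movement d p A a n X = measure_pmf.expectation (LV d p A n X) (total_movement a n)"

definition expected_movement :: "nat \<Rightarrow> real \<Rightarrow> real \<Rightarrow> real \<Rightarrow> nat \<Rightarrow> real" where
  "expected_movement d p A a n = (\<integral>X. mean_movement d p A a n X \<partial>placement d n)"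

end

theory Submission
  imports Defs "HOL-Real_Asymp.Real_Asymp"
begin

text \<open>The displacement of a sensor is at most the sum of its moves along the \<open>d\<close> axes, so up to a
  constant the total movement is a sum over axes, blocks and ranks of terms
  \<open>\<bar>X - c\<bar> powr a\<close>, where \<open>X\<close> is an order statistic of the block and \<open>c\<close> the centre of its slab.
  The block depends only on the earlier coordinates, hence given the block the current coordinates
  are still independent and uniform. By Hoeffding's inequality an order statistic of at least \<open>m\<close>
  uniform points is within \<open>O(1 / sqrt m)\<close> of its target, with Gaussian tails, so running the
  algorithm on \<open>m ^ d\<close> uniform points of the unit cube costs \<open>O(m ^ d * m powr (- a / 2))\<close> on average.

  If every cell of side \<open>1 / k\<close> holds enough sensors, apply this in each cell, scaled by \<open>1 / k\<close>:
  given the cells of the sensors, the positions inside the cells are independent and uniform. The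
  exceptional event has small probability but is not independent of the positions, and bounding the
  movement on it takes two extra ingredients: a Chernoff bound with a better exponent than the one
  for which the parameters were chosen, and a moment of higher order.

  For the covering, every cell (or the whole cube) ends up with a sensor at each point of a grid, and
  the bound on \<open>f\<close> is the loss from rounding down, \<open>z / \<lfloor>z\<rfloor> \<le> u / (u - 1)\<close> for \<open>z \<ge> u = 3 powr (1 / d)\<close>,
  once for the cells and once for the grid in each cell.\<close>

subsection \<open>The deterministic algorithm\<close>

text \<open>The obstacle is the event that some cell holds few sensors. Put N = n, e = a / d and
  ignore constants and logarithms. A run on the whole cube costs N^(1 - e/2) on average, and the
  usual Chernoff estimate gives the event probability N^(-e/2). The product N^(1 - e) is what
  \<open>p\<close> is tuned for, but on the event the sensors are no longer independent and uniform,
  so the two cannot be multiplied. Instead a displacement u is cut off at t = N^(-s/d) by u^a \<le>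
  t^a + t^(-(q-1)a) u^(qa). The first part needs only the probability of the event; the second is
  averaged over all placements and costs N^(1 + s(q-1)e - qe/2). With the usual estimate the first
  part forces s \<ge> 1/2, and then the second is never better than N^(1 - e/2), for any fixed q.
  The exponent 4/15 lowers the probability to N^(-1/5 - 3e/5), which allows s = 2/5; the second part
  is then at most N^(1 - e) as soon as q \<ge> 6. Hence the moment of order
  \<open>6 * a\<close>.\<close>

lemma insort_key_cong_order:
  assumes "\<And>y. y \<in> set ys \<Longrightarrow> f x \<le> f y \<longleftrightarrow> g x \<le> g y"
  shows "insort_key f x ys = insort_key g x ys"
  using assms by (induction ys) auto

text \<open>Insertion only compares keys, so keys with the same weak order, ties included, give the
  same list. This is used to pass from positions in a small cube to coordinates in the unit cube,
  and from a sample to a resampled copy.\<close>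

lemma sort_key_cong_order:
  assumes "\<And>x y. x \<in> set xs \<Longrightarrow> y \<in> set xs \<Longrightarrow> f x \<le> f y \<longleftrightarrow> g x \<le> g y"
  shows "sort_key f xs = sort_key g xs"
  using assms
proof (induction xs)
  case (Cons x xs)
  have "sort_key f xs = sort_key g xs"
    by (rule Cons.IH) (simp add: Cons.prems)
  then show ?case
    using Cons.prems by (auto intro!: insort_key_cong_order)
qed simp

definition chunk :: "nat \<Rightarrow> nat \<Rightarrow> 'a list \<Rightarrow> 'a list" where
  "chunk w j xs = take w (drop (j * w) xs)"

text \<open>Blocks are counted from \<open>0\<close> here: for \<open>l = j + 1\<close> this is the
  algorithm's target \<open>l / m - 1 / (2 * m)\<close> in a cube of side 1.\<close>

definition centre :: "nat \<Rightarrow> nat \<Rightarrow> real" where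
  "centre m j = (real j + 1 / 2) / real m"

lemma chunk_bound:
  fixes j m w :: nat
  assumes "j < m"
  shows "j * w + w \<le> m * w"
  using mult_le_mono1[of "Suc j" m w] assms by simp

lemma length_chunk [simp]:
  assumes "length xs = m * w" "j < m"
  shows "length (chunk w j xs) = w"
  using chunk_bound[OF assms(2), of w] assms(1) by (simp add: chunk_def)

lemma nth_chunk:
  assumes "length xs = m * w" "j < m" "r < w"
  shows "chunk w j xs ! r = xs ! (j * w + r)"
  using chunk_bound[OF assms(2), of w] assms by (simp add: chunk_def)

lemma set_chunk_subset: "set (chunk w j xs) \<subseteq> set xs"
  unfolding chunk_def by (meson set_drop_subset set_take_subset subset_trans)

lemma distinct_chunk [simp]: "distinct xs \<Longrightarrow> distinct (chunk w j xs)"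
  by (simp add: chunk_def)

lemma set_chunk:
  assumes "length xs = m * w" "j < m"
  shows "set (chunk w j xs) = (\<lambda>r. xs ! (j * w + r)) ` {..<w}"
proof -
  have "set (chunk w j xs) = (\<lambda>r. chunk w j xs ! r) ` {..<length (chunk w j xs)}"
    by (auto simp: set_conv_nth)
  also have "\<dots> = (\<lambda>r. xs ! (j * w + r)) ` {..<w}"
    using assms by (intro image_cong) (simp_all add: nth_chunk[OF assms] length_chunk[OF assms])
  finally show ?thesis .
qed

lemma disjoint_chunks:
  assumes "length xs = m * w" "distinct xs"
  shows "disjoint_family_on (\<lambda>j. set (chunk w j xs)) {..<m}"
  unfolding disjoint_family_on_def
proof (intro ballI impI)
  fix j j' assume j: "j \<in> {..<m}" "j' \<in> {..<m}" "j \<noteq> j'"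
  have "xs ! (j * w + r) \<noteq> xs ! (j' * w + r')" if "r < w" "r' < w" for r r'
  proof
    assume "xs ! (j * w + r) = xs ! (j' * w + r')"
    moreover have "j * w + r < length xs" "j' * w + r' < length xs"
      using chunk_bound[of j m w] chunk_bound[of j' m w] j that assms(1) by auto
    ultimately have "j * w + r = j' * w + r'"
      using assms(2) by (simp add: nth_eq_iff_index_eq)
    then have "(j * w + r) div w = (j' * w + r') div w" by simp
    then show False using that j(3) by simp
  qed
  then show "set (chunk w j xs) \<inter> set (chunk w j' xs) = {}"
    using j set_chunk[OF assms(1)] by auto
qed

lemma UN_chunks:
  assumes "length xs = m * w"
  shows "(\<Union>j<m. set (chunk w j xs)) = set xs"
proof
  show "(\<Union>j<m. set (chunk w j xs)) \<subseteq> set xs"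
    using set_chunk_subset by fastforce
  show "set xs \<subseteq> (\<Union>j<m. set (chunk w j xs))"
  proof
    fix x assume "x \<in> set xs"
    then obtain i where i: "i < m * w" "x = xs ! i"
      using assms by (auto simp: set_conv_nth)
    then have "w > 0" by (cases w) auto
    then have "i div w < m" "i mod w < w" "i = i div w * w + i mod w"
      using i by (auto simp: less_mult_imp_div_less)
    then show "x \<in> (\<Union>j<m. set (chunk w j xs))"
      using assms i(2) by (metis (no_types, lifting) UN_I imageI lessThan_iff set_chunk)
  qed
qed

lemma sum_chunks:
  assumes "length xs = m * w" "distinct xs"
  shows "(\<Sum>i\<in>set xs. f i) = (\<Sum>j<m. \<Sum>i\<in>set (chunk w j xs). f i)"
  unfolding UN_chunks[OF assms(1), symmetric]
  using disjoint_chunks[OF assms] by (intro sum.UNION_disjoint) (auto simp: disjoint_family_on_def)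

section \<open>Locality: what a call reads and writes\<close>

lemma euclid_dist_upd:
  assumes "c < d"
  shows "euclid_dist d x (x(c := t)) = \<bar>x c - t\<bar>"
proof -
  have "(\<Sum>j<d. (x j - (x(c := t)) j)\<^sup>2) = (\<Sum>j<d. if j = c then (x c - t)\<^sup>2 else 0)"
    by (intro sum.cong) auto
  then show ?thesis using assms by (simp add: euclid_dist_def L2_set_def)
qed

lemma move_coord_other: "i' \<noteq> i \<Longrightarrow> move_coord d c t i S i' = S i'"
  by (simp add: move_coord_def Let_def)

lemma move_coord_self:
  assumes "c < d"
  shows "move_coord d c t i S i = ((positions S i)(c := t), displacement S i + \<bar>positions S i c - t\<bar>)"
  using assms by (simp add: move_coord_def Let_def euclid_dist_upd)

text \<open>By disjointness, earlier rounds change nothing that round \<open>j\<close> reads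
  (\<open>out\<close>, \<open>loc\<close>) and later rounds change nothing that it wrote. This
  splits both loops of the algorithm, over sensors and over blocks, into independent pieces.\<close>

lemma fold_blocks:
  fixes G :: "'j \<Rightarrow> ('i \<Rightarrow> 's) \<Rightarrow> ('i \<Rightarrow> 's)"
  assumes "distinct js" "disjoint_family_on B (set js)"
    and out: "\<And>j S i. j \<in> set js \<Longrightarrow> i \<notin> B j \<Longrightarrow> G j S i = S i"
    and loc: "\<And>j S S' i. j \<in> set js \<Longrightarrow> (\<And>i. i \<in> B j \<Longrightarrow> S i = S' i) \<Longrightarrow> i \<in> B j \<Longrightarrow> G j S i = G j S' i"
  shows fold_blocks_outside: "i \<notin> (\<Union>j\<in>set js. B j) \<Longrightarrow> fold G js S i = S i"
    and fold_blocks_inside: "j \<in> set js \<Longrightarrow> i \<in> B j \<Longrightarrow> fold G js S i = G j S i"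
proof -
  have outside: "fold G ks T i = T i"
    if "set ks \<subseteq> set js" "i \<notin> (\<Union>j\<in>set ks. B j)" for ks T i
    using that by (induction ks arbitrary: T) (auto simp: out)
  then show "i \<notin> (\<Union>j\<in>set js. B j) \<Longrightarrow> fold G js S i = S i" by simp
  have "fold G ks T i = G j T i"
    if "set ks \<subseteq> set js" "distinct ks" "j \<in> set ks" "i \<in> B j" for ks T
    using that
  proof (induction ks arbitrary: T)
    case (Cons k ks)
    have dis: "B j' \<inter> B j'' = {}" if "j' \<in> set js" "j'' \<in> set js" "j' \<noteq> j''" for j' j''
      using assms(2) that by (auto simp: disjoint_family_on_def)
    show ?case
    proof (cases "j = k")
      case True
      have "i \<notin> (\<Union>j\<in>set ks. B j)"
      proof
        assume "i \<in> (\<Union>j\<in>set ks. B j)"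
        then obtain j' where "j' \<in> set ks" "i \<in> B j'" by auto
        then show False
          using dis[of j j'] Cons.prems True by auto
      qed
      then show ?thesis
        using outside[of ks i] Cons.prems True by simp
    next
      case False
      have "fold G (k # ks) T i = G j (G k T) i"
        using Cons.IH[of "G k T"] Cons.prems False by simp
      also have "\<dots> = G j T i"
      proof (rule loc)
        fix i' assume "i' \<in> B j"
        then have "i' \<notin> B k" using dis[of j k] Cons.prems False by auto
        then show "G k T i' = T i'" using Cons.prems by (intro out) auto
      qed (use Cons.prems in auto)
      finally show ?thesis .
    qed
  qed simp
  then show "j \<in> set js \<Longrightarrow> i \<in> B j \<Longrightarrow> fold G js S i = G j S i"
    using assms(1) by simp
qed

lemma fold_move_coord:
  assumes "distinct B"
  shows "fold (move_coord d c t) B S i = (if i \<in> set B then move_coord d c t i S i else S i)"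
proof -
  have loc: "move_coord d c t j S i = move_coord d c t j S' i"
    if "\<And>i. i \<in> {j} \<Longrightarrow> S i = S' i" "i \<in> {j}" for j S S' i
    using that by (auto simp: move_coord_def Let_def positions_def displacement_def)
  have "disjoint_family_on (\<lambda>j. {j}) (set B)"
    by (auto simp: disjoint_family_on_def)
  note blocks = fold_blocks[where G = "move_coord d c t" and B = "\<lambda>j. {j}", OF assms this _ loc]
  show ?thesis
    using blocks(1)[of i S] blocks(2)[of i i S] by (auto simp: move_coord_other)
qed

definition MV_block ::
    "nat \<Rightarrow> nat \<Rightarrow> real \<Rightarrow> point \<Rightarrow> nat \<Rightarrow> nat list \<Rightarrow> nat \<Rightarrow> state \<Rightarrow> state" where
  "MV_block d m y b D xs j S =
     (let c = d - Suc D; B = chunk (m ^ D) j xs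
      in MV d m y b D B (fold (move_coord d c (b c + y * centre m j)) B S))"

text \<open>For \<open>D = 0\<close> a chunk is a single sensor and the inner call does nothing, so
  the one-dimensional clause of \<open>MV\<close> has the same shape as the general one and needs no
  separate treatment in \<open>MV_local\<close>.\<close>

lemma MV_Suc:
  assumes "length I = m ^ Suc D"
  shows "MV d m y b (Suc D) I S =
    fold (MV_block d m y b D (sort_key (\<lambda>i. positions S i (d - Suc D)) I)) [0..<m] S"
proof -
  have upt: "[1..<Suc m] = map Suc [0..<m]" by (simp add: map_Suc_upt)
  have eq: "real (Suc j) * y / real m - y / (2 * real m) = y * centre m j" for j
    by (cases "m = 0") (simp_all add: centre_def field_simps)
  show ?thesis
  proof (cases D)
    case 0
    define xs where "xs = sort_key (\<lambda>i. positions S i (d - Suc 0)) I"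
    have "length xs = m" using assms 0 by (simp add: xs_def)
    then have one: "chunk (Suc 0) j xs = [xs ! j]" if "j < m" for j
      using that by (simp add: chunk_def take_Suc_conv_app_nth hd_drop_conv_nth take_Suc)
    show ?thesis
      unfolding upt MV.simps 0 Let_def fold_map
      using eq by (intro fold_cong)
        (auto simp: MV_block_def one xs_def[symmetric] Let_def fun_eq_iff mult.commute simp del: of_nat_Suc)
  next
    case (Suc D')
    show ?thesis
      unfolding upt MV.simps Suc Let_def fold_map
      by (intro fold_cong) (auto simp: MV_block_def chunk_def Let_def eq comp_def simp del: of_nat_Suc)
  qed
qed

text \<open>The first two claims at \<open>D\<close> are the conditions \<open>out\<close> and
  \<open>loc\<close> of \<open>fold_blocks\<close> for the loop at \<open>Suc D\<close>, which is
  why they share one induction. The third is what the loop then yields, and the form in which the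
  recursion is unfolded afterwards (\<open>MV_in_block\<close>).\<close>

lemma MV_local:
  assumes "distinct I" "length I = m ^ D"
  shows MV_outside: "i \<notin> set I \<Longrightarrow> MV d m y b D I S i = S i"
    and MV_agree: "(\<And>i. i \<in> set I \<Longrightarrow> S i = S' i) \<Longrightarrow> i \<in> set I \<Longrightarrow>
      MV d m y b D I S i = MV d m y b D I S' i"
    and "D = Suc E \<Longrightarrow> j < m \<Longrightarrow>
      i \<in> set (chunk (m ^ E) j (sort_key (\<lambda>i. positions S i (d - D)) I)) \<Longrightarrow>
      MV d m y b D I S i = MV_block d m y b E (sort_key (\<lambda>i. positions S i (d - D)) I) j S i"
proof -
  have "(\<forall>i. i \<notin> set I \<longrightarrow> MV d m y b D I S i = S i) \<and>
    ((\<forall>i\<in>set I. S i = S' i) \<longrightarrow> (\<forall>i\<in>set I. MV d m y b D I S i = MV d m y b D I S' i)) \<and>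
    (\<forall>E j i. D = Suc E \<longrightarrow> j < m \<longrightarrow>
      i \<in> set (chunk (m ^ E) j (sort_key (\<lambda>i. positions S i (d - D)) I)) \<longrightarrow>
      MV d m y b D I S i = MV_block d m y b E (sort_key (\<lambda>i. positions S i (d - D)) I) j S i)"
    using assms
  proof (induction D arbitrary: I S S')
    case (Suc D)
    define X where "X S = sort_key (\<lambda>i. positions S i (d - Suc D)) I" for S :: state
    have X: "length (X S) = m * m ^ D" "distinct (X S)" "set (X S) = set I" for S
      using Suc.prems by (simp_all add: X_def)
    have len: "length (chunk (m ^ D) j (X S)) = m ^ D" if "j < m" for j S
      using that X by simp
    define B where "B S j = set (chunk (m ^ D) j (X S))" for S j
    have dis: "disjoint_family_on (B S) (set [0..<m])" for S
      unfolding B_def using disjoint_chunks[OF X(1,2)[of S]] by (simp add: atLeast0LessThan)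
    have out: "MV_block d m y b D (X S) j T i = T i" if "j \<in> set [0..<m]" "i \<notin> B S j" for S T j i
      unfolding MV_block_def Let_def
      using Suc.IH[of "chunk (m ^ D) j (X S)"] len[of j S] X that
      by (simp add: B_def fold_move_coord)
    have loc: "MV_block d m y b D (X S) j T i = MV_block d m y b D (X S) j T' i"
      if "j \<in> set [0..<m]" "\<And>i. i \<in> B S j \<Longrightarrow> T i = T' i" "i \<in> B S j" for S T T' j i
    proof -
      let ?C = "chunk (m ^ D) j (X S)" and ?f = "move_coord d (d - Suc D) (b (d - Suc D) + y * centre m j)"
      have "fold ?f ?C T i = fold ?f ?C T' i" if "i \<in> set ?C" for i
        using that \<open>\<And>i. i \<in> B S j \<Longrightarrow> T i = T' i\<close> X(2)
        by (simp add: fold_move_coord B_def move_coord_def Let_def positions_def displacement_def)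
      then show ?thesis
        unfolding MV_block_def Let_def
        using Suc.IH[of ?C "fold ?f ?C T" "fold ?f ?C T'"] len[of j S] X that(1,3)
        by (simp add: B_def)
    qed
    note MVS = MV_Suc[OF Suc.prems(2), of d y b, folded X_def]
    note blocks = fold_blocks[where G = "MV_block d m y b D (X T)" and B = "B T" for T, OF distinct_upt dis out loc]
    have UN: "(\<Union>j\<in>set [0..<m]. B T j) = set I" for T
      using UN_chunks[OF X(1)] X(3) by (simp add: B_def atLeast0LessThan)
    have inside: "MV d m y b (Suc D) I T i = MV_block d m y b D (X T) j T i"
      if "j < m" "i \<in> B T j" for T i j
      unfolding MVS by (rule blocks(2)) (use that in auto)
    have outside: "MV d m y b (Suc D) I T i = T i" if "i \<notin> set I" for T i
      unfolding MVS by (rule blocks(1)) (use that UN in auto)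
    have agree: "MV d m y b (Suc D) I S i = MV d m y b (Suc D) I S' i"
      if SS: "\<forall>i\<in>set I. S i = S' i" and i: "i \<in> set I" for i
    proof -
      obtain j where j: "j < m" "i \<in> B S j" using i unfolding UN[of S, symmetric] by auto
      \<comment> \<open>States agreeing on \<open>I\<close> are sorted alike, so they have the same
        blocks and can be compared block by block.\<close>
      have "X S = X S'" unfolding X_def
        by (rule sort_key_cong_order) (use SS in \<open>simp add: positions_def\<close>)
      moreover have "B S j \<subseteq> set I" using UN[of S] j(1) by auto
      ultimately show ?thesis
        using inside[OF j] inside[of j i S'] loc[of j S S S' i] SS j by (auto simp: B_def)
    qed
    show ?case
      using outside inside agree by (auto simp: X_def B_def)
  qed simp
  then show "i \<notin> set I \<Longrightarrow> MV d m y b D I S i = S i"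
    and "(\<And>i. i \<in> set I \<Longrightarrow> S i = S' i) \<Longrightarrow> i \<in> set I \<Longrightarrow>
      MV d m y b D I S i = MV d m y b D I S' i"
    and "D = Suc E \<Longrightarrow> j < m \<Longrightarrow>
      i \<in> set (chunk (m ^ E) j (sort_key (\<lambda>i. positions S i (d - D)) I)) \<Longrightarrow>
      MV d m y b D I S i = MV_block d m y b E (sort_key (\<lambda>i. positions S i (d - D)) I) j S i"
    by blast+
qed

section \<open>Final positions\<close>

lemmas MV_in_block = MV_local(3)[OF _ _ refl]

lemma MV_low_coordinates:
  assumes "distinct I" "length I = m ^ D" "c < d - D"
  shows "positions (MV d m y b D I S) i c = positions S i c"
  using assms
proof (induction D arbitrary: I S)
  case (Suc D)
  let ?xs = "sort_key (\<lambda>i. positions S i (d - Suc D)) I"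
  show ?case
  proof (cases "i \<in> set I")
    case True
    then obtain j where j: "j < m" "i \<in> set (chunk (m ^ D) j ?xs)"
      using UN_chunks[of ?xs m "m ^ D"] Suc.prems by auto
    let ?B = "chunk (m ^ D) j ?xs"
    have B: "length ?B = m ^ D" "distinct ?B" using Suc.prems j by auto
    have "positions (MV d m y b (Suc D) I S) i c = 
        positions (fold (move_coord d (d - Suc D) (b (d - Suc D) + y * centre m j)) ?B S) i c"
      using MV_in_block[OF Suc.prems(1,2) j] Suc.IH[OF B(2,1)] Suc.prems(3)
      by (simp add: MV_block_def Let_def positions_def)
    also have "\<dots> = positions S i c"
      using B Suc.prems(3) by (simp add: positions_def fold_move_coord move_coord_def Let_def)
    finally show ?thesis .
  qed (use Suc.prems in \<open>simp add: MV_outside positions_def\<close>)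
qed simp

text \<open>At each level follow the block whose index is the required entry of \<open>l\<close>;
  the later calls do not touch the coordinate just set (\<open>MV_low_coordinates\<close>). At the
  bottom the list has \<open>m ^ 0 = 1\<close> entries, so a sensor is left.\<close>

lemma MV_grid:
  assumes "distinct I" "length I = m ^ D" "D \<le> d" "\<And>c. l c < m"
  shows "\<exists>i\<in>set I. \<forall>c. d - D \<le> c \<and> c < d \<longrightarrow>
    positions (MV d m y b D I S) i c = b c + y * centre m (l c)"
  using assms
proof (induction D arbitrary: I S)
  case 0
  then show ?case by (cases I) auto
next
  case (Suc D)
  let ?xs = "sort_key (\<lambda>i. positions S i (d - Suc D)) I" and ?c = "d - Suc D"
  let ?j = "l ?c" and ?t = "b (d - Suc D) + y * centre m (l (d - Suc D))"
  let ?B = "chunk (m ^ D) ?j ?xs"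
  let ?S = "fold (move_coord d ?c ?t) ?B S"
  have j: "?j < m" using Suc.prems by simp
  have B: "length ?B = m ^ D"
    by (rule length_chunk[where m = m]) (use Suc.prems j in simp_all)
  have B': "distinct ?B" using Suc.prems by simp
  note B = B B'
  obtain i where i: "i \<in> set ?B" and
    pos: "\<And>c. d - D \<le> c \<Longrightarrow> c < d \<Longrightarrow> positions (MV d m y b D ?B ?S) i c = b c + y * centre m (l c)"
    using Suc.IH[OF B(2,1) _ Suc.prems(4), of ?S] Suc.prems(3) by auto
  have eq: "MV d m y b (Suc D) I S i = MV d m y b D ?B ?S i"
    using MV_in_block[OF Suc.prems(1,2) j i] by (simp add: MV_block_def Let_def)
  have "positions (MV d m y b (Suc D) I S) i c = b c + y * centre m (l c)"
    if "d - Suc D \<le> c" "c < d" for c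
  proof (cases "c = d - Suc D")
    case True
    have "positions (MV d m y b D ?B ?S) i c = positions ?S i c"
      by (rule MV_low_coordinates) (use B True Suc.prems in auto)
    also have "\<dots> = ?t"
      using B i True Suc.prems(3) by (simp add: positions_def fold_move_coord move_coord_self)
    finally show ?thesis using True eq by (simp add: positions_def)
  next
    case False
    then show ?thesis using pos[of c] that eq by (simp add: positions_def)
  qed
  moreover have "i \<in> set I" using i set_chunk_subset[of "m ^ D" ?j ?xs] by auto
  ultimately show ?case by blast
qed

text \<open>The factor \<open>2 powr a\<close> pays for splitting \<open>(u + v) powr a\<close>, where \<open>u\<close> is the length of the
  first move of a sensor and \<open>v\<close> that of all later ones.\<close>

fun MV_cost :: "real \<Rightarrow> nat \<Rightarrow> nat \<Rightarrow> nat \<Rightarrow> nat list \<Rightarrow> (nat \<Rightarrow> point) \<Rightarrow> real" where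
  "MV_cost a d m 0 I X = 0"
| "MV_cost a d m (Suc D) I X =
     (let c = d - Suc D; xs = sort_key (\<lambda>i. X i c) I
      in 2 powr a * (\<Sum>j<m. (\<Sum>i\<in>set (chunk (m ^ D) j xs). \<bar>X i c - centre m j\<bar> powr a)
                           + MV_cost a d m D (chunk (m ^ D) j xs) X))"

lemma MV_cost_nonneg: "MV_cost a d m D I X \<ge> 0"
  by (induction D arbitrary: I) (auto simp: Let_def intro!: sum_nonneg mult_nonneg_nonneg add_nonneg_nonneg)

text \<open>Used when resampling: a recursive call reads only coordinates that have been redrawn, so
  the mixed sample can be replaced by the fresh one.\<close>

lemma MV_cost_cong:
  assumes "\<And>i c. i \<in> set I \<Longrightarrow> d - D \<le> c \<Longrightarrow> c < d \<Longrightarrow> X i c = X' i c" "D \<le> d"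
  shows "MV_cost a d m D I X = MV_cost a d m D I X'"
  using assms
proof (induction D arbitrary: I)
  case (Suc D)
  have sort: "sort_key (\<lambda>i. X i (d - Suc D)) I = sort_key (\<lambda>i. X' i (d - Suc D)) I" (is "?xs = _")
    by (rule sort_key_cong_order) (use Suc.prems in simp)
  have sub: "set (chunk w j ?xs) \<subseteq> set I" for w j
    using set_chunk_subset[of w j ?xs] by simp
  have "MV_cost a d m D (chunk w j ?xs) X = MV_cost a d m D (chunk w j ?xs) X'" for w j
  proof (rule Suc.IH)
    fix i c assume "i \<in> set (chunk w j ?xs)" "d - D \<le> c" "c < d"
    then show "X i c = X' i c" using sub[of w j] Suc.prems by (intro Suc.prems(1)) auto
  qed (use Suc.prems in auto)
  moreover have "(\<Sum>i\<in>set (chunk w j ?xs). \<bar>X i (d - Suc D) - centre m j\<bar> powr a) =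
      (\<Sum>i\<in>set (chunk w j ?xs). \<bar>X' i (d - Suc D) - centre m j\<bar> powr a)" for w j
    using sub[of w j] Suc.prems by (intro sum.cong) auto
  ultimately show ?case
    unfolding MV_cost.simps Let_def sort[symmetric] by simp
qed simp

lemma powr_add_le:
  fixes u v a :: real
  assumes "u \<ge> 0" "v \<ge> 0" "a > 0"
  shows "(u + v) powr a \<le> 2 powr a * (u powr a + v powr a)"
proof -
  have "(u + v) powr a \<le> (2 * max u v) powr a"
    using assms by (intro powr_mono2) auto
  also have "\<dots> = 2 powr a * max u v powr a"
    using assms by (simp add: powr_mult)
  also have "\<dots> \<le> 2 powr a * (u powr a + v powr a)"
    by (intro mult_left_mono) (auto simp: max_def)
  finally show ?thesis .
qed

lemma MV_displacement_mono:
  assumes "distinct I" "length I = m ^ D" "D \<le> d"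
  shows "displacement S i \<le> displacement (MV d m y b D I S) i"
  using assms
proof (induction D arbitrary: I S)
  case (Suc D)
  let ?xs = "sort_key (\<lambda>i. positions S i (d - Suc D)) I"
  show ?case
  proof (cases "i \<in> set I")
    case True
    then obtain j where j: "j < m" "i \<in> set (chunk (m ^ D) j ?xs)"
      using UN_chunks[of ?xs m "m ^ D"] Suc.prems by auto
    let ?B = "chunk (m ^ D) j ?xs"
    let ?S = "fold (move_coord d (d - Suc D) (b (d - Suc D) + y * centre m j)) ?B S"
    have B: "length ?B = m ^ D" "distinct ?B" using Suc.prems j by auto
    have "displacement S i \<le> displacement ?S i"
      using B Suc.prems(3) by (simp add: displacement_def fold_move_coord move_coord_self)
    also have "\<dots> \<le> displacement (MV d m y b D ?B ?S) i"
      by (rule Suc.IH) (use B Suc.prems in auto)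
    also have "\<dots> = displacement (MV d m y b (Suc D) I S) i"
      using MV_in_block[OF Suc.prems(1,2) j] by (simp add: MV_block_def Let_def displacement_def)
    finally show ?thesis .
  qed (use Suc.prems in \<open>simp add: MV_outside displacement_def\<close>)
qed simp

text \<open>\<open>X\<close> holds the coordinates rescaled to the unit cube: rescaling preserves
  the sorting order, and undoing it multiplies every move by \<open>y\<close>. The claim is about
  increments of the displacement because inner calls start from sensors that have already
  moved.\<close>

lemma MV_displacement_le_cost:
  assumes "distinct I" "length I = m ^ D" "D \<le> d" "y > 0" "a > 0"
    and "\<And>i c. i \<in> set I \<Longrightarrow> d - D \<le> c \<Longrightarrow> c < d \<Longrightarrow> positions S i c = b c + y * X i c"
  shows "(\<Sum>i\<in>set I. (displacement (MV d m y b D I S) i - displacement S i) powr a)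
    \<le> y powr a * MV_cost a d m D I X"
  using assms
proof (induction D arbitrary: I S)
  case (Suc D)
  define c where "c = d - Suc D"
  have c: "c < d" "d - Suc D \<le> c" using Suc.prems by (auto simp: c_def)
  define xs where "xs = sort_key (\<lambda>i. X i c) I"
  have sort: "sort_key (\<lambda>i. positions S i (d - Suc D)) I = xs"
    unfolding xs_def c_def by (rule sort_key_cong_order) (use Suc.prems in simp)
  have xs: "length xs = m * m ^ D" "distinct xs" "set xs = set I"
    using Suc.prems by (simp_all add: xs_def)
  define B where "B j = chunk (m ^ D) j xs" for j
  define T where "T j = fold (move_coord d c (b c + y * centre m j)) (B j) S" for j
  have B: "length (B j) = m ^ D" "distinct (B j)" "set (B j) \<subseteq> set I" if "j < m" for j
    using xs that set_chunk_subset[of "m ^ D" j xs] by (auto simp: B_def)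
  have block: "(\<Sum>i\<in>set (B j). (displacement (MV d m y b (Suc D) I S) i - displacement S i) powr a)
      \<le> y powr a * (2 powr a * ((\<Sum>i\<in>set (B j). \<bar>X i c - centre m j\<bar> powr a) + MV_cost a d m D (B j) X))"
    if j: "j < m" for j
  proof -
    let ?v = "\<lambda>i. displacement (MV d m y b D (B j) (T j)) i - displacement (T j) i"
    have "(displacement (MV d m y b (Suc D) I S) i - displacement S i) powr a
        \<le> 2 powr a * (y powr a * \<bar>X i c - centre m j\<bar> powr a + ?v i powr a)" if i: "i \<in> set (B j)" for i
    proof -
      have "displacement (MV d m y b (Suc D) I S) i = displacement (MV d m y b D (B j) (T j)) i"
        using MV_in_block[of I m D j i S d y b] Suc.prems j i sort
        by (simp add: MV_block_def Let_def displacement_def B_def T_def c_def)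
      moreover have "displacement (T j) i = displacement S i + \<bar>positions S i c - (b c + y * centre m j)\<bar>"
        using i B[OF j] c by (simp add: T_def displacement_def fold_move_coord move_coord_self)
      moreover have "positions S i c - (b c + y * centre m j) = y * (X i c - centre m j)"
        using Suc.prems(6)[of i c] i B(3)[OF j] c by (auto simp: algebra_simps)
      ultimately have "displacement (MV d m y b (Suc D) I S) i - displacement S i
          = y * \<bar>X i c - centre m j\<bar> + ?v i"
        using Suc.prems(4) by (simp add: abs_mult)
      moreover have "?v i \<ge> 0"
        using MV_displacement_mono[of "B j" m D d "T j" i y b] B[OF j] Suc.prems(3) by simp
      ultimately show ?thesis
        using powr_add_le[of "y * \<bar>X i c - centre m j\<bar>" "?v i" a] Suc.prems(4,5)
        by (simp add: powr_mult)
    qed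
    then have "(\<Sum>i\<in>set (B j). (displacement (MV d m y b (Suc D) I S) i - displacement S i) powr a)
      \<le> (\<Sum>i\<in>set (B j). 2 powr a * (y powr a * \<bar>X i c - centre m j\<bar> powr a + ?v i powr a))"
      by (intro sum_mono)
    also have "\<dots> = 2 powr a * (y powr a * (\<Sum>i\<in>set (B j). \<bar>X i c - centre m j\<bar> powr a) + (\<Sum>i\<in>set (B j). ?v i powr a))"
      by (simp add: sum.distrib flip: sum_distrib_left)
    also have "(\<Sum>i\<in>set (B j). ?v i powr a) \<le> y powr a * MV_cost a d m D (B j) X"
    proof (rule Suc.IH)
      fix i c' assume i: "i \<in> set (B j)" "d - D \<le> c'" "c' < d"
      have "c' \<noteq> c" using i Suc.prems(3) by (auto simp: c_def)
      then have "positions (T j) i c' = positions S i c'"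
        using i B[OF j] c by (simp add: T_def positions_def fold_move_coord move_coord_self)
      then show "positions (T j) i c' = b c' + y * X i c'"
        using i Suc.prems(6)[of i c'] B(3)[OF j] by auto
    qed (use B[OF j] Suc.prems in auto)
    finally show ?thesis by (simp add: algebra_simps)
  qed
  have "(\<Sum>i\<in>set I. (displacement (MV d m y b (Suc D) I S) i - displacement S i) powr a)
      = (\<Sum>j<m. \<Sum>i\<in>set (B j). (displacement (MV d m y b (Suc D) I S) i - displacement S i) powr a)"
    using sum_chunks[OF xs(1,2)] xs(3) by (simp add: B_def)
  also have "\<dots> \<le> (\<Sum>j<m. y powr a * (2 powr a * ((\<Sum>i\<in>set (B j). \<bar>X i c - centre m j\<bar> powr a) + MV_cost a d m D (B j) X)))"
    by (intro sum_mono block) simp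
  also have "\<dots> = y powr a * MV_cost a d m (Suc D) I X"
    by (simp add: Let_def c_def xs_def B_def sum_distrib_left)
  finally show ?case .
qed simp

subsection \<open>Independent uniform points\<close>

abbreviation unif01 :: "real measure" where
  "unif01 \<equiv> uniform_measure lborel {0..1}"

lemma prob_space_unif01: "prob_space unif01"
  by (rule prob_space_uniform_measure) auto

lemma sets_unif01 [measurable_cong]: "sets unif01 = sets borel"
  by simp

lemma emeasure_unif01:
  assumes "A \<in> sets borel"
  shows "emeasure unif01 A = emeasure lborel ({0..1} \<inter> A)"
  using assms by (subst emeasure_uniform_measure) (auto simp: divide_ennreal_def)

text \<open>Both measures give a box the product of the lengths of its sides, cut down to the unit
  interval. The product form makes the coordinates of a sensor independent, which allows the
  analysis to go axis by axis.\<close>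

lemma uniform_cube_eq_PiM: "uniform_cube d = (\<Pi>\<^sub>M j\<in>{..<d}. unif01)"
proof -
  interpret U: product_prob_space "\<lambda>_. unif01" "{..<d}"
    by (simp add: product_prob_space_def product_prob_space_axioms_def product_sigma_finite_def
        prob_space_unif01 prob_space_imp_sigma_finite)
  interpret L: product_sigma_finite "\<lambda>_. lborel :: real measure" ..
  have sets: "sets (uniform_cube d) = sets (\<Pi>\<^sub>M j\<in>{..<d}. unif01)"
    by (simp add: uniform_cube_def cong: sets_PiM_cong)
  have cube: "unit_cube d \<in> sets (\<Pi>\<^sub>M j\<in>{..<d}. lborel)"
    unfolding unit_cube_def by (intro sets_PiM_I_finite) auto
  have one: "emeasure (\<Pi>\<^sub>M j\<in>{..<d}. lborel) (unit_cube d) = 1"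
    unfolding unit_cube_def by (subst L.emeasure_PiM) auto
  show ?thesis
  proof (rule U.PiM_eqI)
    fix A :: "nat \<Rightarrow> real set" assume "\<And>j. j \<in> {..<d} \<Longrightarrow> A j \<in> sets unif01"
    then have A: "\<And>j. j \<in> {..<d} \<Longrightarrow> A j \<in> sets borel" by simp
    then have PiA: "Pi\<^sub>E {..<d} A \<in> sets (\<Pi>\<^sub>M j\<in>{..<d}. lborel)"
      by (intro sets_PiM_I_finite) auto
    have "emeasure (uniform_cube d) (Pi\<^sub>E {..<d} A)
        = emeasure (\<Pi>\<^sub>M j\<in>{..<d}. lborel) (unit_cube d \<inter> Pi\<^sub>E {..<d} A)"
      unfolding uniform_cube_def by (subst emeasure_uniform_measure[OF cube PiA]) (simp add: one divide_ennreal_def)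
    also have "unit_cube d \<inter> Pi\<^sub>E {..<d} A = Pi\<^sub>E {..<d} (\<lambda>j. {0..1} \<inter> A j)"
      by (auto simp: unit_cube_def PiE_Int)
    also have "emeasure (\<Pi>\<^sub>M j\<in>{..<d}. lborel) \<dots> = (\<Prod>j<d. emeasure lborel ({0..1} \<inter> A j))"
      using A by (intro L.emeasure_PiM) auto
    also have "\<dots> = (\<Prod>j<d. emeasure unif01 (A j))"
      using A by (intro prod.cong) (auto simp: emeasure_unif01 simp del: emeasure_uniform_measure)
    finally show "emeasure (uniform_cube d) (Pi\<^sub>E {..<d} A) = (\<Prod>j<d. emeasure unif01 (A j))" .
  qed (use sets in auto)
qed

lemma prob_space_uniform_cube: "prob_space (uniform_cube d)"
  unfolding uniform_cube_eq_PiM by (intro prob_space_PiM prob_space_unif01)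

lemma prob_space_placement: "prob_space (placement d n)"
  unfolding placement_def by (intro prob_space_PiM prob_space_uniform_cube)

lemma measurable_coordinate [measurable]: "(\<lambda>x. x c) \<in> borel_measurable (uniform_cube d)"
proof (cases "c < d")
  case True
  have "(\<lambda>x. x c) \<in> measurable (\<Pi>\<^sub>M j\<in>{..<d}. unif01) unif01"
    by (rule measurable_component_singleton) (use True in simp)
  then show ?thesis
    unfolding uniform_cube_eq_PiM by (simp add: measurable_def)
next
  case False
  \<comment> \<open>Points of the product space are extensional, so a coordinate outside the index
    set is constant.\<close>
  have "x c = undefined" if "x \<in> space (uniform_cube d)" for x
    using that False by (auto simp: uniform_cube_eq_PiM space_PiM PiE_def extensional_def)
  then show ?thesis by (subst measurable_cong[where g = "\<lambda>_. undefined"]) auto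
qed

lemma measurable_sensor [measurable (raw)]:
  "i < n \<Longrightarrow> (\<lambda>X. X i) \<in> measurable (placement d n) (uniform_cube d)"
  unfolding placement_def by (rule measurable_component_singleton) simp

lemma measurable_sensor_coordinate [measurable]:
  "(\<lambda>X. X i c) \<in> borel_measurable (placement d n)"
proof (cases "i < n")
  case True
  show ?thesis by (rule measurable_compose[OF measurable_sensor[OF True] measurable_coordinate])
next
  case False
  have "X i = undefined" if "X \<in> space (placement d n)" for X
    using that False by (auto simp: placement_def space_PiM PiE_def extensional_def)
  then show ?thesis by (subst measurable_cong[where g = "\<lambda>_. undefined c"]) auto
qed

text \<open>The strict upper bound is the one that \<open>slice_eq\<close> asks for: a position
  inside a slice must stay off its right end.\<close>

lemma AE_unif01: "AE x in unif01. 0 \<le> x \<and> x < 1"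
proof -
  have "AE x in lborel. x \<noteq> (1::real)"
    by (rule AE_lborel_singleton)
  then show ?thesis
    by (intro AE_uniform_measureI) auto
qed

lemma AE_uniform_cube: "AE x in uniform_cube d. \<forall>c<d. 0 \<le> x c \<and> x c < 1"
proof -
  have "AE x in uniform_cube d. \<forall>c\<in>{..<d}. 0 \<le> x c \<and> x c < 1"
    unfolding uniform_cube_eq_PiM
    by (intro AE_finite_allI AE_PiM_component prob_space_unif01 AE_unif01) auto
  then show ?thesis by eventually_elim auto
qed

lemma AE_placement: "AE X in placement d n. \<forall>i<n. \<forall>c<d. 0 \<le> X i c \<and> X i c < 1"
proof -
  have "AE X in placement d n. \<forall>i\<in>{..<n}. \<forall>c<d. 0 \<le> X i c \<and> X i c < 1"
    unfolding placement_def
    by (intro AE_finite_allI AE_PiM_component prob_space_uniform_cube AE_uniform_cube) auto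
  then show ?thesis by eventually_elim auto
qed

subsection \<open>Resampling\<close>

text \<open>Independence is used only in this form: replacing part of the randomness of a sample \<open>x\<close>
  by that of an independent copy \<open>y\<close>, via \<open>h (x, y)\<close>, does not change the distribution.\<close>

definition resamples :: "'a measure \<Rightarrow> ('a \<times> 'a \<Rightarrow> 'a) \<Rightarrow> bool" where
  "resamples Q h \<longleftrightarrow> h \<in> measurable (Q \<Otimes>\<^sub>M Q) Q \<and> distr (Q \<Otimes>\<^sub>M Q) Q h = Q"

lemma resamples_fst: "prob_space Q \<Longrightarrow> resamples Q fst"
  by (simp add: resamples_def prob_space.distr_pair_fst)

lemma resamples_snd:
  assumes "prob_space Q"
  shows "resamples Q snd"
proof -
  interpret prob_space Q by fact
  have "distr (Q \<Otimes>\<^sub>M Q) Q snd = Q"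
  proof (intro measure_eqI)
    fix A assume "A \<in> sets (distr (Q \<Otimes>\<^sub>M Q) Q snd)"
    then have A: "A \<in> sets Q" by simp
    then have "snd -` A \<inter> space (Q \<Otimes>\<^sub>M Q) = space Q \<times> A"
      by (auto simp: space_pair_measure dest: sets.sets_into_space)
    with A show "emeasure (distr (Q \<Otimes>\<^sub>M Q) Q snd) A = emeasure Q A"
      by (simp add: emeasure_distr emeasure_pair_measure_Times emeasure_space_1)
  qed simp
  then show ?thesis by (simp add: resamples_def)
qed

text \<open>Compare on boxes: for fixed \<open>X\<close> the preimage of a box under the combined
  map is again a box, so its measure is a product of functions of the single \<open>X i\<close>, and
  the outer integral factors as well.\<close>

lemma resamples_PiM:
  fixes I :: "'i set"
  assumes "finite I" "prob_space Q" and h: "\<And>i. i \<in> I \<Longrightarrow> resamples Q (h i)"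
  shows "resamples (\<Pi>\<^sub>M i\<in>I. Q) (\<lambda>(X, Y). \<lambda>i\<in>I. h i (X i, Y i))"
proof -
  interpret Q: prob_space Q by fact
  interpret P: product_prob_space "\<lambda>_. Q" I
    by unfold_locales
  let ?P = "\<Pi>\<^sub>M i\<in>I. Q" and ?H = "\<lambda>(X, Y). \<lambda>i\<in>I. h i (X i, Y i)"
  have [measurable]: "h i \<in> measurable (Q \<Otimes>\<^sub>M Q) Q" if "i \<in> I" for i
    using h that by (simp add: resamples_def)
  have H[measurable]: "?H \<in> measurable (?P \<Otimes>\<^sub>M ?P) ?P"
  proof -
    have "(\<lambda>Z. h i (fst Z i, snd Z i)) \<in> measurable (?P \<Otimes>\<^sub>M ?P) Q" if "i \<in> I" for i
      using that by measurable
    then show ?thesis unfolding split_beta by (intro measurable_restrict)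
  qed
  have "distr (?P \<Otimes>\<^sub>M ?P) ?P ?H = ?P"
  proof (rule P.PiM_eqI)
    fix A assume A: "\<And>i. i \<in> I \<Longrightarrow> A i \<in> sets Q"
    define f where "f i x = emeasure Q (Pair x -` (h i -` A i \<inter> space (Q \<Otimes>\<^sub>M Q)))" for i x
    have hA: "h i -` A i \<inter> space (Q \<Otimes>\<^sub>M Q) \<in> sets (Q \<Otimes>\<^sub>M Q)" if "i \<in> I" for i
      using A[OF that] that by measurable
    have PiA: "Pi\<^sub>E I A \<in> sets ?P"
      using A \<open>finite I\<close> by (intro sets_PiM_I_finite) auto
    have "emeasure (distr (?P \<Otimes>\<^sub>M ?P) ?P ?H) (Pi\<^sub>E I A)
        = emeasure (?P \<Otimes>\<^sub>M ?P) (?H -` Pi\<^sub>E I A \<inter> space (?P \<Otimes>\<^sub>M ?P))"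
      by (rule emeasure_distr[OF H PiA])
    also have "\<dots> = (\<integral>\<^sup>+X. emeasure ?P (Pair X -` (?H -` Pi\<^sub>E I A \<inter> space (?P \<Otimes>\<^sub>M ?P))) \<partial>?P)"
      by (rule P.emeasure_pair_measure_alt) (rule measurable_sets[OF H PiA])
    also have "\<dots> = (\<integral>\<^sup>+X. (\<Prod>i\<in>I. f i (X i)) \<partial>?P)"
    proof (rule nn_integral_cong)
      fix X assume X: "X \<in> space ?P"
      have "Pair X -` (?H -` Pi\<^sub>E I A \<inter> space (?P \<Otimes>\<^sub>M ?P))
          = Pi\<^sub>E I (\<lambda>i. Pair (X i) -` (h i -` A i \<inter> space (Q \<Otimes>\<^sub>M Q)))"
        using X by (auto simp: space_pair_measure space_PiM PiE_iff)
      also have "emeasure ?P \<dots> = (\<Prod>i\<in>I. f i (X i))"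
        unfolding f_def by (rule P.emeasure_PiM[OF \<open>finite I\<close>]) (rule sets_Pair1[OF hA])
      finally show "emeasure ?P (Pair X -` (?H -` Pi\<^sub>E I A \<inter> space (?P \<Otimes>\<^sub>M ?P))) = (\<Prod>i\<in>I. f i (X i))" .
    qed
    also have "\<dots> = (\<Prod>i\<in>I. \<integral>\<^sup>+x. f i x \<partial>Q)"
      unfolding f_def
      by (rule P.product_nn_integral_prod[OF \<open>finite I\<close>]) (rule Q.measurable_emeasure_Pair[OF hA])
    also have "\<dots> = (\<Prod>i\<in>I. emeasure Q (A i))"
    proof (rule prod.cong)
      fix i assume i: "i \<in> I"
      have "(\<integral>\<^sup>+x. f i x \<partial>Q) = emeasure (Q \<Otimes>\<^sub>M Q) (h i -` A i \<inter> space (Q \<Otimes>\<^sub>M Q))"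
        unfolding f_def by (rule Q.emeasure_pair_measure_alt[symmetric]) (rule hA[OF i])
      also have "\<dots> = emeasure (distr (Q \<Otimes>\<^sub>M Q) Q (h i)) (A i)"
        using A[OF i] i by (simp add: emeasure_distr)
      finally show "(\<integral>\<^sup>+x. f i x \<partial>Q) = emeasure Q (A i)"
        using h[OF i] by (simp add: resamples_def)
    qed simp
    finally show "emeasure (distr (?P \<Otimes>\<^sub>M ?P) ?P ?H) (Pi\<^sub>E I A) = (\<Prod>i\<in>I. emeasure Q (A i))" .
  qed (use \<open>finite I\<close> in auto)
  with H show ?thesis by (simp add: resamples_def)
qed

lemma nn_integral_resamples:
  assumes "prob_space Q" "resamples Q h" and [measurable]: "f \<in> borel_measurable Q"
  shows "(\<integral>\<^sup>+x. f x \<partial>Q) = (\<integral>\<^sup>+x. \<integral>\<^sup>+y. f (h (x, y)) \<partial>Q \<partial>Q)"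
proof -
  interpret prob_space Q by fact
  have [measurable]: "h \<in> measurable (Q \<Otimes>\<^sub>M Q) Q"
    using assms by (simp add: resamples_def)
  have "(\<integral>\<^sup>+x. f x \<partial>Q) = (\<integral>\<^sup>+x. f x \<partial>distr (Q \<Otimes>\<^sub>M Q) Q h)"
    using assms by (simp add: resamples_def)
  also have "\<dots> = (\<integral>\<^sup>+z. f (h z) \<partial>(Q \<Otimes>\<^sub>M Q))"
    by (rule nn_integral_distr) measurable
  also have "\<dots> = (\<integral>\<^sup>+x. \<integral>\<^sup>+y. f (h (x, y)) \<partial>Q \<partial>Q)"
    by (rule nn_integral_fst[symmetric]) measurable
  finally show ?thesis .
qed

text \<open>\<open>resamples_PiM\<close> is applied twice, over the coordinates of a sensor and over
  the sensors. Two choices of \<open>h\<close> occur later: keep one axis and redraw the others, or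
  keep the slice of each coordinate and redraw the position in it.\<close>

lemma nn_integral_resamples_placement:
  assumes h: "\<And>i c. i < n \<Longrightarrow> c < d \<Longrightarrow> resamples unif01 (h i c)"
    and [measurable]: "f \<in> borel_measurable (placement d n)"
  shows "(\<integral>\<^sup>+X. f X \<partial>placement d n) = (\<integral>\<^sup>+X. \<integral>\<^sup>+Y.
    f (\<lambda>i\<in>{..<n}. \<lambda>c\<in>{..<d}. h i c (X i c, Y i c)) \<partial>placement d n \<partial>placement d n)"
proof -
  have "resamples (uniform_cube d) (\<lambda>(x, y). \<lambda>c\<in>{..<d}. h i c (x c, y c))" if "i < n" for i
    unfolding uniform_cube_eq_PiM using that by (intro resamples_PiM prob_space_unif01 h) auto
  then have "resamples (placement d n)
      (\<lambda>(X, Y). \<lambda>i\<in>{..<n}. (\<lambda>(x, y). \<lambda>c\<in>{..<d}. h i c (x c, y c)) (X i, Y i))"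
    unfolding placement_def
    by (intro resamples_PiM[where h = "\<lambda>i (x, y). \<lambda>c\<in>{..<d}. h i c (x c, y c)"] prob_space_uniform_cube) auto
  from nn_integral_resamples[OF prob_space_placement this assms(2)] show ?thesis by simp
qed

subsection \<open>Order statistics\<close>

lemma indep_vars_PiM_components:
  assumes "finite I" "I \<noteq> {}" "prob_space Q"
  shows "prob_space.indep_vars (\<Pi>\<^sub>M i\<in>I. Q) (\<lambda>_. Q) (\<lambda>i X. X i) I"
proof -
  interpret Q: prob_space Q by fact
  interpret P: product_prob_space "\<lambda>_. Q" I
    by unfold_locales
  let ?P = "\<Pi>\<^sub>M i\<in>I. Q"
  have "distr ?P ?P (\<lambda>X. \<lambda>i\<in>I. X i) = distr ?P ?P (\<lambda>X. X)"
    by (rule distr_cong) (auto simp: space_PiM PiE_restrict)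
  also have "\<dots> = ?P" by simp
  also have "\<dots> = (\<Pi>\<^sub>M i\<in>I. distr ?P Q (\<lambda>X. X i))"
    by (rule PiM_cong) (auto intro: distr_PiM_component[symmetric] Q.prob_space_axioms)
  finally show ?thesis
    using assms(2) by (subst P.indep_vars_iff_distr_eq_PiM') auto
qed

lemma Hoeffding_count:
  fixes S :: "nat set"
  assumes "S \<subseteq> {..<n}" "S \<noteq> {}" "prob_space Q" and A: "A \<in> sets Q" and "\<epsilon> \<ge> 0"
  defines "P \<equiv> \<Pi>\<^sub>M i\<in>{..<n}. Q"
  shows "measure P {X \<in> space P. real (card {s\<in>S. X s \<in> A}) \<ge> card S * measure Q A + \<epsilon>}
      \<le> exp (- 2 * \<epsilon>\<^sup>2 / card S)"
    and "measure P {X \<in> space P. real (card {s\<in>S. X s \<in> A}) \<le> card S * measure Q A - \<epsilon>}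
      \<le> exp (- 2 * \<epsilon>\<^sup>2 / card S)"
proof -
  interpret Q: prob_space Q by fact
  interpret P: prob_space P
    unfolding P_def by (rule prob_space_PiM) (rule assms(3))
  have fin: "finite S" using finite_subset[OF assms(1)] by simp
  define ind where "ind s X = indicat_real A (X s)" for s :: nat and X :: "nat \<Rightarrow> 'a"
  have "{..<n} \<noteq> {}" using assms(1,2) by auto
  then have all: "P.indep_vars (\<lambda>_. Q) (\<lambda>i X. X i) {..<n}"
    unfolding P_def by (intro indep_vars_PiM_components finite_lessThan assms(3))
  have "P.indep_vars (\<lambda>_. Q) (\<lambda>i X. X i) S"
    using all assms(1) by (rule P.indep_vars_subset)
  then have indep: "P.indep_vars (\<lambda>_. borel) ind S"
    unfolding ind_def by (rule P.indep_vars_compose2) (rule borel_measurable_indicator[OF A])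
  have E: "P.expectation (ind s) = measure Q A" if "s \<in> S" for s
  proof -
    have "P.expectation (ind s) = (\<integral>x. indicat_real A x \<partial>distr P Q (\<lambda>X. X s))"
      unfolding ind_def using that assms(1) A P_def by (intro integral_distr[symmetric]) auto
    also have "distr P Q (\<lambda>X. X s) = Q"
      unfolding P_def by (rule distr_PiM_component) (use assms(1-3) that in auto)
    finally show ?thesis using A by simp
  qed
  have mean: "card S * measure Q A = (\<Sum>s\<in>S. P.expectation (ind s))"
    by (simp add: E)
  interpret H: Hoeffding_ineq P S ind "\<lambda>_. 0" "\<lambda>_. 1" "card S * measure Q A"
  proof unfold_locales
    show "AE X in P. ind s X \<in> {0..1}" if "s \<in> S" for s
      by (simp add: ind_def indicator_def)
  qed (fact fin indep eq_reflection[OF mean])+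
  have count: "(\<Sum>s\<in>S. ind s X) = real (card {s\<in>S. X s \<in> A})" for X
    using fin by (simp add: ind_def indicator_def sum.If_cases Int_def)
  have "card S > 0" using fin assms(2) by (simp add: card_gt_0_iff)
  then have pos: "(\<Sum>s\<in>S. (1 - 0 :: real)\<^sup>2) > 0" by simp
  show "measure P {X \<in> space P. real (card {s\<in>S. X s \<in> A}) \<ge> card S * measure Q A + \<epsilon>}
      \<le> exp (- 2 * \<epsilon>\<^sup>2 / card S)"
    using H.Hoeffding_ineq_ge[OF assms(5) pos] unfolding count by simp
  show "measure P {X \<in> space P. real (card {s\<in>S. X s \<in> A}) \<le> card S * measure Q A - \<epsilon>}
      \<le> exp (- 2 * \<epsilon>\<^sup>2 / card S)"
    using H.Hoeffding_ineq_le[OF assms(5) pos] unfolding count by simp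
qed


subsection \<open>Measurability\<close>

lemma measurable_insort_key:
  fixes f :: "'x \<Rightarrow> 'i::countable \<Rightarrow> real"
  assumes [measurable]: "\<And>i. (\<lambda>x. f x i) \<in> borel_measurable M"
  shows "(\<lambda>x. insort_key (f x) i ys) \<in> measurable M (count_space UNIV)"
proof (induction ys)
  case (Cons y ys)
  have "(\<lambda>x. y # insort_key (f x) i ys) \<in> measurable M (count_space UNIV)"
    by (rule measurable_compose[OF Cons.IH]) simp
  moreover have "{x \<in> space M. f x i \<le> f x y} \<in> sets M"
    by measurable
  ultimately have "(\<lambda>x. if f x i \<le> f x y then i # y # ys else y # insort_key (f x) i ys) \<in> measurable M (count_space UNIV)"
    by (intro measurable_If) simp_all
  then show ?case by simp
qed simp

text \<open>There are only countably many lists, so the sorted list is a discrete random variable;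
  with \<open>measurable_compose_countable\<close> it can later be treated as a constant.\<close>

lemma measurable_sort_key:
  fixes f :: "'x \<Rightarrow> 'i::countable \<Rightarrow> real"
  assumes "\<And>i. (\<lambda>x. f x i) \<in> borel_measurable M"
  shows "(\<lambda>x. sort_key (f x) I) \<in> measurable M (count_space UNIV)"
proof (induction I)
  case (Cons i I)
  show ?case
    using measurable_compose_countable[where f = "\<lambda>ys x. insort_key (f x) i ys", OF measurable_insort_key Cons.IH] assms
    by simp
qed simp

text \<open>Componentwise, so that no sigma-algebra on the type \<open>state\<close> has to be
  fixed.\<close>

definition measurable_state :: "'x measure \<Rightarrow> ('x \<Rightarrow> state) \<Rightarrow> bool" where
  "measurable_state M S \<longleftrightarrow> (\<forall>i c. (\<lambda>x. positions (S x) i c) \<in> borel_measurable M) \<and>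
     (\<forall>i. (\<lambda>x. displacement (S x) i) \<in> borel_measurable M)"

lemma measurable_state_start:
  assumes "\<And>i c. (\<lambda>x. X x i c) \<in> borel_measurable M"
  shows "measurable_state M (\<lambda>x. start (X x))"
  using assms by (simp add: measurable_state_def start_def positions_def displacement_def)

lemma measurable_state_move_coord:
  assumes "measurable_state M S"
  shows "measurable_state M (\<lambda>x. move_coord d c t i (S x))"
proof -
  have S: "(\<lambda>x. positions (S x) i c) \<in> borel_measurable M"
    "(\<lambda>x. displacement (S x) i) \<in> borel_measurable M" for i c
    using assms by (simp_all add: measurable_state_def)
  have pos: "positions (move_coord d c t i (S x)) i' c'
      = (if i' = i \<and> c' = c then t else positions (S x) i' c')" for x i' c'
    by (simp add: move_coord_def Let_def positions_def)
  have "(\<lambda>x. positions (move_coord d c t i (S x)) i' c') \<in> borel_measurable M" for i' c'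
    unfolding pos using S by (cases "i' = i \<and> c' = c") simp_all
  \<comment> \<open>The factor \<open>if j = c\<close> covers \<open>c \<ge> d\<close> too: then
    every summand is 0.\<close>
  moreover have dist: "euclid_dist d (positions (S x) i) ((positions (S x) i)(c := t))
      = sqrt (\<Sum>j<d. (if j = c then 1 else 0) * (positions (S x) i c - t)\<^sup>2)" for x
    unfolding euclid_dist_def L2_set_def by (intro arg_cong[where f = sqrt] sum.cong) auto
  have disp: "displacement (move_coord d c t i (S x)) i' = (if i' = i
      then displacement (S x) i + sqrt (\<Sum>j<d. (if j = c then 1 else 0) * (positions (S x) i c - t)\<^sup>2)
      else displacement (S x) i')" for x i'
    unfolding dist[symmetric] by (simp add: move_coord_def Let_def displacement_def positions_def)
  have "(\<lambda>x. displacement (move_coord d c t i (S x)) i') \<in> borel_measurable M" for i'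
  proof (cases "i' = i")
    case True
    show ?thesis
      unfolding disp if_P[OF True]
      by (intro borel_measurable_add S measurable_compose[OF _ borel_measurable_sqrt] borel_measurable_sum borel_measurable_times
          borel_measurable_power borel_measurable_diff borel_measurable_const)
  next
    case False
    then show ?thesis unfolding disp by (simp add: S)
  qed
  ultimately show ?thesis by (simp add: measurable_state_def)
qed

lemma measurable_state_fold:
  assumes "\<And>j S. j \<in> set js \<Longrightarrow> measurable_state M S \<Longrightarrow> measurable_state M (\<lambda>x. G j (S x))"
    and "measurable_state M S"
  shows "measurable_state M (\<lambda>x. fold G js (S x))"
  using assms
proof (induction js arbitrary: S)
  case (Cons j js)
  have "measurable_state M (\<lambda>x. G j (S x))"
    by (rule Cons.prems(1)[OF _ Cons.prems(2)]) simp
  then have "measurable_state M (\<lambda>x. fold G js (G j (S x)))"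
    by (rule Cons.IH[OF Cons.prems(1), rotated 2]) simp_all
  then show ?case by (simp only: fold_simps)
qed simp

text \<open>The sorted list is one of countably many constants: for each fixed list the map is
  measurable by \<open>G\<close>, and the pieces are glued along the measurable list.\<close>

lemma measurable_state_sort:
  fixes G :: "nat list \<Rightarrow> state \<Rightarrow> state"
  assumes S: "measurable_state M S" and G: "\<And>xs. measurable_state M (\<lambda>x. G xs (S x))"
  shows "measurable_state M (\<lambda>x. G (sort_key (\<lambda>i. positions (S x) i c) I) (S x))"
proof -
  have sort: "(\<lambda>x. sort_key (\<lambda>i. positions (S x) i c) I) \<in> measurable M (count_space UNIV)"
    using S by (intro measurable_sort_key) (simp add: measurable_state_def)
  have "(\<lambda>x. positions (G (sort_key (\<lambda>i. positions (S x) i c) I) (S x)) i c') \<in> borel_measurable M" for i c'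
    by (rule measurable_compose_countable[where f = "\<lambda>xs x. positions (G xs (S x)) i c'", OF _ sort])
      (use G in \<open>simp only: measurable_state_def\<close>)
  moreover have "(\<lambda>x. displacement (G (sort_key (\<lambda>i. positions (S x) i c) I) (S x)) i) \<in> borel_measurable M" for i
    by (rule measurable_compose_countable[where f = "\<lambda>xs x. displacement (G xs (S x)) i", OF _ sort])
      (use G in \<open>simp only: measurable_state_def\<close>)
  ultimately show ?thesis unfolding measurable_state_def by blast
qed

lemma measurable_state_MV:
  assumes "measurable_state M S"
  shows "measurable_state M (\<lambda>x. MV d m y b D I (S x))"
  using assms
proof (induction D arbitrary: I S rule: induct_nat_012)
  case 1
  show ?case
    unfolding MV.simps Let_def
    by (rule measurable_state_sort[OF 1])
      (rule measurable_state_fold[OF _ 1], erule measurable_state_move_coord)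
next
  case (ge2 D)
  show ?case
    unfolding MV.simps Let_def
    by (rule measurable_state_sort[OF ge2.prems])
      (rule measurable_state_fold[OF _ ge2.prems], rule ge2.IH(2),
        rule measurable_state_fold, erule measurable_state_move_coord)
qed simp

lemma measurable_MV_displacement [measurable]:
  "(\<lambda>X. displacement (MV d m y b D I (start X)) i) \<in> borel_measurable (placement d' n)"
proof -
  have "measurable_state (placement d' n) (\<lambda>X. MV d m y b D I (start X))"
    by (intro measurable_state_MV measurable_state_start) measurable
  then show ?thesis by (simp add: measurable_state_def)
qed

lemma measurable_MV_cost [measurable]:
  "(\<lambda>X. MV_cost a d m D I X) \<in> borel_measurable (placement d' n)"
proof (induction D arbitrary: I)
  case (Suc D)
  note [measurable] = Suc.IH
  have sort: "(\<lambda>X. sort_key (\<lambda>i. X i (d - Suc D)) I) \<in> measurable (placement d' n) (count_space UNIV)"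
    by (intro measurable_sort_key) measurable
  show ?case
    unfolding MV_cost.simps Let_def
    by (rule measurable_compose_countable[OF _ sort]) measurable
qed (simp add: MV_cost.simps(1)[abs_def])

subsection \<open>Moments of order statistics\<close>

text \<open>Keys are nondecreasing along the sorted list, so in the first case a key at most
  \<open>t\<close> sits before position \<open>r\<close>, and in the second positions
  \<open>0\<close> to \<open>r\<close> all qualify. This turns a statement about an order statistic
  into one about a count, to which Hoeffding's inequality applies.\<close>

lemma sort_key_nth_count:
  fixes f :: "'i \<Rightarrow> real"
  assumes "distinct I" "r < length I"
  shows "t < f (sort_key f I ! r) \<Longrightarrow> card {s\<in>set I. f s \<le> t} \<le> r"
    and "f (sort_key f I ! r) \<le> t \<Longrightarrow> r < card {s\<in>set I. f s \<le> t}"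
proof -
  let ?xs = "sort_key f I"
  have mono: "f (?xs ! q) \<le> f (?xs ! q')" if "q \<le> q'" "q' < length I" for q q'
    using sorted_nth_mono[OF sorted_sort_key[of f I], of q q'] that by simp
  {
    assume "t < f (?xs ! r)"
    then have "{s\<in>set I. f s \<le> t} \<subseteq> (!) ?xs ` {..<r}"
    proof (intro subsetI)
      fix s assume s: "s \<in> {s\<in>set I. f s \<le> t}"
      then have "s \<in> set ?xs" by simp
      then obtain q where q: "q < length I" "s = ?xs ! q"
        by (metis in_set_conv_nth length_sort)
      then have "q < r" using mono[of r q] s \<open>t < f (?xs ! r)\<close> by force
      then show "s \<in> (!) ?xs ` {..<r}" using q by auto
    qed
    then show "card {s\<in>set I. f s \<le> t} \<le> r"
      using surj_card_le[of "{..<r}"] by fastforce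
  }
  {
    assume t: "f (?xs ! r) \<le> t"
    have "(!) ?xs ` {..r} \<subseteq> {s\<in>set I. f s \<le> t}"
    proof (intro image_subsetI)
      fix q assume "q \<in> {..r}"
      then have q: "q \<le> r" "q < length ?xs" using assms(2) by auto
      then show "?xs ! q \<in> {s\<in>set I. f s \<le> t}"
        using mono[of q r] assms(2) t nth_mem[of q ?xs] by auto
    qed
    then have "card ((!) ?xs ` {..r}) \<le> card {s\<in>set I. f s \<le> t}"
      by (intro card_mono) auto
    moreover have "inj_on ((!) ?xs) {..r}"
      using assms by (intro inj_on_nth) auto
    ultimately show "r < card {s\<in>set I. f s \<le> t}"
      by (simp add: card_image)
  }
qed

lemma measure_uniform_cube_le:
  assumes "c < d" "0 \<le> t" "t \<le> 1"
  shows "measure (uniform_cube d) {x \<in> space (uniform_cube d). x c \<le> t} = t"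
proof -
  have "measure unif01 {..t} = measure (distr (uniform_cube d) unif01 (\<lambda>x. x c)) {..t}"
    unfolding uniform_cube_eq_PiM using assms by (subst distr_PiM_component) (auto simp: prob_space_unif01)
  also have "\<dots> = measure (uniform_cube d) {x \<in> space (uniform_cube d). x c \<le> t}"
    by (subst measure_distr) (auto simp: measurable_def intro!: arg_cong[where f = "measure _"])
  finally have "measure (uniform_cube d) {x \<in> space (uniform_cube d). x c \<le> t} = measure unif01 {..t}" ..
  also have "\<dots> = measure lborel {0..t}"
  proof -
    have "{0..1} \<inter> {..t} = {0..t}" using assms by auto
    moreover have "{..t} \<in> sets borel" by simp
    ultimately show ?thesis by (simp only: measure_def emeasure_unif01)
  qed
  finally show ?thesis using assms by simp
qed

lemma measurable_count:
  assumes "S \<subseteq> {..<n}" "A \<in> sets (uniform_cube d)"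
  shows "(\<lambda>X. real (card {s\<in>S. X s \<in> A})) \<in> borel_measurable (placement d n)"
proof -
  have fin: "finite S" using finite_subset[OF assms(1)] by simp
  have "real (card {s\<in>S. X s \<in> A}) = (\<Sum>s\<in>S. indicat_real A (X s))" for X :: "nat \<Rightarrow> point"
    using fin by (simp add: indicator_def sum.If_cases Int_def)
  moreover have "(\<lambda>X. indicat_real A (X s)) \<in> borel_measurable (placement d n)" if "s \<in> S" for s
    using that assms by (intro measurable_compose[OF measurable_sensor]) auto
  ultimately show ?thesis by simp
qed

text \<open>Write \<open>N\<close> for the length of \<open>I\<close>. If the order statistic
  exceeds \<open>t1 = r / N + \<epsilon>\<close>, then at most
  \<open>r = N * t1 - N * \<epsilon>\<close> points lie below \<open>t1\<close>, a deviation of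
  \<open>N * \<epsilon>\<close> from the mean \<open>N * t1\<close>; Hoeffding bounds its
  probability by \<open>exp (- 2 * (N * \<epsilon>)\<^sup>2 / N)\<close>. The lower side is
  symmetric.\<close>

lemma order_statistic_tail:
  fixes \<epsilon> :: real
  assumes I: "distinct I" "set I \<subseteq> {..<n}" and r: "r < length I" and c: "c < d" and "\<epsilon> \<ge> 0"
  shows "measure (placement d n) {X \<in> space (placement d n).
      \<bar>X (sort_key (\<lambda>i. X i c) I ! r) c - r / length I\<bar> > \<epsilon>} \<le> 2 * exp (- 2 * length I * \<epsilon>\<^sup>2)"
proof -
  let ?P = "placement d n" and ?Q = "uniform_cube d" and ?N = "real (length I)"
  interpret P: prob_space ?P by (rule prob_space_placement)
  have N: "?N > 0" using r by auto
  define v where "v X = X (sort_key (\<lambda>i. X i c) I ! r) c" for X :: "nat \<Rightarrow> point"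
  define A where "A t = {x \<in> space ?Q. x c \<le> t}" for t :: real
  define cnt where "cnt t X = real (card {s\<in>set I. X s \<in> A t})" for t and X :: "nat \<Rightarrow> point"
  have A: "A t \<in> sets ?Q" for t
    unfolding A_def by measurable
  have [measurable]: "cnt t \<in> borel_measurable ?P" for t
    unfolding cnt_def by (rule measurable_count[OF I(2) A])
  have cnt: "cnt t X = real (card {s\<in>set I. X s c \<le> t})" if "X \<in> space ?P" for t X
  proof -
    have "X s \<in> space ?Q" if "s \<in> set I" for s
      using \<open>X \<in> space ?P\<close> that I(2) by (auto simp: placement_def space_PiM)
    then show ?thesis unfolding cnt_def A_def by (intro arg_cong[where f = "\<lambda>B. real (card B)"]) auto
  qed
  have lower: "cnt t X \<le> r" if "X \<in> space ?P" "t < v X" for t X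
    using sort_key_nth_count(1)[OF I(1) r, of t "\<lambda>i. X i c"] that by (simp add: cnt v_def)
  have upper: "r < cnt t X" if "X \<in> space ?P" "v X \<le> t" for t X
    using sort_key_nth_count(2)[OF I(1) r, of "\<lambda>i. X i c" t] that by (simp add: cnt v_def)
  have ne: "set I \<noteq> {}" using r by auto
  have card: "card (set I) = length I" using I(1) by (rule distinct_card)
  define t1 where "t1 = r / ?N + \<epsilon>"
  define t2 where "t2 = r / ?N - \<epsilon>"
  \<comment> \<open>For \<open>t1 > 1\<close> the mean of the count is no longer
    \<open>N * t1\<close>, but then the order statistic exceeds \<open>t1\<close> with probability
    0, since the points lie in the unit interval almost surely. Likewise for
    \<open>t2 < 0\<close>.\<close>
  define A1 where "A1 = (if t1 \<le> 1 then {X \<in> space ?P. cnt t1 X \<le> ?N * t1 - ?N * \<epsilon>} else {})"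
  define A2 where "A2 = (if t2 \<ge> 0 then {X \<in> space ?P. cnt t2 X \<ge> ?N * t2 + ?N * \<epsilon>} else {})"
  have expo: "2 * (?N * \<epsilon>)\<^sup>2 / ?N = 2 * ?N * \<epsilon>\<^sup>2"
    using N by (simp add: power2_eq_square)
  have meas: "A1 \<in> sets ?P" "A2 \<in> sets ?P"
    by (cases "t1 \<le> 1"; simp add: A1_def) (cases "t2 \<ge> 0"; simp add: A2_def)
  have A1: "measure ?P A1 \<le> exp (- 2 * ?N * \<epsilon>\<^sup>2)"
  proof (cases "t1 \<le> 1")
    case True
    have t1: "t1 \<ge> 0" using assms(5) by (simp add: t1_def)
    have "measure ?P {X \<in> space ?P. cnt t1 X \<le> card (set I) * measure ?Q (A t1) - ?N * \<epsilon>}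
        \<le> exp (- 2 * (?N * \<epsilon>)\<^sup>2 / card (set I))"
      unfolding cnt_def placement_def
      using N assms(5) by (intro Hoeffding_count(2) I(2) ne prob_space_uniform_cube A) simp
    then show ?thesis
      using True measure_uniform_cube_le[OF c t1 True] by (simp add: A1_def A_def card expo)
  qed (simp add: A1_def)
  have A2: "measure ?P A2 \<le> exp (- 2 * ?N * \<epsilon>\<^sup>2)"
  proof (cases "t2 \<ge> 0")
    case True
    have t2: "t2 \<le> 1"
    proof -
      have "r / ?N \<le> 1" using r N by (simp add: divide_simps)
      then show ?thesis using assms(5) by (simp add: t2_def)
    qed
    have "measure ?P {X \<in> space ?P. cnt t2 X \<ge> card (set I) * measure ?Q (A t2) + ?N * \<epsilon>}
        \<le> exp (- 2 * (?N * \<epsilon>)\<^sup>2 / card (set I))"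
      unfolding cnt_def placement_def
      using N assms(5) by (intro Hoeffding_count(1) I(2) ne prob_space_uniform_cube A) simp
    then show ?thesis
      using True measure_uniform_cube_le[OF c True t2] by (simp add: A2_def A_def card expo)
  qed (simp add: A2_def)
  have Nt: "?N * t1 - ?N * \<epsilon> = r" "?N * t2 + ?N * \<epsilon> = r"
    using N by (simp_all add: t1_def t2_def algebra_simps)
  have "measure ?P {X \<in> space ?P. \<bar>v X - r / ?N\<bar> > \<epsilon>} \<le> measure ?P (A1 \<union> A2)"
  proof (rule P.finite_measure_mono_AE)
    show "AE X in ?P. X \<in> {X \<in> space ?P. \<bar>v X - r / ?N\<bar> > \<epsilon>} \<longrightarrow> X \<in> A1 \<union> A2"
      using AE_placement[of n d]
    proof eventually_elim
      case (elim X)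
      have "sort_key (\<lambda>i. X i c) I ! r \<in> set I"
        using r nth_mem[of r "sort_key (\<lambda>i. X i c) I"] by simp
      then have v: "0 \<le> v X" "v X \<le> 1"
        using elim c I(2) by (force simp: v_def)+
      show ?case
      proof
        assume X: "X \<in> {X \<in> space ?P. \<bar>v X - r / ?N\<bar> > \<epsilon>}"
        then have "v X > t1 \<or> v X < t2" by (auto simp: t1_def t2_def abs_if split: if_splits)
        then consider "v X > t1" | "v X < t2" by blast
        then show "X \<in> A1 \<union> A2"
        proof cases
          case 1
          then have "X \<in> A1" using v X lower[of X t1] Nt(1) by (simp add: A1_def)
          then show ?thesis ..
        next
          case 2
          then have "X \<in> A2" using v X upper[of X t2] Nt(2) by (simp add: A2_def)
          then show ?thesis ..
        qed
      qed
    qed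
  qed (use meas in auto)
  also have "\<dots> \<le> measure ?P A1 + measure ?P A2"
    using meas by (intro measure_Un_le)
  finally show ?thesis using A1 A2 by (simp add: v_def)
qed

text \<open>The subtraction \<open>k - 1\<close> is truncated, so the first two terms both have the factor \<open>2\<close>.\<close>

definition moment_const :: "real \<Rightarrow> real" where
  "moment_const a = (\<Sum>k. (real k + 1) powr a * (2 * exp (- 2 * (real (k - 1))\<^sup>2)))"

lemma summable_moment:
  "summable (\<lambda>k. (real k + 1) powr a * (2 * exp (- 2 * (real (k - 1))\<^sup>2)))"
proof -
  have "summable (\<lambda>k. (real k + 1) powr a * (2 * exp (- 2 * (real k - 1)\<^sup>2)))"
  proof (rule summable_comparison_test_bigo)
    show "summable (\<lambda>k. norm (1 / real k ^ 2))"
      using inverse_power_summable[of 2, where 'a = real] by (simp add: field_simps)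
    show "(\<lambda>k. (real k + 1) powr a * (2 * exp (- 2 * (real k - 1)\<^sup>2))) \<in> O(\<lambda>k. 1 / real k ^ 2)"
      by real_asymp
  qed
  moreover have "eventually (\<lambda>k. (real k + 1) powr a * (2 * exp (- 2 * (real (k - 1))\<^sup>2))
      = (real k + 1) powr a * (2 * exp (- 2 * (real k - 1)\<^sup>2))) sequentially"
    using eventually_ge_at_top[of 1] by eventually_elim (simp add: of_nat_diff)
  ultimately show ?thesis using summable_cong by fast
qed

lemma moment_const_nonneg: "moment_const a \<ge> 0"
  unfolding moment_const_def by (intro suminf_nonneg summable_moment) auto

text \<open>Cut the range of \<open>u\<close> into shells of width \<open>1 / sqrt m\<close> and sum
  the tail bounds. The tail has \<open>k - 1\<close> instead of \<open>k\<close> because one unit is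
  spent on the distance from a quantile to the centre of its slab (\<open>near\<close> in
  \<open>moment_order_statistic\<close>).\<close>

lemma nn_integral_powr_le_moment:
  fixes m :: real
  assumes "prob_space M" "a > 0" "m > 0" and [measurable]: "u \<in> borel_measurable M"
    and u: "\<And>x. u x \<ge> 0"
    and tail: "\<And>k. measure M {x \<in> space M. u x > real k / sqrt m} \<le> 2 * exp (- 2 * (real (k - 1))\<^sup>2)"
  shows "(\<integral>\<^sup>+x. ennreal (u x powr a) \<partial>M) \<le> ennreal (moment_const a * m powr (- a / 2))"
proof -
  interpret prob_space M by fact
  let ?A = "\<lambda>k. {x \<in> space M. u x > real k / sqrt m}"
  let ?b = "\<lambda>k. ((real k + 1) / sqrt m) powr a"
  have "(\<integral>\<^sup>+x. ennreal (u x powr a) \<partial>M) \<le> (\<integral>\<^sup>+x. (\<Sum>k. ennreal (?b k) * indicator (?A k) x) \<partial>M)"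
  proof (rule nn_integral_mono)
    fix x assume x: "x \<in> space M"
    show "ennreal (u x powr a) \<le> (\<Sum>k. ennreal (?b k) * indicator (?A k) x)"
    proof (cases "u x = 0")
      case False
      then have pos: "u x * sqrt m > 0" using u[of x] assms(3) by simp
      \<comment> \<open>Rounding up and subtracting 1 gives shells open on the left, matching the
        strict inequality of the tail events.\<close>
      define k where "k = nat (\<lceil>u x * sqrt m\<rceil> - 1)"
      have "real k = real_of_int (\<lceil>u x * sqrt m\<rceil> - 1)"
        unfolding k_def using pos by (intro of_nat_nat) linarith
      then have k: "real k < u x * sqrt m" "u x * sqrt m \<le> real k + 1"
        by linarith+
      then have "x \<in> ?A k" "u x \<le> (real k + 1) / sqrt m"
        using x assms(3) by (simp_all add: field_simps)
      then have "ennreal (u x powr a) \<le> ennreal (?b k) * indicator (?A k) x"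
        using u[of x] assms(2) by (auto intro!: ennreal_leI powr_mono2)
      also have "\<dots> \<le> (\<Sum>k. ennreal (?b k) * indicator (?A k) x)"
      proof -
        have "sum f {k} \<le> suminf f" for f :: "nat \<Rightarrow> ennreal"
          by (intro sum_le_suminf) simp_all
        then show ?thesis by simp
      qed
      finally show ?thesis .
    qed simp
  qed
  also have "\<dots> = (\<Sum>k. ennreal (?b k) * emeasure M (?A k))"
    by (subst nn_integral_suminf) (simp_all add: nn_integral_cmult)
  also have "\<dots> \<le> (\<Sum>k. ennreal ((real k + 1) powr a * (2 * exp (- 2 * (real (k - 1))\<^sup>2))) * ennreal (m powr (- a / 2)))"
  proof (intro suminf_le)
    fix k
    have "ennreal (?b k) * emeasure M (?A k) \<le> ennreal (?b k) * ennreal (2 * exp (- 2 * (real (k - 1))\<^sup>2))"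
      using tail[of k] by (intro mult_left_mono) (simp_all add: emeasure_eq_measure)
    also have "\<dots> = ennreal ((real k + 1) powr a * (2 * exp (- 2 * (real (k - 1))\<^sup>2))) * ennreal (m powr (- a / 2))"
    proof -
      have "sqrt m powr a = m powr (a / 2)"
        using assms(3) by (simp add: powr_half_sqrt[symmetric] powr_powr)
      then have "?b k = (real k + 1) powr a * m powr (- a / 2)"
        using assms(3) by (simp add: powr_divide powr_minus divide_simps)
      then show ?thesis by (simp add: ennreal_mult' [symmetric] mult_ac)
    qed
    finally show "ennreal (?b k) * emeasure M (?A k) \<le> \<dots>" .
  qed simp_all
  also have "\<dots> = ennreal (moment_const a * m powr (- a / 2))"
    using suminf_ennreal2[OF _ summable_moment, of a] moment_const_nonneg[of a]
    by (simp add: ennreal_mult moment_const_def)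
  finally show ?thesis .
qed

text \<open>The list has \<open>m * w \<ge> m\<close> points, so a deviation of
  \<open>k' / sqrt m\<close> from the quantile has Hoeffding exponent at least
  \<open>2 * k'\<^sup>2\<close>, whatever \<open>w\<close>. Hence the bound depends on
  \<open>m\<close> only, and the same constant serves at every level of the recursion.\<close>

lemma moment_order_statistic:
  assumes I: "distinct I" "set I \<subseteq> {..<n}" "length I = m * w" and j: "j < m" and r: "r < w"
    and c: "c < d" and "a > 0"
  shows "(\<integral>\<^sup>+X. ennreal (\<bar>X (sort_key (\<lambda>i. X i c) I ! (j * w + r)) c - centre m j\<bar> powr a) \<partial>placement d n)
    \<le> ennreal (moment_const a * real m powr (- a / 2))"
proof (rule nn_integral_powr_le_moment[OF prob_space_placement assms(7)])
  let ?P = "placement d n" and ?q = "j * w + r"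
  let ?v = "\<lambda>X. X (sort_key (\<lambda>i. X i c) I ! ?q) c"
  interpret P: prob_space ?P by (rule prob_space_placement)
  show m: "real m > 0" using j by simp
  have sort: "(\<lambda>X. sort_key (\<lambda>i. X i c) I) \<in> measurable ?P (count_space UNIV)"
    by (intro measurable_sort_key) measurable
  have v[measurable]: "?v \<in> borel_measurable ?P"
    by (rule measurable_compose_countable[OF _ sort]) measurable
  then show "(\<lambda>X. \<bar>?v X - centre m j\<bar>) \<in> borel_measurable ?P" by measurable
  have q: "?q < length I" using chunk_bound[OF j, of w] I(3) r by simp
  have N: "real (length I) > 0" using q by (cases I) auto
  \<comment> \<open>Rank \<open>j * w + r\<close> among \<open>m * w\<close> points has its quantile
    in slab \<open>j\<close>.\<close>
  have near: "\<bar>?q / length I - centre m j\<bar> \<le> 1 / sqrt m"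
  proof -
    have "?q / length I - centre m j = (r / w - 1 / 2) / m"
      using m r I(3) by (simp add: centre_def field_simps)
    also have "\<bar>\<dots>\<bar> \<le> 1 / m"
    proof -
      have "0 \<le> real r / w" "real r / w \<le> 1" using r by (auto simp: divide_simps)
      then have "\<bar>r / w - 1 / 2\<bar> \<le> (1 :: real)" by linarith
      then show ?thesis using m by (simp add: abs_mult divide_simps)
    qed
    also have "1 / real m \<le> 1 / sqrt m"
      using m by (intro divide_left_mono) (auto simp: power2_eq_square intro!: real_le_lsqrt)
    finally show ?thesis .
  qed
  show "measure ?P {X \<in> space ?P. \<bar>?v X - centre m j\<bar> > real k / sqrt m} \<le> 2 * exp (- 2 * (real (k - 1))\<^sup>2)" for k
  proof (cases k)
    case 0
    have "measure ?P {X \<in> space ?P. \<bar>?v X - centre m j\<bar> > real k / sqrt m} \<le> 1"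
      by (rule P.prob_le_1)
    also have "1 \<le> 2 * exp (- 2 * (real (k - 1))\<^sup>2)" using 0 by simp
    finally show ?thesis .
  next
    case (Suc k')
    have "measure ?P {X \<in> space ?P. \<bar>?v X - centre m j\<bar> > real k / sqrt m}
        \<le> measure ?P {X \<in> space ?P. \<bar>?v X - ?q / length I\<bar> > real k' / sqrt m}"
    proof (rule P.finite_measure_mono)
      show "{X \<in> space ?P. \<bar>?v X - centre m j\<bar> > real k / sqrt m}
          \<subseteq> {X \<in> space ?P. \<bar>?v X - ?q / length I\<bar> > real k' / sqrt m}"
      proof safe
        fix X assume "real k / sqrt m < \<bar>?v X - centre m j\<bar>"
        moreover have "real k / sqrt m = real k' / sqrt m + 1 / sqrt m"
          by (simp add: Suc add_divide_distrib)
        ultimately show "real k' / sqrt m < \<bar>?v X - ?q / length I\<bar>" using near by linarith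
      qed
    qed measurable
    also have "\<dots> \<le> 2 * exp (- 2 * length I * (real k' / sqrt m)\<^sup>2)"
      using m by (intro order_statistic_tail I q c) simp
    also have "\<dots> \<le> 2 * exp (- 2 * (real k')\<^sup>2)"
    proof -
      have "(real k')\<^sup>2 \<le> length I * (real k' / sqrt m)\<^sup>2"
      proof -
        have "1 * (real k')\<^sup>2 \<le> w * (real k')\<^sup>2"
          using r by (intro mult_right_mono) auto
        then show ?thesis using m by (simp add: I(3) power_divide)
      qed
      then show ?thesis by simp
    qed
    finally show ?thesis by (simp add: Suc)
  qed
qed simp

section \<open>Expected cost of one run\<close>

fun MV_const :: "real \<Rightarrow> nat \<Rightarrow> real" where
  "MV_const a 0 = 0"
| "MV_const a (Suc D) = 2 powr a * (moment_const a + MV_const a D)"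

lemma MV_const_nonneg: "MV_const a D \<ge> 0"
  by (induction D) (simp_all add: moment_const_nonneg)

text \<open>The claim is made for every list \<open>I\<close> fixed in advance. A block is a random
  list, but after redrawing all axes except the sorted one it is fixed with respect to the fresh
  sample, so the induction hypothesis applies to it for each \<open>X\<close>.\<close>

lemma nn_integral_MV_cost:
  assumes "distinct I" "set I \<subseteq> {..<n}" "length I = m ^ D" "D \<le> d" "m > 0" "a > 0"
  shows "(\<integral>\<^sup>+X. ennreal (MV_cost a d m D I X) \<partial>placement d n)
    \<le> ennreal (MV_const a D * (real m ^ D * real m powr (- a / 2)))"
  using assms
proof (induction D arbitrary: I)
  case (Suc D)
  let ?P = "placement d n" and ?c = "d - Suc D"
  interpret P: prob_space ?P by (rule prob_space_placement)
  let ?M = "real m powr (- a / 2)"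
  define xs where "xs X = sort_key (\<lambda>i. X i ?c) I" for X :: "nat \<Rightarrow> point"
  define B where "B j X = chunk (m ^ D) j (xs X)" for j and X :: "nat \<Rightarrow> point"
  define F where "F j X = (\<Sum>r<m ^ D. \<bar>X (xs X ! (j * m ^ D + r)) ?c - centre m j\<bar> powr a)" for j X
  define R where "R j X = MV_cost a d m D (B j X) X" for j X
  have c: "?c < d" using Suc.prems by simp
  have xs: "length (xs X) = m * m ^ D" "distinct (xs X)" "set (xs X) = set I" for X
    using Suc.prems by (simp_all add: xs_def)
  have B: "length (B j X) = m ^ D" "distinct (B j X)" "set (B j X) \<subseteq> set I" if "j < m" for j X
    using xs length_chunk[OF xs(1)] that set_chunk_subset[of "m ^ D" j "xs X"] by (auto simp: B_def)
  have sort: "xs \<in> measurable ?P (count_space UNIV)"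
    unfolding xs_def by (intro measurable_sort_key) measurable
  have F_meas[measurable]: "F j \<in> borel_measurable ?P" for j
    unfolding F_def by (rule measurable_compose_countable[OF _ sort]) measurable
  have R_meas[measurable]: "R j \<in> borel_measurable ?P" for j
    unfolding R_def B_def by (rule measurable_compose_countable[OF _ sort]) measurable
  have nonneg: "F j X \<ge> 0" "R j X \<ge> 0" for j X
    by (simp_all add: F_def R_def sum_nonneg MV_cost_nonneg)
  have cost: "MV_cost a d m (Suc D) I X = 2 powr a * (\<Sum>j<m. F j X + R j X)" for X
  proof -
    have "(\<Sum>i\<in>set (B j X). \<bar>X i ?c - centre m j\<bar> powr a) = F j X" if j: "j < m" for j
    proof -
      have "inj_on (\<lambda>r. xs X ! (j * m ^ D + r)) {..<m ^ D}"
        using xs[of X] chunk_bound[OF j, of "m ^ D"] by (auto simp: inj_on_def nth_eq_iff_index_eq)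
      then show ?thesis
        unfolding B_def set_chunk[OF xs(1) j] F_def by (simp add: sum.reindex)
    qed
    then show ?thesis by (simp add: Let_def xs_def B_def R_def)
  qed
  have F: "(\<integral>\<^sup>+X. ennreal (F j X) \<partial>?P) \<le> ennreal (real m ^ D * (moment_const a * ?M))" if j: "j < m" for j
  proof -
    have [measurable]: "(\<lambda>X. X (xs X ! q) ?c) \<in> borel_measurable ?P" for q
      by (rule measurable_compose_countable[OF _ sort]) measurable
    have "(\<integral>\<^sup>+X. ennreal (F j X) \<partial>?P)
        = (\<Sum>r<m ^ D. \<integral>\<^sup>+X. ennreal (\<bar>X (xs X ! (j * m ^ D + r)) ?c - centre m j\<bar> powr a) \<partial>?P)"
      unfolding F_def by (simp add: nn_integral_sum flip: sum_ennreal)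
    also have "\<dots> \<le> (\<Sum>r<m ^ D. ennreal (moment_const a * ?M))"
      unfolding xs_def using Suc.prems j c
      by (intro sum_mono moment_order_statistic) simp_all
    also have "\<dots> = ennreal (real m ^ D * (moment_const a * ?M))"
      by (simp add: moment_const_nonneg ennreal_mult ennreal_of_nat_eq_real_of_nat flip: of_nat_power)
    finally show ?thesis .
  qed
  have R: "(\<integral>\<^sup>+X. ennreal (R j X) \<partial>?P) \<le> ennreal (MV_const a D * (real m ^ D * ?M))" if j: "j < m" for j
  proof -
    \<comment> \<open>Earlier axes are redrawn as well; neither the block nor the remaining cost
      reads them.\<close>
    define h :: "nat \<Rightarrow> nat \<Rightarrow> real \<times> real \<Rightarrow> real" where "h i c' = (if c' = ?c then fst else snd)" for i c'
    let ?Z = "\<lambda>X Y. \<lambda>i\<in>{..<n}. \<lambda>c'\<in>{..<d}. h i c' (X i c', Y i c')"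
    have "(\<integral>\<^sup>+X. ennreal (R j X) \<partial>?P) = (\<integral>\<^sup>+X. \<integral>\<^sup>+Y. ennreal (R j (?Z X Y)) \<partial>?P \<partial>?P)"
      by (rule nn_integral_resamples_placement)
        (auto simp: h_def intro: resamples_fst resamples_snd prob_space_unif01)
    also have "\<dots> = (\<integral>\<^sup>+X. \<integral>\<^sup>+Y. ennreal (MV_cost a d m D (B j X) Y) \<partial>?P \<partial>?P)"
    proof (intro nn_integral_cong arg_cong[where f = ennreal])
      fix X Y
      have "xs (?Z X Y) = xs X"
        unfolding xs_def using Suc.prems(2) c
        by (intro sort_key_cong_order) (auto simp: h_def subset_iff)
      then have "R j (?Z X Y) = MV_cost a d m D (B j X) (?Z X Y)" by (simp add: R_def B_def)
      also have "\<dots> = MV_cost a d m D (B j X) Y"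
      proof (rule MV_cost_cong)
        fix i c' assume i: "i \<in> set (B j X)" "d - D \<le> c'" "c' < d"
        have "c' \<noteq> ?c" using i Suc.prems(4) by auto
        moreover have "i < n" using i(1) B(3)[OF j, of X] Suc.prems(2) by auto
        ultimately show "?Z X Y i c' = Y i c'" using i by (simp add: h_def)
      qed (use Suc.prems in simp)
      finally show "R j (?Z X Y) = MV_cost a d m D (B j X) Y" .
    qed
    also have "\<dots> \<le> (\<integral>\<^sup>+X. ennreal (MV_const a D * (real m ^ D * ?M)) \<partial>?P)"
      using Suc.prems(4-6) B[OF j] order_trans[OF B(3)[OF j] Suc.prems(2)]
      by (intro nn_integral_mono Suc.IH) simp_all
    finally show ?thesis by (simp add: P.emeasure_space_1)
  qed
  have "(\<integral>\<^sup>+X. ennreal (MV_cost a d m (Suc D) I X) \<partial>?P)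
      = ennreal (2 powr a) * (\<Sum>j<m. (\<integral>\<^sup>+X. ennreal (F j X) \<partial>?P) + (\<integral>\<^sup>+X. ennreal (R j X) \<partial>?P))"
  proof -
    have "ennreal (MV_cost a d m (Suc D) I X) = ennreal (2 powr a) * (\<Sum>j<m. ennreal (F j X) + ennreal (R j X))" for X
      unfolding cost using nonneg by (simp add: ennreal_mult sum_nonneg flip: ennreal_plus sum_ennreal)
    then show ?thesis
      by (simp add: nn_integral_cmult nn_integral_sum nn_integral_add)
  qed
  also have "\<dots> \<le> ennreal (2 powr a) * (\<Sum>j<m. ennreal (real m ^ D * (moment_const a * ?M))
      + ennreal (MV_const a D * (real m ^ D * ?M)))"
    by (intro mult_left_mono sum_mono add_mono F R) auto
  also have "\<dots> = ennreal (2 powr a * (m * (real m ^ D * (moment_const a * ?M) + MV_const a D * (real m ^ D * ?M))))"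
  proof -
    have "ennreal s * (\<Sum>j<m. ennreal p + ennreal q) = ennreal (s * (m * (p + q)))"
      if "s \<ge> 0" "p \<ge> 0" "q \<ge> 0" for s p q :: real
      using that by (simp add: ennreal_mult ennreal_of_nat_eq_real_of_nat)
    then show ?thesis
      using moment_const_nonneg[of a] MV_const_nonneg[of a D] by simp
  qed
  also have "2 powr a * (m * (real m ^ D * (moment_const a * ?M) + MV_const a D * (real m ^ D * ?M)))
      = MV_const a (Suc D) * (real m ^ Suc D * ?M)"
    by (simp add: algebra_simps)
  finally show ?case .
qed simp


text \<open>As rules about the application of a variable, these two can send the measurability prover
  into a loop on goals about cells.\<close>

declare measurable_coordinate [measurable del] measurable_sensor_coordinate [measurable del]

subsection \<open>Slices and cells\<close>

definition slice :: "nat \<Rightarrow> real \<Rightarrow> nat" where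
  "slice k x = min (nat \<lfloor>real k * x\<rfloor>) (k - 1)"

lemma slice_less: "k > 0 \<Longrightarrow> slice k x < k"
  by (simp add: slice_def)

lemma slice_eq:
  assumes "g < k" "0 \<le> y" "y < 1"
  shows "slice k ((real g + y) / real k) = g"
proof -
  have "\<lfloor>real k * ((real g + y) / real k)\<rfloor> = int g"
    using assms by (simp add: floor_unique)
  then show ?thesis using assms by (simp add: slice_def)
qed

lemma slice_bounds:
  assumes "k > 0" "0 \<le> x" "x \<le> 1"
  shows "real (slice k x) \<le> real k * x" "real k * x \<le> real (slice k x) + 1"
proof -
  have f: "real (nat \<lfloor>real k * x\<rfloor>) = of_int \<lfloor>real k * x\<rfloor>"
    using assms by simp
  show "real (slice k x) \<le> real k * x"
  proof -
    have "real (slice k x) \<le> real (nat \<lfloor>real k * x\<rfloor>)" by (simp add: slice_def)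
    then show ?thesis unfolding f by linarith
  qed
  show "real k * x \<le> real (slice k x) + 1"
  proof (cases "nat \<lfloor>real k * x\<rfloor> \<le> k - 1")
    case True
    then have "real (slice k x) = of_int \<lfloor>real k * x\<rfloor>" using f by (simp add: slice_def)
    then show ?thesis by linarith
  next
    case False
    then have "real (slice k x) = real k - 1" using assms(1) by (simp add: slice_def of_nat_diff)
    moreover have "real k * x \<le> real k" using assms by (simp add: mult_left_le)
    ultimately show ?thesis by simp
  qed
qed

lemma measurable_slice [measurable]: "slice k \<in> measurable borel (count_space UNIV)"
  unfolding slice_def[abs_def] by measurable

text \<open>Dropping the endpoint \<open>1\<close>, a null set, lets half-open slices tile the
  interval exactly.\<close>

lemma nn_integral_unif01:
  assumes [measurable]: "f \<in> borel_measurable borel"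
  shows "(\<integral>\<^sup>+x. f x \<partial>unif01) = (\<integral>\<^sup>+x. f x * indicator {0..<1} x \<partial>lborel)"
proof -
  have "(\<integral>\<^sup>+x. f x \<partial>unif01) = (\<integral>\<^sup>+x. f x * indicator {0..1} x \<partial>lborel)"
    by (subst nn_integral_uniform_measure) (auto simp: divide_ennreal_def)
  also have "\<dots> = (\<integral>\<^sup>+x. f x * indicator {0..<1} x \<partial>lborel)"
    by (rule nn_integral_cong_AE, use AE_lborel_singleton[of 1] in eventually_elim)
      (auto simp: indicator_def)
  finally show ?thesis .
qed

text \<open>A uniform point amounts to a uniformly chosen slice and an independent uniform position
  in it, by an affine substitution on each slice.\<close>

lemma nn_integral_unif01_slices:
  assumes [measurable]: "f \<in> borel_measurable borel" and k: "k > 0"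
  shows "(\<integral>\<^sup>+x. f x \<partial>unif01)
    = (\<Sum>g<k. ennreal (1 / real k) * (\<integral>\<^sup>+y. f ((real g + y) / real k) \<partial>unif01))"
proof -
  define J where "J g = {real g / real k..<(real g + 1) / real k}" for g
  have part: "indicator {0..<1} x = (\<Sum>g<k. indicator (J g) x :: ennreal)" for x
  proof (cases "x \<in> {0..<1}")
    case True
    define g where "g = nat \<lfloor>real k * x\<rfloor>"
    have "real k * x < real k" using True k by simp
    then have "\<lfloor>real k * x\<rfloor> < int k" by (simp add: floor_less_iff)
    then have g: "g < k" unfolding g_def using k by (simp add: nat_less_iff)
    have iff: "x \<in> J g' \<longleftrightarrow> g' = g" for g'
    proof -
      have "x \<in> J g' \<longleftrightarrow> real g' \<le> real k * x \<and> real k * x < real g' + 1"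
        using k by (auto simp: J_def field_simps)
      also have "\<dots> \<longleftrightarrow> \<lfloor>real k * x\<rfloor> = int g'" by (simp add: floor_eq_iff)
      also have "\<dots> \<longleftrightarrow> g' = g" unfolding g_def using True by (auto simp: nat_eq_iff)
      finally show ?thesis .
    qed
    have "(\<Sum>g'<k. indicator (J g') x :: ennreal) = (\<Sum>g'<k. if g' = g then 1 else 0)"
      by (intro sum.cong) (simp_all add: indicator_def iff)
    then show ?thesis using True g by simp
  next
    case False
    have "x \<notin> J g" if "g < k" for g
    proof
      assume "x \<in> J g"
      then have x: "real g / real k \<le> x" "x < (real g + 1) / real k" by (simp_all add: J_def)
      have "0 \<le> real g / real k" by simp
      also note x(1)
      finally have "0 \<le> x" .
      note x(2)
      also have "(real g + 1) / real k \<le> 1" using that by simp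
      finally show False using False \<open>0 \<le> x\<close> by simp
    qed
    then show ?thesis using False by simp
  qed
  have piece: "(\<integral>\<^sup>+x. f x * indicator (J g) x \<partial>lborel)
      = ennreal (1 / real k) * (\<integral>\<^sup>+y. f ((real g + y) / real k) \<partial>unif01)" for g
  proof -
    have "(\<integral>\<^sup>+x. f x * indicator (J g) x \<partial>lborel) = ennreal \<bar>1 / real k\<bar> *
        (\<integral>\<^sup>+y. f (real g / real k + 1 / real k * y) * indicator (J g) (real g / real k + 1 / real k * y) \<partial>lborel)"
      using k by (intro nn_integral_real_affine) (auto simp: J_def)
    also have "(\<lambda>y. f (real g / real k + 1 / real k * y) * indicator (J g) (real g / real k + 1 / real k * y))
        = (\<lambda>y. f ((real g + y) / real k) * indicator {0..<1} y)"
    proof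
      fix y
      have eq: "real g / real k + 1 / real k * y = (real g + y) / real k"
        by (simp add: add_divide_distrib)
      have "(real g + y) / real k \<in> J g \<longleftrightarrow> y \<in> {0..<1}"
        using k by (simp add: J_def divide_le_cancel divide_less_cancel)
      then show "f (real g / real k + 1 / real k * y) * indicator (J g) (real g / real k + 1 / real k * y)
          = f ((real g + y) / real k) * indicator {0..<1} y"
        unfolding eq by (simp add: indicator_def)
    qed
    finally show ?thesis by (simp add: nn_integral_unif01)
  qed
  have "(\<integral>\<^sup>+x. f x \<partial>unif01) = (\<integral>\<^sup>+x. (\<Sum>g<k. f x * indicator (J g) x) \<partial>lborel)"
    by (simp add: nn_integral_unif01 part sum_distrib_left)
  also have "\<dots> = (\<Sum>g<k. \<integral>\<^sup>+x. f x * indicator (J g) x \<partial>lborel)"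
    by (intro nn_integral_sum) (simp add: J_def)
  finally show ?thesis by (simp add: piece)
qed

text \<open>Integrating over the new position leaves a function of the slice alone; splitting the
  integral over \<open>x\<close> by slices then gives the same sum as splitting the integral over a
  single uniform point.\<close>

lemma resamples_slice:
  assumes k: "k > 0"
  shows "resamples unif01 (\<lambda>(x, y). (real (slice k x) + y) / real k)"
proof -
  interpret U: prob_space unif01 by (rule prob_space_unif01)
  let ?h = "\<lambda>(x, y). (real (slice k x) + y) / real k"
  have h0: "?h \<in> borel_measurable (borel \<Otimes>\<^sub>M borel)" by measurable
  have h[measurable]: "?h \<in> measurable (unif01 \<Otimes>\<^sub>M unif01) unif01"
    using h0 by (simp cong: measurable_cong_sets sets_pair_measure_cong)
  have "distr (unif01 \<Otimes>\<^sub>M unif01) unif01 ?h = unif01"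
  proof (rule measure_eqI)
    fix A assume "A \<in> sets (distr (unif01 \<Otimes>\<^sub>M unif01) unif01 ?h)"
    then have A: "A \<in> sets borel" by simp
    note [measurable] = A
    define \<Phi> where "\<Phi> g = (\<integral>\<^sup>+y. indicator A ((real g + y) / real k) \<partial>unif01)" for g :: nat
    have "emeasure (distr (unif01 \<Otimes>\<^sub>M unif01) unif01 ?h) A
        = (\<integral>\<^sup>+z. indicator A z \<partial>distr (unif01 \<Otimes>\<^sub>M unif01) unif01 ?h)"
      using A by simp
    also have "\<dots> = (\<integral>\<^sup>+z. indicator A (?h z) \<partial>(unif01 \<Otimes>\<^sub>M unif01))"
      using A by (intro nn_integral_distr h) simp
    also have "\<dots> = (\<integral>\<^sup>+x. \<integral>\<^sup>+y. indicator A (?h (x, y)) \<partial>unif01 \<partial>unif01)"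
      by (rule U.nn_integral_fst[symmetric], rule measurable_compose[OF h]) (use A in simp)
    also have "\<dots> = (\<integral>\<^sup>+x. \<Phi> (slice k x) \<partial>unif01)"
      by (simp add: \<Phi>_def)
    also have "\<dots> = (\<Sum>g<k. ennreal (1 / real k) * (\<integral>\<^sup>+y. \<Phi> (slice k ((real g + y) / real k)) \<partial>unif01))"
      by (rule nn_integral_unif01_slices[OF _ k]) measurable
    also have "\<dots> = (\<Sum>g<k. ennreal (1 / real k) * \<Phi> g)"
    proof (intro sum.cong refl arg_cong[where f = "(*) _"])
      fix g assume "g \<in> {..<k}"
      then have "(\<integral>\<^sup>+y. \<Phi> (slice k ((real g + y) / real k)) \<partial>unif01) = (\<integral>\<^sup>+y. \<Phi> g \<partial>unif01)"
        by (intro nn_integral_cong_AE, use AE_unif01 in eventually_elim) (simp add: slice_eq)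
      then show "(\<integral>\<^sup>+y. \<Phi> (slice k ((real g + y) / real k)) \<partial>unif01) = \<Phi> g"
        using U.emeasure_space_1 by simp
    qed
    also have "\<dots> = (\<integral>\<^sup>+x. indicator A x \<partial>unif01)"
      unfolding \<Phi>_def by (rule nn_integral_unif01_slices[OF _ k, symmetric]) measurable
    also have "\<dots> = emeasure unif01 A" using A by (intro nn_integral_indicator) simp
    finally show "emeasure (distr (unif01 \<Otimes>\<^sub>M unif01) unif01 ?h) A = emeasure unif01 A" .
  qed simp
  with h show ?thesis by (simp add: resamples_def)
qed

lemma emeasure_slice:
  assumes "g < k"
  shows "emeasure unif01 {x. slice k x = g} = ennreal (1 / real k)"
proof -
  interpret U: prob_space unif01 by (rule prob_space_unif01)
  have k: "k > 0" using assms by simp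
  have [measurable]: "{x. slice k x = g} \<in> sets borel" by measurable
  have "emeasure unif01 {x. slice k x = g} = (\<integral>\<^sup>+x. indicator {x. slice k x = g} x \<partial>unif01)"
    by (intro nn_integral_indicator[symmetric]) simp
  also have "\<dots> = (\<Sum>g'<k. ennreal (1 / real k) *
      (\<integral>\<^sup>+y. indicator {x. slice k x = g} ((real g' + y) / real k) \<partial>unif01))"
    by (rule nn_integral_unif01_slices[OF _ k]) measurable
  also have "\<dots> = (\<Sum>g'<k. if g' = g then ennreal (1 / real k) else 0)"
  proof (intro sum.cong refl)
    fix g' assume g': "g' \<in> {..<k}"
    have "(\<integral>\<^sup>+y. indicator {x. slice k x = g} ((real g' + y) / real k) \<partial>unif01)
        = (\<integral>\<^sup>+y. (if g' = g then 1 else 0) \<partial>unif01)"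
      by (intro nn_integral_cong_AE, use AE_unif01 in eventually_elim)
        (use g' in \<open>simp add: slice_eq indicator_def\<close>)
    also have "\<dots> = (if g' = g then 1 else 0)" using U.emeasure_space_1 by simp
    finally show "ennreal (1 / real k) *
        (\<integral>\<^sup>+y. indicator {x. slice k x = g} ((real g' + y) / real k) \<partial>unif01)
        = (if g' = g then ennreal (1 / real k) else 0)" by simp
  qed
  finally show ?thesis using assms by simp
qed

section \<open>Cells and the number of sensors in them\<close>

lemma cell_of_slice: "cell_of d k x = (\<lambda>j\<in>{..<d}. slice k (x j))"
  by (simp add: cell_of_def slice_def)

lemma cell_of_in_cells: "k > 0 \<Longrightarrow> cell_of d k x \<in> cells d k"
  by (auto simp: cell_of_slice cells_def slice_less)

lemma finite_cells: "finite (cells d k)"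
  unfolding cells_def by (intro finite_PiE) auto

lemma card_cells: "card (cells d k) = k ^ d"
  by (simp add: cells_def card_PiE)

lemma cell_of_eq_iff:
  assumes "c \<in> cells d k"
  shows "cell_of d k x = c \<longleftrightarrow> (\<forall>j<d. slice k (x j) = c j)"
  using assms by (auto simp: cell_of_slice cells_def PiE_iff extensional_def fun_eq_iff)

lemma emeasure_cell:
  assumes "c \<in> cells d k"
  shows "{x \<in> space (uniform_cube d). cell_of d k x = c} \<in> sets (uniform_cube d)"
    and "measure (uniform_cube d) {x \<in> space (uniform_cube d). cell_of d k x = c} = (1 / real k) ^ d"
proof -
  interpret U: product_prob_space "\<lambda>_. unif01" "{..<d}"
    by (simp add: product_prob_space_def product_prob_space_axioms_def product_sigma_finite_def
        prob_space_unif01 prob_space_imp_sigma_finite)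
  let ?C = "{x \<in> space (uniform_cube d). cell_of d k x = c}"
  have eq: "?C = (\<Pi>\<^sub>E j\<in>{..<d}. {x. slice k x = c j})"
  proof -
    have "space (uniform_cube d) = extensional {..<d}"
      by (simp add: uniform_cube_eq_PiM space_PiM PiE_def)
    then show ?thesis
      by (auto simp only: PiE_def Pi_iff cell_of_eq_iff[OF assms] mem_Collect_eq lessThan_iff Int_iff)
  qed
  have slice: "{x. slice k x = g} \<in> sets unif01" for g
  proof -
    have "{x. slice k x = g} \<in> sets borel" by measurable
    then show ?thesis by simp
  qed
  show "?C \<in> sets (uniform_cube d)"
    unfolding eq unfolding uniform_cube_eq_PiM by (rule sets_PiM_I_finite[OF finite_lessThan slice])
  have "emeasure (uniform_cube d) ?C = (\<Prod>j<d. emeasure unif01 {x. slice k x = c j})"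
    unfolding eq unfolding uniform_cube_eq_PiM by (rule U.emeasure_PiM[OF finite_lessThan slice])
  also have "\<dots> = (\<Prod>j<d. ennreal (1 / real k))"
    using assms by (intro prod.cong refl emeasure_slice) (auto simp: cells_def)
  also have "\<dots> = ennreal ((1 / real k) ^ d)" by (simp add: ennreal_power)
  finally show "measure (uniform_cube d) ?C = (1 / real k) ^ d" by (simp add: measure_def)
qed

text \<open>Chernoff's bound with parameter \<open>1\<close>; \<open>4 / 15 < 1 - exp (-1) - 1 / 3\<close>. The constant
  \<open>4 / 15\<close> exceeds the \<open>2 / 9\<close> of the usual estimate \<open>exp (- \<delta>\<^sup>2 \<mu> / 2)\<close>, and the proof needs this.\<close>

lemma Chernoff_few:
  fixes n :: nat
  assumes "prob_space Q" "A \<in> sets Q"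
  defines "q \<equiv> measure Q A" and "P \<equiv> \<Pi>\<^sub>M i\<in>{..<n}. Q"
  shows "measure P {X \<in> space P. real (card {i. i < n \<and> X i \<in> A}) < real n * q / 3}
    \<le> exp (- (4 / 15) * (real n * q))"
proof -
  interpret Q: prob_space Q by fact
  interpret P: product_prob_space "\<lambda>_. Q" "{..<n}" by unfold_locales
  interpret PP: prob_space P unfolding P_def by (rule P.prob_space_axioms)
  let ?B = "{X \<in> space P. real (card {i. i < n \<and> X i \<in> A}) < real n * q / 3}"
  define f where "f x = ennreal (exp (- indicator A x))" for x
  have [measurable]: "f \<in> borel_measurable Q" unfolding f_def using assms(2) by measurable
  \<comment> \<open>Gives \<open>1 - exp (-1) \<ge> 3 / 5\<close>; after the Markov factor
    \<open>exp (n * q / 3)\<close> the exponent is \<open>3 / 5 - 1 / 3 = 4 / 15\<close>.\<close>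
  have e: "exp (-1 :: real) \<le> 2 / 5"
  proof -
    have "5 / 2 \<le> exp (1 :: real)"
      using exp_lower_Taylor_quadratic[of 1] by simp
    then show ?thesis by (simp add: exp_minus field_simps)
  qed
  have f: "(\<integral>\<^sup>+x. f x \<partial>Q) \<le> ennreal (exp (- (3 / 5) * q))"
  proof -
    have ind: "integrable Q (indicat_real A)"
      by (rule integrable_real_indicator[OF assms(2)]) (simp add: Q.emeasure_eq_measure)
    have "(\<integral>\<^sup>+x. f x \<partial>Q) = (\<integral>\<^sup>+x. ennreal (1 - (1 - exp (-1)) * indicator A x) \<partial>Q)"
      unfolding f_def by (intro nn_integral_cong) (simp add: indicator_def)
    also have "\<dots> = ennreal (\<integral>x. 1 - (1 - exp (-1)) * indicator A x \<partial>Q)"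
    proof (rule nn_integral_eq_integral)
      show "integrable Q (\<lambda>x. 1 - (1 - exp (-1)) * indicat_real A x)"
        by (intro Bochner_Integration.integrable_diff Q.integrable_const integrable_mult_right ind)
    qed (simp add: indicator_def)
    also have "(\<integral>x. 1 - (1 - exp (-1)) * indicator A x \<partial>Q) = 1 - (1 - exp (-1)) * q"
      using ind assms(2) by (subst Bochner_Integration.integral_diff) (simp_all add: q_def Q.prob_space)
    also have "\<dots> \<le> 1 - (3 / 5) * q"
    proof -
      have "(3 / 5) * q \<le> (1 - exp (-1)) * q"
        using e by (intro mult_right_mono) (simp_all add: q_def)
      then show ?thesis by simp
    qed
    also have "\<dots> \<le> exp (- (3 / 5) * q)"
      using exp_ge_add_one_self[of "- (3 / 5) * q"] by simp
    finally show ?thesis by (simp add: ennreal_leI)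
  qed
  have count: "(\<Prod>i<n. f (X i)) = ennreal (exp (- real (card {i. i < n \<and> X i \<in> A})))" for X
  proof -
    have "(\<Prod>i<n. f (X i)) = ennreal (exp (\<Sum>i<n. - indicator A (X i)))"
      by (simp add: f_def prod_ennreal exp_sum)
    also have "(\<Sum>i<n. - indicator A (X i)) = - real (card {i. i < n \<and> X i \<in> A})"
      by (simp add: sum_negf indicator_def sum.If_cases Int_def)
    finally show ?thesis .
  qed
  have "emeasure P ?B \<le> (\<integral>\<^sup>+X. ennreal (exp (real n * q / 3)) * (\<Prod>i<n. f (X i)) \<partial>P)"
  proof -
    have "(\<lambda>X. \<Sum>i<n. indicat_real A (X i)) \<in> borel_measurable P"
      unfolding P_def
      by (rule borel_measurable_sum, rule measurable_compose[where N = Q])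
        (simp_all add: borel_measurable_indicator[OF assms(2)])
    moreover have "(\<Sum>i<n. indicat_real A (X i)) = real (card {i. i < n \<and> X i \<in> A})" for X
      by (simp add: indicator_def sum.If_cases Int_def)
    ultimately have "(\<lambda>X. real (card {i. i < n \<and> X i \<in> A})) \<in> borel_measurable P"
      by (simp only:)
    then have B: "?B \<in> sets P"
      by (rule borel_measurable_less[OF _ borel_measurable_const])
    have "emeasure P ?B = (\<integral>\<^sup>+X. indicator ?B X \<partial>P)"
      by (rule nn_integral_indicator[OF B, symmetric])
    also have "\<dots> \<le> (\<integral>\<^sup>+X. ennreal (exp (real n * q / 3)) * (\<Prod>i<n. f (X i)) \<partial>P)"
    proof (intro nn_integral_mono)
      fix X
      show "indicator ?B X \<le> ennreal (exp (real n * q / 3)) * (\<Prod>i<n. f (X i))"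
      proof (cases "X \<in> ?B")
        case True
        have "ennreal (exp (real n * q / 3)) * (\<Prod>i<n. f (X i))
            = ennreal (exp (real n * q / 3 - real (card {i. i < n \<and> X i \<in> A})))"
          unfolding count by (simp only: ennreal_mult'[symmetric] exp_ge_zero mult_exp_exp diff_conv_add_uminus)
        moreover have "1 \<le> exp (real n * q / 3 - real (card {i. i < n \<and> X i \<in> A}))"
          using True by simp
        ultimately show ?thesis using True by simp
      qed simp
    qed
    finally show ?thesis .
  qed
  also have "\<dots> = ennreal (exp (real n * q / 3)) * (\<integral>\<^sup>+X. (\<Prod>i<n. f (X i)) \<partial>P)"
    unfolding P_def by (rule nn_integral_cmult) measurable
  also have "(\<integral>\<^sup>+X. (\<Prod>i<n. f (X i)) \<partial>P) = (\<Prod>i<n. \<integral>\<^sup>+x. f x \<partial>Q)"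
    unfolding P_def by (rule P.product_nn_integral_prod) simp_all
  also have "\<dots> \<le> (\<Prod>i<n. ennreal (exp (- (3 / 5) * q)))"
    by (intro prod_mono_ennreal f)
  also have "\<dots> = ennreal (exp (real n * (- (3 / 5) * q)))"
    by (simp only: prod_constant card_lessThan ennreal_power exp_ge_zero exp_of_nat_mult)
  finally have "emeasure P ?B \<le> ennreal (exp (real n * q / 3)) * ennreal (exp (real n * (- (3 / 5) * q)))"
    by (simp add: mult_left_mono)
  also have "\<dots> = ennreal (exp (- (4 / 15) * (real n * q)))"
    by (simp add: mult_exp_exp flip: ennreal_mult)
  finally show ?thesis
    by (simp add: PP.emeasure_eq_measure)
qed

section \<open>Averaging over finitely many random choices\<close>

lemma ennreal_expectation_pmf:
  assumes "finite (set_pmf \<mu>)" "\<And>t. t \<in> set_pmf \<mu> \<Longrightarrow> f t \<ge> 0"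
  shows "ennreal (measure_pmf.expectation \<mu> f) = (\<Sum>t\<in>set_pmf \<mu>. ennreal (pmf \<mu> t) * ennreal (f t))"
proof -
  have "measure_pmf.expectation \<mu> f = (\<Sum>t\<in>set_pmf \<mu>. pmf \<mu> t * f t)"
    using assms(1) by (simp add: integral_measure_pmf_real mult.commute)
  then show ?thesis using assms(2) by (simp add: ennreal_mult' flip: sum_ennreal)
qed

text \<open>A finite average commutes with the integral over placements, so it is enough to bound
  the movement for each fixed choice. Here \<open>\<mu>\<close> must not depend on \<open>x\<close>;
  in the dense case this is arranged by fixing the cells of the sensors first.\<close>

lemma nn_integral_expectation_pmf_le:
  assumes \<mu>: "finite (set_pmf \<mu>)"
    and nonneg: "\<And>t x. t \<in> set_pmf \<mu> \<Longrightarrow> f t x \<ge> 0"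
    and meas: "\<And>t. t \<in> set_pmf \<mu> \<Longrightarrow> f t \<in> borel_measurable M"
    and bound: "\<And>t. t \<in> set_pmf \<mu> \<Longrightarrow> (\<integral>\<^sup>+x. ennreal (f t x) \<partial>M) \<le> B"
  shows "(\<integral>\<^sup>+x. ennreal (measure_pmf.expectation \<mu> (\<lambda>t. f t x)) \<partial>M) \<le> B"
proof -
  have "(\<integral>\<^sup>+x. ennreal (measure_pmf.expectation \<mu> (\<lambda>t. f t x)) \<partial>M)
      = (\<integral>\<^sup>+x. (\<Sum>t\<in>set_pmf \<mu>. ennreal (pmf \<mu> t) * ennreal (f t x)) \<partial>M)"
    by (simp add: ennreal_expectation_pmf[OF \<mu> nonneg])
  also have "\<dots> = (\<Sum>t\<in>set_pmf \<mu>. ennreal (pmf \<mu> t) * (\<integral>\<^sup>+x. ennreal (f t x) \<partial>M))"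
    using meas by (subst nn_integral_sum) (auto simp: nn_integral_cmult intro!: sum.cong nn_integral_cmult)
  also have "\<dots> \<le> (\<Sum>t\<in>set_pmf \<mu>. ennreal (pmf \<mu> t) * B)"
    by (intro sum_mono mult_left_mono bound) simp_all
  also have "\<dots> = B"
  proof -
    have "(\<Sum>t\<in>set_pmf \<mu>. ennreal (pmf \<mu> t)) = ennreal (\<Sum>t\<in>set_pmf \<mu>. pmf \<mu> t)"
      by (rule sum_ennreal) simp
    then show ?thesis
      using sum_pmf_eq_1[OF \<mu> subset_refl] by (simp flip: sum_distrib_right)
  qed
  finally show ?thesis .
qed

lemma set_pmf_choose_uniformly:
  assumes "finite I" "N \<le> card I"
  shows "set_pmf (choose_uniformly N I) = {T. T \<subseteq> I \<and> card T = N}"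
proof -
  have "{T. T \<subseteq> I \<and> card T = N} \<noteq> {}"
    using obtain_subset_with_card_n[OF assms(2)] by blast
  moreover have "finite {T. T \<subseteq> I \<and> card T = N}"
    using assms(1) by simp
  ultimately show ?thesis
    unfolding choose_uniformly_def by (rule set_pmf_of_set)
qed

subsection \<open>The algorithm with random choices\<close>

lemma grid_near:
  assumes "m > 0" "0 \<le> s" "s \<le> 1"
  shows "\<exists>l<m. \<bar>s - centre m l\<bar> \<le> 1 / (2 * real m)"
proof (intro exI conjI)
  show "slice m s < m" using assms by (simp add: slice_less)
  have "s - centre m (slice m s) = (real m * s - real (slice m s) - 1 / 2) / real m"
    using assms by (simp add: centre_def field_simps)
  then have "\<bar>s - centre m (slice m s)\<bar> = \<bar>real m * s - real (slice m s) - 1 / 2\<bar> / real m"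
    by (simp add: abs_divide)
  also have "\<dots> \<le> (1 / 2) / real m"
  proof (rule divide_right_mono)
    show "\<bar>real m * s - real (slice m s) - 1 / 2\<bar> \<le> 1 / 2"
      using slice_bounds[OF assms] by linarith
  qed simp
  finally show "\<bar>s - centre m (slice m s)\<bar> \<le> 1 / (2 * real m)" by simp
qed

lemma MV_covers:
  assumes "finite T" "card T = m ^ d" "m > 0" "y > 0"
    and x: "\<And>j. j < d \<Longrightarrow> b j \<le> x j \<and> x j \<le> b j + y"
  shows "\<exists>i\<in>T. \<forall>j<d. \<bar>x j - positions (MV d m y b d (sorted_list_of_set T) S) i j\<bar> \<le> y / (2 * real m)"
proof -
  \<comment> \<open>Positions \<open>j \<ge> d\<close> also get a value below \<open>m\<close>,
    since \<open>MV_grid\<close> takes an index at every position.\<close>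
  have "\<exists>l<m. j < d \<longrightarrow> \<bar>(x j - b j) / y - centre m l\<bar> \<le> 1 / (2 * real m)" for j
  proof (cases "j < d")
    case True
    then have "0 \<le> (x j - b j) / y" "(x j - b j) / y \<le> 1"
      using x[of j] assms(4) by (simp_all add: field_simps)
    then show ?thesis using grid_near[OF assms(3)] by blast
  qed (use assms(3) in auto)
  then obtain l where l: "\<And>j. l j < m" "\<And>j. j < d \<Longrightarrow> \<bar>(x j - b j) / y - centre m (l j)\<bar> \<le> 1 / (2 * real m)"
    by metis
  have L: "distinct (sorted_list_of_set T)" "length (sorted_list_of_set T) = m ^ d"
    using assms(2) by simp_all
  obtain i where i: "i \<in> T"
    "\<And>c. c < d \<Longrightarrow> positions (MV d m y b d (sorted_list_of_set T) S) i c = b c + y * centre m (l c)"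
    using MV_grid[where l = l and S = S and b = b and y = y, OF L order_refl l(1)] assms(1) by auto
  have "\<bar>x j - positions (MV d m y b d (sorted_list_of_set T) S) i j\<bar> \<le> y / (2 * real m)" if j: "j < d" for j
  proof -
    have "x j - (b j + y * centre m (l j)) = y * ((x j - b j) / y - centre m (l j))"
      using assms(4) by (simp add: field_simps)
    then have "\<bar>x j - (b j + y * centre m (l j))\<bar> = y * \<bar>(x j - b j) / y - centre m (l j)\<bar>"
      using assms(4) by (simp add: abs_mult)
    also have "\<dots> \<le> y * (1 / (2 * real m))"
      using l(2)[OF j] assms(4) by (intro mult_left_mono) simp_all
    finally show ?thesis using i(2)[OF j] by simp
  qed
  then show ?thesis using i(1) by blast
qed

lemma MV_displacement_unused:
  assumes "finite T" "card T = m ^ d" "i \<notin> T"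
  shows "displacement (MV d m y b d (sorted_list_of_set T) (start X)) i = 0"
proof -
  have "MV d m y b d (sorted_list_of_set T) (start X) i = start X i"
    by (rule MV_outside) (use assms in simp_all)
  then show ?thesis by (simp add: displacement_def start_def)
qed

lemma MV_displacement_nonneg:
  assumes "finite T" "card T = m ^ d"
  shows "displacement (MV d m y b d (sorted_list_of_set T) (start X)) i \<ge> 0"
proof -
  have "displacement (start X) i \<le> displacement (MV d m y b d (sorted_list_of_set T) (start X)) i"
    by (rule MV_displacement_mono) (use assms in simp_all)
  then show ?thesis by (simp add: displacement_def start_def)
qed

lemma sum_displacement_le_cost:
  assumes "finite T" "card T = m ^ d" "y > 0" "a > 0"
    and X: "\<And>i c. i \<in> T \<Longrightarrow> c < d \<Longrightarrow> X i c = b c + y * Y i c"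
  shows "(\<Sum>i\<in>T. displacement (MV d m y b d (sorted_list_of_set T) (start X)) i powr a)
    \<le> y powr a * MV_cost a d m d (sorted_list_of_set T) Y"
proof -
  have "(\<Sum>i\<in>set (sorted_list_of_set T). (displacement (MV d m y b d (sorted_list_of_set T) (start X)) i
      - displacement (start X) i) powr a) \<le> y powr a * MV_cost a d m d (sorted_list_of_set T) Y"
    by (rule MV_displacement_le_cost) (use assms in \<open>simp_all add: positions_def start_def\<close>)
  moreover have "displacement (start X) i = 0" for i
    by (simp add: displacement_def start_def)
  ultimately show ?thesis using assms(1) by simp
qed

text \<open>Above the cut-off, \<open>u powr (- 5 * a)\<close> is at most
  \<open>t powr (- 5 * a)\<close>. On an event, the first summand costs only the probability of the
  event, and the second can be integrated over the whole space.\<close>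

lemma powr_le_truncated:
  fixes u t a :: real
  assumes "u \<ge> 0" "t > 0" "a > 0"
  shows "u powr a \<le> t powr a + t powr (- 5 * a) * u powr (6 * a)"
proof (cases "u \<le> t")
  case True
  then have "u powr a \<le> t powr a" using assms by (intro powr_mono2) simp_all
  then show ?thesis by (simp add: add_increasing2)
next
  case False
  then have "u powr a = u powr (- 5 * a) * u powr (6 * a)"
    using assms by (simp flip: powr_add)
  also have "u powr (- 5 * a) \<le> t powr (- 5 * a)"
    using False assms by (intro powr_mono2') simp_all
  then have "u powr (- 5 * a) * u powr (6 * a) \<le> t powr (- 5 * a) * u powr (6 * a)"
    by (intro mult_right_mono) simp_all
  finally show ?thesis by (simp add: add_increasing)
qed

lemma borel_measurable_sum_powr:
  fixes f :: "'x \<Rightarrow> 'i \<Rightarrow> real"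
  assumes "\<And>i. (\<lambda>x. f x i) \<in> borel_measurable N"
  shows "(\<lambda>x. \<Sum>i\<in>I. f x i powr a) \<in> borel_measurable N"
  by (rule borel_measurable_sum) (rule powr_real_measurable[OF assms borel_measurable_const])

text \<open>Collects what covering and expectation need to know about the three rounded roots; the
  particular \<open>p\<close>, \<open>A\<close> and \<open>x0\<close> enter only in
  \<open>LV_analysis\<close>. \<open>Mn\<close> and \<open>enough\<close> guarantee that there are
  enough sensors to choose from, so that \<open>pmf_of_set\<close> is never applied to an empty set
  in the cases that arise.\<close>

locale LV_parameters =
  fixes d n k m M :: nat and p A a :: real
  assumes d: "d > 0" and a: "a > 0"
    and k_eq: "k = floor_root d (real n / (p * ln (real n)))"
    and m_eq: "m = floor_root d (A * ln (real n))"
    and M_eq: "M = floor_root d (real n)"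
    and k: "k > 0" and m: "m > 0" and M: "M > 0" and Mn: "M ^ d \<le> n"
    and enough: "real (m ^ d) \<le> 1 / 3 * (real n / real k ^ d)"
begin

abbreviation "P \<equiv> placement d n"

text \<open>Stated for an arbitrary map \<open>g\<close> from sensors to cells: the case distinction
  and the choice in the dense case see the placement only through the cells, which is what lets the
  positions inside the cells be redrawn.\<close>

definition few :: "(nat \<Rightarrow> nat \<Rightarrow> nat) \<Rightarrow> bool" where
  "few g \<longleftrightarrow> (\<exists>c\<in>cells d k. real (card {i. i < n \<and> g i = c}) < 1 / 3 * (real n / real k ^ d))"

definition sparse_choice :: "nat set pmf" where
  "sparse_choice = choose_uniformly (M ^ d) {..<n}"

definition sparse_state :: "nat set \<Rightarrow> (nat \<Rightarrow> point) \<Rightarrow> state" where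
  "sparse_state T X = MV d M 1 (\<lambda>_. 0) d (sorted_list_of_set T) (start X)"

definition dense_choice :: "(nat \<Rightarrow> nat \<Rightarrow> nat) \<Rightarrow> ((nat \<Rightarrow> nat) \<Rightarrow> nat set) pmf" where
  "dense_choice g = Pi_pmf (cells d k) {} (\<lambda>c. choose_uniformly (m ^ d) {i. i < n \<and> g i = c})"

definition dense_state ::
    "(nat \<Rightarrow> nat \<Rightarrow> nat) \<Rightarrow> ((nat \<Rightarrow> nat) \<Rightarrow> nat set) \<Rightarrow> (nat \<Rightarrow> point) \<Rightarrow> state" where
  "dense_state g F X i =
     MV d m (1 / real k) (corner k (g i)) d (sorted_list_of_set (F (g i))) (start X) i"

text \<open>Restricted to the sensors and valued in \<open>cells d k\<close>, it takes finitely many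
  values, so measurability can be treated one value at a time.\<close>

definition assignment :: "(nat \<Rightarrow> point) \<Rightarrow> nat \<Rightarrow> nat \<Rightarrow> nat" where
  "assignment X = (\<lambda>i\<in>{..<n}. cell_of d k (X i))"

lemma LV_eq:
  "LV d p A n X = (let g = (\<lambda>i. cell_of d k (X i)) in
     if few g then map_pmf (\<lambda>T. sparse_state T X) sparse_choice
     else map_pmf (\<lambda>F. dense_state g F X) (dense_choice g))"
  unfolding LV_def Let_def k_eq[symmetric] m_eq[symmetric] M_eq[symmetric]
  by (simp add: few_def sparse_choice_def sparse_state_def dense_choice_def dense_state_def[abs_def] sensors_in_def)

lemma same_class:
  assumes "\<And>i. i < n \<Longrightarrow> g i = g' i"
  shows "{i. i < n \<and> g i = c} = {i. i < n \<and> g' i = c}"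
  using assms by auto

lemma few_cong: "(\<And>i. i < n \<Longrightarrow> g i = g' i) \<Longrightarrow> few g = few g'"
  by (simp only: few_def same_class[of g g'])

lemma dense_choice_cong: "(\<And>i. i < n \<Longrightarrow> g i = g' i) \<Longrightarrow> dense_choice g = dense_choice g'"
  by (simp only: dense_choice_def same_class[of g g'])

lemma set_sparse_choice: "set_pmf sparse_choice = {T. T \<subseteq> {..<n} \<and> card T = M ^ d}"
  unfolding sparse_choice_def by (rule set_pmf_choose_uniformly) (use Mn in simp_all)

lemma finite_sparse_choice: "finite (set_pmf sparse_choice)"
  unfolding set_sparse_choice by simp

lemma set_dense_choice:
  assumes "\<not> few g"
  shows "set_pmf (dense_choice g) =
    PiE_dflt (cells d k) {} (\<lambda>c. {T. T \<subseteq> {i. i < n \<and> g i = c} \<and> card T = m ^ d})"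
proof -
  have "set_pmf (choose_uniformly (m ^ d) {i. i < n \<and> g i = c}) = {T. T \<subseteq> {i. i < n \<and> g i = c} \<and> card T = m ^ d}"
    if "c \<in> cells d k" for c
  proof (rule set_pmf_choose_uniformly)
    have "real (m ^ d) \<le> real (card {i. i < n \<and> g i = c})"
      using assms enough that unfolding few_def by (meson linorder_not_less order_trans)
    then show "m ^ d \<le> card {i. i < n \<and> g i = c}" by (simp only: of_nat_le_iff)
  qed simp
  then show ?thesis
    unfolding dense_choice_def set_Pi_pmf[OF finite_cells] by (auto simp: PiE_dflt_def)
qed

lemma finite_dense_choice:
  assumes "\<not> few g"
  shows "finite (set_pmf (dense_choice g))"
  unfolding set_dense_choice[OF assms] by (intro finite_PiE_dflt finite_cells) simp

lemma dense_choiceD: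
  assumes "\<not> few g" "F \<in> set_pmf (dense_choice g)" "c \<in> cells d k"
  shows "F c \<subseteq> {i. i < n \<and> g i = c}" "card (F c) = m ^ d" "finite (F c)"
proof -
  show F: "F c \<subseteq> {i. i < n \<and> g i = c}" "card (F c) = m ^ d"
    using assms by (auto simp: set_dense_choice PiE_dflt_def)
  show "finite (F c)" by (rule finite_subset[OF F(1)]) simp
qed

text \<open>Half the grid spacing is \<open>1 / (2 * M)\<close> in the sparse case and
  \<open>1 / (2 * k * m)\<close> in the dense case, where a point is served by the grid of its own
  cell.\<close>

lemma LV_covers:
  assumes S: "S \<in> set_pmf (LV d p A n X)"
    and r: "1 / (2 * real M) \<le> r" "1 / (2 * real k * real m) \<le> r"
  shows "covers d n r (positions S)"
  unfolding covers_def
proof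
  fix x assume xd: "x \<in> unit_cube d"
  have x: "0 \<le> x j \<and> x j \<le> 1" if "j < d" for j
    using PiE_mem[OF xd[unfolded unit_cube_def], of j] that by simp
  let ?g = "\<lambda>i. cell_of d k (X i)"
  show "\<exists>i<n. \<forall>j<d. \<bar>x j - positions S i j\<bar> \<le> r"
  proof (cases "few ?g")
    case True
    then obtain T where T: "S = sparse_state T X" "T \<subseteq> {..<n}" "card T = M ^ d"
      using S by (auto simp: LV_eq Let_def set_sparse_choice)
    have "finite T" by (rule finite_subset[OF T(2)]) simp
    then have "\<exists>i\<in>T. \<forall>j<d. \<bar>x j - positions S i j\<bar> \<le> 1 / (2 * real M)"
      unfolding T(1) sparse_state_def by (rule MV_covers) (use T M x in auto)
    then show ?thesis using T(2) r(1) by (meson lessThan_iff order_trans subsetD)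
  next
    case False
    then obtain F where F: "S = dense_state ?g F X" "F \<in> set_pmf (dense_choice ?g)"
      using S by (auto simp: LV_eq Let_def)
    let ?c = "cell_of d k x"
    have c: "?c \<in> cells d k" by (rule cell_of_in_cells[OF k])
    note Fc = dense_choiceD[OF False F(2) c]
    have "\<exists>i\<in>F ?c. \<forall>j<d. \<bar>x j - positions (MV d m (1 / real k) (corner k ?c) d (sorted_list_of_set (F ?c)) (start X)) i j\<bar>
        \<le> 1 / real k / (2 * real m)"
    proof (rule MV_covers[OF Fc(3,2) m])
      fix j assume j: "j < d"
      have "real (slice k (x j)) \<le> real k * x j" "real k * x j \<le> real (slice k (x j)) + 1"
        using slice_bounds[OF k] x[OF j] by auto
      then show "corner k ?c j \<le> x j \<and> x j \<le> corner k ?c j + 1 / real k"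
        using k j by (simp add: corner_def cell_of_slice field_simps)
    qed (use k in simp)
    then obtain i where i: "i \<in> F ?c"
      "\<And>j. j < d \<Longrightarrow> \<bar>x j - positions (MV d m (1 / real k) (corner k ?c) d (sorted_list_of_set (F ?c)) (start X)) i j\<bar>
        \<le> 1 / real k / (2 * real m)" by blast
    have gi: "i < n" "cell_of d k (X i) = ?c" using Fc(1) i(1) by auto
    have "positions S i = positions (MV d m (1 / real k) (corner k ?c) d (sorted_list_of_set (F ?c)) (start X)) i"
      by (simp add: F(1) dense_state_def positions_def gi(2))
    moreover have "1 / real k / (2 * real m) \<le> r" using r(2) by (simp add: mult_ac)
    ultimately have "\<forall>j<d. \<bar>x j - positions S i j\<bar> \<le> r"
      using i(2) by (metis order_trans)
    then show ?thesis using gi(1) by blast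
  qed
qed

section \<open>Mean movement for a fixed placement, and its measurability\<close>

definition sparse_mean :: "(nat \<Rightarrow> point) \<Rightarrow> real" where
  "sparse_mean X = measure_pmf.expectation sparse_choice (\<lambda>T. total_movement a n (sparse_state T X))"

definition dense_mean :: "(nat \<Rightarrow> nat \<Rightarrow> nat) \<Rightarrow> (nat \<Rightarrow> point) \<Rightarrow> real" where
  "dense_mean g X = measure_pmf.expectation (dense_choice g) (\<lambda>F. total_movement a n (dense_state g F X))"

lemma assignment_eq: "i < n \<Longrightarrow> assignment X i = cell_of d k (X i)"
  by (simp add: assignment_def)

lemma mean_movement_eq:
  "mean_movement d p A a n X = (if few (assignment X) then sparse_mean X else dense_mean (assignment X) X)"
proof -
  let ?g = "\<lambda>i. cell_of d k (X i)"
  have few: "few ?g = few (assignment X)" by (rule few_cong) (simp add: assignment_eq)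
  have choice: "dense_choice ?g = dense_choice (assignment X)"
    by (rule dense_choice_cong) (simp add: assignment_eq)
  have state: "total_movement a n (dense_state ?g F X) = total_movement a n (dense_state (assignment X) F X)" for F
    unfolding total_movement_def
    by (rule sum.cong) (simp_all add: displacement_def dense_state_def assignment_eq)
  show ?thesis
    unfolding mean_movement_def LV_eq Let_def few sparse_mean_def dense_mean_def
    by (simp add: choice state)
qed

lemma total_movement_nonneg: "total_movement a n S \<ge> 0"
  by (simp add: total_movement_def sum_nonneg)

lemma sparse_mean_nonneg: "sparse_mean X \<ge> 0"
  unfolding sparse_mean_def by (intro Bochner_Integration.integral_nonneg total_movement_nonneg)

lemma dense_mean_nonneg: "dense_mean g X \<ge> 0"
  unfolding dense_mean_def by (intro Bochner_Integration.integral_nonneg total_movement_nonneg)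

lemma measurable_total_sparse:
  "(\<lambda>X. total_movement a n (sparse_state T X)) \<in> borel_measurable P"
  unfolding total_movement_def sparse_state_def
  by (rule borel_measurable_sum_powr) (rule measurable_MV_displacement)

lemma displacement_dense: "displacement (dense_state g F X) i =
    displacement (MV d m (1 / real k) (corner k (g i)) d (sorted_list_of_set (F (g i))) (start X)) i"
  by (simp add: displacement_def dense_state_def)

lemma measurable_total_dense:
  "(\<lambda>X. total_movement a n (dense_state g F X)) \<in> borel_measurable P"
  unfolding total_movement_def displacement_dense
  by (rule borel_measurable_sum_powr) (rule measurable_MV_displacement)

lemma measurable_sparse_mean: "sparse_mean \<in> borel_measurable P"
proof -
  have "sparse_mean X = (\<Sum>T\<in>set_pmf sparse_choice. total_movement a n (sparse_state T X) * pmf sparse_choice T)" for X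
    unfolding sparse_mean_def by (rule integral_measure_pmf_real[OF finite_sparse_choice])
  then have eq: "sparse_mean = (\<lambda>X. \<Sum>T\<in>set_pmf sparse_choice. total_movement a n (sparse_state T X) * pmf sparse_choice T)"
    by blast
  show ?thesis
    unfolding eq by (rule borel_measurable_sum) (rule borel_measurable_times[OF measurable_total_sparse borel_measurable_const])
qed

lemma measurable_dense_mean:
  assumes "\<not> few g"
  shows "dense_mean g \<in> borel_measurable P"
proof -
  have "dense_mean g X = (\<Sum>F\<in>set_pmf (dense_choice g). total_movement a n (dense_state g F X) * pmf (dense_choice g) F)" for X
    unfolding dense_mean_def by (rule integral_measure_pmf_real[OF finite_dense_choice[OF assms]])
  then have eq: "dense_mean g = (\<lambda>X. \<Sum>F\<in>set_pmf (dense_choice g). total_movement a n (dense_state g F X) * pmf (dense_choice g) F)"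
    by blast
  show ?thesis
    unfolding eq by (rule borel_measurable_sum) (rule borel_measurable_times[OF measurable_total_dense borel_measurable_const])
qed

definition assignments :: "(nat \<Rightarrow> nat \<Rightarrow> nat) set" where
  "assignments = {..<n} \<rightarrow>\<^sub>E cells d k"

lemma finite_assignments: "finite assignments"
  unfolding assignments_def by (intro finite_PiE finite_cells) simp

lemma assignment_in: "assignment X \<in> assignments"
  by (simp add: assignments_def assignment_def cell_of_in_cells[OF k])

lemma measurable_assignment: "assignment \<in> measurable P (count_space assignments)"
  unfolding measurable_count_space_eq2[OF finite_assignments]
proof (intro conjI ballI)
  show "assignment \<in> space P \<rightarrow> assignments" using assignment_in by blast
  fix g assume g: "g \<in> assignments"
  have "assignment X = g \<longleftrightarrow> (\<forall>i\<in>{..<n}. \<forall>j\<in>{..<d}. slice k (X i j) = g i j)" for X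
  proof -
    have "assignment X = g \<longleftrightarrow> (\<forall>i<n. cell_of d k (X i) = g i)"
      using g by (auto simp: assignments_def assignment_def PiE_iff extensional_def fun_eq_iff)
    also have "\<dots> \<longleftrightarrow> (\<forall>i\<in>{..<n}. \<forall>j\<in>{..<d}. slice k (X i j) = g i j)"
      using g by (auto simp: cell_of_eq_iff assignments_def PiE_iff)
    finally show ?thesis .
  qed
  then have "assignment -` {g} \<inter> space P = {X\<in>space P. \<forall>i\<in>{..<n}. \<forall>j\<in>{..<d}. slice k (X i j) = g i j}"
    by blast
  also have "\<dots> \<in> sets P"
  proof (intro sets.sets_Collect_finite_All finite_lessThan)
    fix i j
    have "(\<lambda>X. slice k (X i j)) \<in> measurable P (count_space UNIV)"
      by (rule measurable_compose[OF measurable_sensor_coordinate measurable_slice])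
    from measurable_sets[OF this, of "{g i j}"]
    show "{X\<in>space P. slice k (X i j) = g i j} \<in> sets P"
      by (simp add: vimage_def Int_def conj_commute)
  qed
  finally show "assignment -` {g} \<inter> space P \<in> sets P" .
qed

lemma measurable_from_assignment:
  assumes "\<And>g. g \<in> assignments \<Longrightarrow> f g \<in> borel_measurable P"
  shows "(\<lambda>X. f (assignment X) X) \<in> borel_measurable P"
  by (rule measurable_compose_countable'[OF assms measurable_assignment countable_finite[OF finite_assignments]])

lemma measurable_mean_movement: "mean_movement d p A a n \<in> borel_measurable P"
proof -
  have "(\<lambda>X. (\<lambda>g X. if few g then sparse_mean X else dense_mean g X) (assignment X) X) \<in> borel_measurable P"
  proof (rule measurable_from_assignment)
    fix g show "(\<lambda>X. if few g then sparse_mean X else dense_mean g X) \<in> borel_measurable P"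
      by (cases "few g") (simp_all add: measurable_sparse_mean measurable_dense_mean)
  qed
  moreover have "mean_movement d p A a n = (\<lambda>X. if few (assignment X) then sparse_mean X else dense_mean (assignment X) X)"
    by (rule ext) (rule mean_movement_eq)
  ultimately show ?thesis by (simp only:)
qed

lemma sets_few: "{X \<in> space P. few (assignment X)} \<in> sets P"
proof -
  have "assignment -` {g\<in>assignments. few g} \<inter> space P \<in> sets P"
    by (rule measurable_sets[OF measurable_assignment]) simp
  also have "assignment -` {g\<in>assignments. few g} \<inter> space P = {X \<in> space P. few (assignment X)}"
    using assignment_in by auto
  finally show ?thesis .
qed

text \<open>Union bound over the \<open>k ^ d\<close> cells, each with mean occupation
  \<open>n / k ^ d\<close>.\<close>

lemma measure_few:
  "measure P {X \<in> space P. few (assignment X)} \<le> real (k ^ d) * exp (- (4 / 15) * (real n / real k ^ d))"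
proof -
  interpret P: prob_space P by (rule prob_space_placement)
  let ?Q = "uniform_cube d"
  define C where "C c = {x \<in> space ?Q. cell_of d k x = c}" for c
  define E where "E c = {X \<in> space P. real (card {i. i < n \<and> X i \<in> C c}) < real n * measure ?Q (C c) / 3}" for c
  have C: "C c \<in> sets ?Q" "measure ?Q (C c) = (1 / real k) ^ d" if "c \<in> cells d k" for c
    using emeasure_cell[OF that] by (simp_all add: C_def)
  have E: "E c \<in> sets P" if "c \<in> cells d k" for c
  proof -
    have "(\<lambda>X. real (card {i\<in>{..<n}. X i \<in> C c})) \<in> borel_measurable P"
      by (rule measurable_count) (use C[OF that] in simp_all)
    from borel_measurable_less[OF this borel_measurable_const]
    show ?thesis unfolding E_def by (simp only: lessThan_iff)
  qed
  have "{X \<in> space P. few (assignment X)} \<subseteq> (\<Union>c\<in>cells d k. E c)"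
  proof
    fix X assume "X \<in> {X \<in> space P. few (assignment X)}"
    then have X: "X \<in> space P" and "few (assignment X)" by simp_all
    then obtain c where c: "c \<in> cells d k"
      "real (card {i. i < n \<and> assignment X i = c}) < 1 / 3 * (real n / real k ^ d)"
      unfolding few_def by blast
    have "X i \<in> space ?Q" if "i < n" for i
      using X that by (auto simp: placement_def space_PiM)
    then have "{i. i < n \<and> assignment X i = c} = {i. i < n \<and> X i \<in> C c}"
      by (auto simp: assignment_eq C_def)
    then have "X \<in> E c"
      using c X C(2)[OF c(1)] by (simp add: E_def power_divide)
    then show "X \<in> (\<Union>c\<in>cells d k. E c)" using c(1) by blast
  qed
  then have "measure P {X \<in> space P. few (assignment X)} \<le> measure P (\<Union>c\<in>cells d k. E c)"
    by (rule P.finite_measure_mono) (intro sets.finite_UN finite_cells E)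
  also have "\<dots> \<le> (\<Sum>c\<in>cells d k. measure P (E c))"
    by (rule P.finite_measure_subadditive_finite[OF finite_cells]) (use E in blast)
  also have "\<dots> \<le> (\<Sum>c\<in>cells d k. exp (- (4 / 15) * (real n / real k ^ d)))"
  proof (rule sum_mono)
    fix c assume c: "c \<in> cells d k"
    have "measure P (E c) \<le> exp (- (4 / 15) * (real n * measure ?Q (C c)))"
      unfolding E_def placement_def by (rule Chernoff_few[OF prob_space_uniform_cube C(1)[OF c]])
    then show "measure P (E c) \<le> exp (- (4 / 15) * (real n / real k ^ d))"
      by (simp add: C(2)[OF c] power_divide)
  qed
  finally show ?thesis by (simp add: card_cells)
qed

section \<open>Expected movement in the sparse and in the dense case\<close>

lemma total_sparse_le:
  assumes "T \<in> set_pmf sparse_choice" "b > 0"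
  shows "total_movement b n (sparse_state T X) \<le> MV_cost b d M d (sorted_list_of_set T) X"
proof -
  have T: "T \<subseteq> {..<n}" "card T = M ^ d" using assms by (simp_all add: set_sparse_choice)
  have fin: "finite T" by (rule finite_subset[OF T(1)]) simp
  have "total_movement b n (sparse_state T X) = (\<Sum>i\<in>T. displacement (sparse_state T X) i powr b)"
    unfolding total_movement_def sparse_state_def
    by (rule sum.mono_neutral_right) (use T fin in \<open>auto simp: MV_displacement_unused\<close>)
  also have "\<dots> \<le> 1 powr b * MV_cost b d M d (sorted_list_of_set T) X"
    unfolding sparse_state_def by (rule sum_displacement_le_cost) (use T fin assms in simp_all)
  finally show ?thesis by simp
qed

text \<open>On the event the placement is not uniform, so \<open>nn_integral_MV_cost\<close> cannot
  be used there. \<open>powr_le_truncated\<close> leaves the indicator only on the summand with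
  \<open>t powr a\<close>; the cost of order \<open>6 * a\<close> is integrated over all placements,
  and its exponent \<open>- 6 * a / 2\<close> is the \<open>- 3 * a\<close> of the bound.\<close>

lemma nn_integral_sparse:
  assumes t: "t > 0"
  shows "(\<integral>\<^sup>+X. ennreal (indicator {X. few (assignment X)} X * sparse_mean X) \<partial>P)
    \<le> ennreal (real n * t powr a * measure P {X \<in> space P. few (assignment X)})
      + ennreal (t powr (- 5 * a) * (MV_const (6 * a) d * (real M ^ d * real M powr (- 3 * a))))"
    (is "_ \<le> ?B")
proof -
  interpret P: prob_space P by (rule prob_space_placement)
  let ?ind = "\<lambda>X. indicat_real {X. few (assignment X)} X"
  let ?f = "\<lambda>T X. ?ind X * total_movement a n (sparse_state T X)"
  have ind: "?ind \<in> borel_measurable P"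
  proof -
    have "(\<lambda>X. (\<lambda>g X. if few g then 1 else 0) (assignment X) X :: real) \<in> borel_measurable P"
      by (rule measurable_from_assignment) simp
    then show ?thesis by (simp add: indicator_def of_bool_def)
  qed
  have "(\<integral>\<^sup>+X. ennreal (measure_pmf.expectation sparse_choice (\<lambda>T. ?f T X)) \<partial>P) \<le> ?B"
  proof (rule nn_integral_expectation_pmf_le[OF finite_sparse_choice])
    fix T assume T: "T \<in> set_pmf sparse_choice"
    then have T': "T \<subseteq> {..<n}" "card T = M ^ d" by (simp_all add: set_sparse_choice)
    have fin: "finite T" by (rule finite_subset[OF T'(1)]) simp
    show "?f T X \<ge> 0" for X by (simp add: total_movement_nonneg)
    show "?f T \<in> borel_measurable P"
      by (rule borel_measurable_times[OF ind measurable_total_sparse])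
    let ?L = "sorted_list_of_set T"
    have "?f T X \<le> ?ind X * (real n * t powr a) + t powr (- 5 * a) * MV_cost (6 * a) d M d ?L X" for X
    proof (cases "few (assignment X)")
      case True
      have "total_movement a n (sparse_state T X)
          \<le> (\<Sum>i<n. t powr a + t powr (- 5 * a) * displacement (sparse_state T X) i powr (6 * a))"
        unfolding total_movement_def sparse_state_def
        by (intro sum_mono powr_le_truncated MV_displacement_nonneg fin T' t a)
      also have "\<dots> = real n * t powr a + t powr (- 5 * a) * total_movement (6 * a) n (sparse_state T X)"
        by (simp add: total_movement_def sum.distrib flip: sum_distrib_left)
      also have "\<dots> \<le> real n * t powr a + t powr (- 5 * a) * MV_cost (6 * a) d M d ?L X"
        by (intro add_left_mono mult_left_mono total_sparse_le T) (use a in simp_all)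
      finally show ?thesis using True by simp
    qed (simp add: MV_cost_nonneg)
    then have "(\<integral>\<^sup>+X. ennreal (?f T X) \<partial>P)
        \<le> (\<integral>\<^sup>+X. ennreal (?ind X * (real n * t powr a)) + ennreal (t powr (- 5 * a)) * ennreal (MV_cost (6 * a) d M d ?L X) \<partial>P)"
      by (intro nn_integral_mono) (simp add: MV_cost_nonneg ennreal_leI flip: ennreal_plus ennreal_mult)
    also have "\<dots> = (\<integral>\<^sup>+X. ennreal (?ind X * (real n * t powr a)) \<partial>P)
        + ennreal (t powr (- 5 * a)) * (\<integral>\<^sup>+X. ennreal (MV_cost (6 * a) d M d ?L X) \<partial>P)"
    proof -
      have 1: "(\<lambda>X. ennreal (?ind X * (real n * t powr a))) \<in> borel_measurable P"
        by (rule measurable_compose[OF borel_measurable_times[OF ind borel_measurable_const] measurable_ennreal])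
      have 2: "(\<lambda>X. ennreal (MV_cost (6 * a) d M d ?L X)) \<in> borel_measurable P"
        by (rule measurable_compose[OF measurable_MV_cost measurable_ennreal])
      have 3: "(\<lambda>X. ennreal (t powr (- 5 * a)) * ennreal (MV_cost (6 * a) d M d ?L X)) \<in> borel_measurable P"
        by (rule borel_measurable_times_ennreal[OF borel_measurable_const 2])
      show ?thesis by (simp only: nn_integral_add[OF 1 3] nn_integral_cmult[OF 2])
    qed
    also have "\<dots> \<le> ?B"
    proof (rule add_mono)
      have "(\<integral>\<^sup>+X. ennreal (?ind X * (real n * t powr a)) \<partial>P)
          = (\<integral>\<^sup>+X. ennreal (real n * t powr a) * indicator {X \<in> space P. few (assignment X)} X \<partial>P)"
        by (intro nn_integral_cong) (simp add: indicator_def)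
      also have "\<dots> = ennreal (real n * t powr a) * emeasure P {X \<in> space P. few (assignment X)}"
        by (rule nn_integral_cmult_indicator[OF sets_few])
      finally show "(\<integral>\<^sup>+X. ennreal (?ind X * (real n * t powr a)) \<partial>P)
          \<le> ennreal (real n * t powr a * measure P {X \<in> space P. few (assignment X)})"
        by (simp add: P.emeasure_eq_measure ennreal_mult)
      have "(\<integral>\<^sup>+X. ennreal (MV_cost (6 * a) d M d ?L X) \<partial>P)
          \<le> ennreal (MV_const (6 * a) d * (real M ^ d * real M powr (- (6 * a) / 2)))"
        by (rule nn_integral_MV_cost) (use T' fin M a in simp_all)
      then show "ennreal (t powr (- 5 * a)) * (\<integral>\<^sup>+X. ennreal (MV_cost (6 * a) d M d ?L X) \<partial>P)
          \<le> ennreal (t powr (- 5 * a) * (MV_const (6 * a) d * (real M ^ d * real M powr (- 3 * a))))"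
        by (simp add: ennreal_mult MV_const_nonneg mult_left_mono)
    qed
    finally show "(\<integral>\<^sup>+X. ennreal (?f T X) \<partial>P) \<le> ?B" .
  qed
  then show ?thesis by (simp add: sparse_mean_def)
qed

lemma total_dense_le:
  assumes g: "g \<in> assignments" "\<not> few g" and F: "F \<in> set_pmf (dense_choice g)"
    and X: "\<And>i c. i < n \<Longrightarrow> c < d \<Longrightarrow> X i c = (real (g i c) + Y i c) / real k"
  shows "total_movement a n (dense_state g F X)
    \<le> (\<Sum>c\<in>cells d k. (1 / real k) powr a * MV_cost a d m d (sorted_list_of_set (F c)) Y)"
proof -
  let ?D = "\<lambda>c. MV d m (1 / real k) (corner k c) d (sorted_list_of_set (F c)) (start X)"
  note FD = dense_choiceD[OF g(2) F]
  have gi: "g i \<in> cells d k" if "i < n" for i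
    using g(1) that by (auto simp: assignments_def)
  have "total_movement a n (dense_state g F X) = (\<Sum>i<n. displacement (?D (g i)) i powr a)"
    by (simp add: total_movement_def displacement_dense)
  also have "\<dots> = (\<Sum>c\<in>cells d k. \<Sum>i\<in>{i\<in>{..<n}. g i = c}. displacement (?D (g i)) i powr a)"
    by (rule sum.group[symmetric]) (use gi finite_cells in auto)
  also have "\<dots> \<le> (\<Sum>c\<in>cells d k. (1 / real k) powr a * MV_cost a d m d (sorted_list_of_set (F c)) Y)"
  proof (rule sum_mono)
    fix c assume c: "c \<in> cells d k"
    have "(\<Sum>i\<in>{i\<in>{..<n}. g i = c}. displacement (?D (g i)) i powr a)
        = (\<Sum>i\<in>{i\<in>{..<n}. g i = c}. displacement (?D c) i powr a)"
      by (rule sum.cong) auto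
    also have "\<dots> = (\<Sum>i\<in>F c. displacement (?D c) i powr a)"
      by (rule sum.mono_neutral_right) (use FD[OF c] in \<open>auto simp: MV_displacement_unused\<close>)
    also have "\<dots> \<le> (1 / real k) powr a * MV_cost a d m d (sorted_list_of_set (F c)) Y"
    proof (rule sum_displacement_le_cost[OF FD(3,2)[OF c] _ a])
      show "1 / real k > 0" using k by simp
      fix i j assume "i \<in> F c" "j < d"
      then show "X i j = corner k c j + 1 / real k * Y i j"
        using FD(1)[OF c] X[of i j] by (auto simp: corner_def add_divide_distrib)
    qed
    finally show "(\<Sum>i\<in>{i\<in>{..<n}. g i = c}. displacement (?D (g i)) i powr a)
        \<le> (1 / real k) powr a * MV_cost a d m d (sorted_list_of_set (F c)) Y" .
  qed
  finally show ?thesis .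
qed

text \<open>Given the cells of the sensors, their positions inside the cells are independent and uniform;
  so redraw the positions inside the cells.\<close>

lemma nn_integral_dense:
  "(\<integral>\<^sup>+X. ennreal (if few (assignment X) then 0 else dense_mean (assignment X) X) \<partial>P)
    \<le> ennreal (real (k ^ d) * ((1 / real k) powr a * (MV_const a d * (real m ^ d * real m powr (- a / 2)))))"
    (is "_ \<le> ?B")
proof -
  interpret P: prob_space P by (rule prob_space_placement)
  define h where "h = (\<lambda>(x, y). (real (slice k x) + y) / real k)"
  define Z where "Z X Y = (\<lambda>i\<in>{..<n}. \<lambda>c\<in>{..<d}. h (X i c, Y i c))" for X Y :: "nat \<Rightarrow> point"
  define f where "f X = ennreal (if few (assignment X) then 0 else dense_mean (assignment X) X)" for X
  have f: "f \<in> borel_measurable P"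
  proof -
    have "(\<lambda>X. (\<lambda>g X. if few g then 0 else dense_mean g X) (assignment X) X) \<in> borel_measurable P"
    proof (rule measurable_from_assignment)
      fix g show "(\<lambda>X. if few g then 0 else dense_mean g X) \<in> borel_measurable P"
        by (cases "few g") (simp_all add: measurable_dense_mean)
    qed
    from measurable_compose[OF this measurable_ennreal] show ?thesis
      unfolding f_def by simp
  qed
  have inner: "(\<integral>\<^sup>+Y. f (Z X Y) \<partial>P) \<le> ?B" for X
  proof (cases "few (assignment X)")
    case True
    have "AE Y in P. f (Z X Y) = 0"
      using AE_placement[of n d]
    proof eventually_elim
      case (elim Y)
      \<comment> \<open>Almost surely the fresh position is at least 0 and below 1, so the redrawn
        sensor stays in its cell.\<close>
      have "assignment (Z X Y) = assignment X"
        using elim by (auto simp: assignment_def cell_of_slice Z_def h_def slice_eq slice_less[OF k] restrict_def fun_eq_iff)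
      then show ?case using True by (simp add: f_def)
    qed
    then have "(\<integral>\<^sup>+Y. f (Z X Y) \<partial>P) = (\<integral>\<^sup>+Y. 0 \<partial>P)" by (rule nn_integral_cong_AE)
    then show ?thesis by simp
  next
    case False
    \<comment> \<open>With \<open>X\<close> fixed, \<open>g\<close> is a constant: the law of the
      choice and the corners no longer depend on the sample \<open>Y\<close>, whose coordinates are
      the rescaled positions inside the cells.\<close>
    define g where "g = assignment X"
    have g: "g \<in> assignments" "\<not> few g" using False assignment_in by (simp_all add: g_def)
    let ?V = "\<lambda>F Y. \<Sum>c\<in>cells d k. (1 / real k) powr a * MV_cost a d m d (sorted_list_of_set (F c)) Y"
    have "(\<integral>\<^sup>+Y. f (Z X Y) \<partial>P) \<le> (\<integral>\<^sup>+Y. ennreal (measure_pmf.expectation (dense_choice g) (\<lambda>F. ?V F Y)) \<partial>P)"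
    proof (rule nn_integral_mono_AE)
      show "AE Y in P. f (Z X Y) \<le> ennreal (measure_pmf.expectation (dense_choice g) (\<lambda>F. ?V F Y))"
        using AE_placement[of n d]
      proof eventually_elim
        case (elim Y)
        have "assignment (Z X Y) = g"
          using elim by (auto simp: g_def assignment_def cell_of_slice Z_def h_def slice_eq slice_less[OF k] restrict_def fun_eq_iff)
        then have "f (Z X Y) = ennreal (dense_mean g (Z X Y))" using g(2) by (simp add: f_def)
        also have "dense_mean g (Z X Y) \<le> measure_pmf.expectation (dense_choice g) (\<lambda>F. ?V F Y)"
          unfolding dense_mean_def
        proof (rule integral_mono_AE)
          show "AE F in dense_choice g. total_movement a n (dense_state g F (Z X Y)) \<le> ?V F Y"
            unfolding AE_measure_pmf_iff
          proof
            fix F assume F: "F \<in> set_pmf (dense_choice g)"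
            show "total_movement a n (dense_state g F (Z X Y)) \<le> ?V F Y"
              by (rule total_dense_le[OF g F])
                (simp add: Z_def h_def g_def assignment_eq cell_of_slice)
          qed
        qed (rule integrable_measure_pmf_finite[OF finite_dense_choice[OF g(2)]])+
        finally show ?case by (simp add: ennreal_leI)
      qed
    qed
    also have "\<dots> \<le> ?B"
    proof (rule nn_integral_expectation_pmf_le[OF finite_dense_choice[OF g(2)]])
      fix F assume F: "F \<in> set_pmf (dense_choice g)"
      note FD = dense_choiceD[OF g(2) F]
      show "?V F Y \<ge> 0" for Y by (intro sum_nonneg mult_nonneg_nonneg MV_cost_nonneg) simp
      show "?V F \<in> borel_measurable P"
        by (rule borel_measurable_sum) (rule borel_measurable_times[OF borel_measurable_const measurable_MV_cost])
      have cost: "(\<integral>\<^sup>+Y. ennreal (MV_cost a d m d (sorted_list_of_set (F c)) Y) \<partial>P)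
          \<le> ennreal (MV_const a d * (real m ^ d * real m powr (- a / 2)))" if "c \<in> cells d k" for c
        by (rule nn_integral_MV_cost) (use FD[OF that] m a in auto)
      have "(\<integral>\<^sup>+Y. ennreal (?V F Y) \<partial>P)
          = (\<integral>\<^sup>+Y. (\<Sum>c\<in>cells d k. ennreal ((1 / real k) powr a) * ennreal (MV_cost a d m d (sorted_list_of_set (F c)) Y)) \<partial>P)"
        by (intro nn_integral_cong) (simp add: MV_cost_nonneg flip: sum_ennreal ennreal_mult)
      also have "\<dots> = (\<Sum>c\<in>cells d k. ennreal ((1 / real k) powr a) * (\<integral>\<^sup>+Y. ennreal (MV_cost a d m d (sorted_list_of_set (F c)) Y) \<partial>P))"
      proof -
        have 1: "(\<lambda>Y. ennreal (MV_cost a d m d (sorted_list_of_set (F c)) Y)) \<in> borel_measurable P" for c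
          by (rule measurable_compose[OF measurable_MV_cost measurable_ennreal])
        show ?thesis
          by (subst nn_integral_sum) (simp_all add: nn_integral_cmult 1)
      qed
      also have "\<dots> \<le> (\<Sum>c\<in>cells d k. ennreal ((1 / real k) powr a) * ennreal (MV_const a d * (real m ^ d * real m powr (- a / 2))))"
        by (intro sum_mono mult_left_mono cost) simp_all
      also have "\<dots> = ?B"
        by (simp add: card_cells ennreal_mult MV_const_nonneg ennreal_of_nat_eq_real_of_nat flip: of_nat_power)
      finally show "(\<integral>\<^sup>+Y. ennreal (?V F Y) \<partial>P) \<le> ?B" .
    qed
    finally show ?thesis .
  qed
  have "(\<integral>\<^sup>+X. f X \<partial>P) = (\<integral>\<^sup>+X. \<integral>\<^sup>+Y. f (Z X Y) \<partial>P \<partial>P)"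
    unfolding Z_def by (rule nn_integral_resamples_placement[OF _ f]) (simp add: h_def resamples_slice[OF k])
  also have "\<dots> \<le> (\<integral>\<^sup>+X. ?B \<partial>P)" by (intro nn_integral_mono inner)
  also have "\<dots> = ?B" by (simp add: P.emeasure_space_1)
  finally show ?thesis by (simp add: f_def)
qed

text \<open>The estimates are made with nonnegative integrals. Integrability has to come with them,
  as the integral in \<open>expected_movement\<close> would default to 0 without it.\<close>

lemma mean_movement_bound:
  assumes t: "t > 0"
  defines "B \<equiv> real n * t powr a * (real (k ^ d) * exp (- (4 / 15) * (real n / real k ^ d)))
      + t powr (- 5 * a) * (MV_const (6 * a) d * (real M ^ d * real M powr (- 3 * a)))
      + real (k ^ d) * ((1 / real k) powr a * (MV_const a d * (real m ^ d * real m powr (- a / 2))))"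
  shows "integrable P (mean_movement d p A a n)" and "expected_movement d p A a n \<le> B"
proof -
  interpret P: prob_space P by (rule prob_space_placement)
  let ?s = "\<lambda>X. indicat_real {X. few (assignment X)} X * sparse_mean X"
  let ?g = "\<lambda>X. if few (assignment X) then 0 else dense_mean (assignment X) X"
  have nonneg: "mean_movement d p A a n X \<ge> 0" for X
    by (simp add: mean_movement_eq sparse_mean_nonneg dense_mean_nonneg)
  have B: "B \<ge> 0"
    unfolding B_def by (intro add_nonneg_nonneg mult_nonneg_nonneg MV_const_nonneg) simp_all
  have "(\<integral>\<^sup>+X. ennreal (mean_movement d p A a n X) \<partial>P) = (\<integral>\<^sup>+X. ennreal (?s X) + ennreal (?g X) \<partial>P)"
    by (intro nn_integral_cong) (simp add: mean_movement_eq)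
  also have "\<dots> = (\<integral>\<^sup>+X. ennreal (?s X) \<partial>P) + (\<integral>\<^sup>+X. ennreal (?g X) \<partial>P)"
  proof (rule nn_integral_add)
    have "(\<lambda>X. (\<lambda>g X. if few g then sparse_mean X else 0) (assignment X) X) \<in> borel_measurable P"
    proof (rule measurable_from_assignment)
      fix g show "(\<lambda>X. if few g then sparse_mean X else 0) \<in> borel_measurable P"
        by (cases "few g") (simp_all add: measurable_sparse_mean)
    qed
    moreover have "(if few (assignment X) then sparse_mean X else 0) = ?s X" for X by simp
    ultimately have "?s \<in> borel_measurable P" by (simp only:)
    from measurable_compose[OF this measurable_ennreal]
    show "(\<lambda>X. ennreal (?s X)) \<in> borel_measurable P" .
    have "(\<lambda>X. (\<lambda>g X. if few g then 0 else dense_mean g X) (assignment X) X) \<in> borel_measurable P"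
    proof (rule measurable_from_assignment)
      fix g show "(\<lambda>X. if few g then 0 else dense_mean g X) \<in> borel_measurable P"
        by (cases "few g") (simp_all add: measurable_dense_mean)
    qed
    from measurable_compose[OF this measurable_ennreal]
    show "(\<lambda>X. ennreal (?g X)) \<in> borel_measurable P" .
  qed
  also have "\<dots> \<le> ennreal B"
  proof -
    have "ennreal (real n * t powr a * measure P {X \<in> space P. few (assignment X)})
        \<le> ennreal (real n * t powr a * (real (k ^ d) * exp (- (4 / 15) * (real n / real k ^ d))))"
      by (intro ennreal_leI mult_left_mono measure_few) simp
    then have "(\<integral>\<^sup>+X. ennreal (?s X) \<partial>P)
        \<le> ennreal (real n * t powr a * (real (k ^ d) * exp (- (4 / 15) * (real n / real k ^ d))))
          + ennreal (t powr (- 5 * a) * (MV_const (6 * a) d * (real M ^ d * real M powr (- 3 * a))))"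
      by (intro order_trans[OF nn_integral_sparse[OF t]] add_right_mono)
    note add_mono[OF this nn_integral_dense]
    also have "ennreal (real n * t powr a * (real (k ^ d) * exp (- (4 / 15) * (real n / real k ^ d))))
          + ennreal (t powr (- 5 * a) * (MV_const (6 * a) d * (real M ^ d * real M powr (- 3 * a))))
          + ennreal (real (k ^ d) * ((1 / real k) powr a * (MV_const a d * (real m ^ d * real m powr (- a / 2))))) = ennreal B"
    proof -
      have "ennreal u + ennreal v + ennreal w = ennreal (u + v + w)" if "u \<ge> 0" "v \<ge> 0" "w \<ge> 0" for u v w
        using that by simp
      then show ?thesis
        unfolding B_def by this (intro mult_nonneg_nonneg MV_const_nonneg; simp)+
    qed
    finally show ?thesis .
  qed
  finally have bound: "(\<integral>\<^sup>+X. ennreal (mean_movement d p A a n X) \<partial>P) \<le> ennreal B" .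
  show int: "integrable P (mean_movement d p A a n)"
  proof (rule integrableI_bounded[OF measurable_mean_movement])
    show "(\<integral>\<^sup>+X. ennreal (norm (mean_movement d p A a n X)) \<partial>P) < \<infinity>"
      using order_le_less_trans[OF bound] nonneg by simp
  qed
  have "ennreal (expected_movement d p A a n) = (\<integral>\<^sup>+X. ennreal (mean_movement d p A a n X) \<partial>P)"
    unfolding expected_movement_def by (rule nn_integral_eq_integral[symmetric, OF int]) (simp add: nonneg)
  then have "ennreal (expected_movement d p A a n) \<le> ennreal B"
    using bound by simp
  then show "expected_movement d p A a n \<le> B"
    by (simp only: ennreal_le_iff[OF B])
qed

end

subsection \<open>Asymptotics\<close>

lemma floor_root_bounds:
  assumes "d > 0" "x \<ge> 1"
  shows "floor_root d x > 0" "real (floor_root d x) ^ d \<le> x"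
    "x powr (1 / real d) \<le> 2 * real (floor_root d x)"
    "x powr (1 / real d) - 1 < real (floor_root d x)"
proof -
  let ?z = "x powr (1 / real d)"
  have z: "?z \<ge> 1" using assms by (intro ge_one_powr_ge_zero) simp_all
  then have fr: "real (floor_root d x) = of_int \<lfloor>?z\<rfloor>" by (simp add: floor_root_def)
  have "\<lfloor>?z\<rfloor> \<ge> 1" using z by (simp add: le_floor_iff)
  then have 1: "real (floor_root d x) \<ge> 1" unfolding fr by linarith
  then show "floor_root d x > 0" by simp
  show gt: "?z - 1 < real (floor_root d x)" unfolding fr by linarith
  show "?z \<le> 2 * real (floor_root d x)" using gt 1 by linarith
  have "real (floor_root d x) ^ d \<le> ?z ^ d"
    unfolding fr using z by (intro power_mono) simp_all
  also have "?z ^ d = x" using assms by (simp add: powr_powr flip: powr_realpow)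
  finally show "real (floor_root d x) ^ d \<le> x" .
qed

text \<open>Rounding down loses less than 1, and \<open>z / (z - 1)\<close> decreases in
  \<open>z\<close>; the assumption \<open>x \<ge> 3\<close> makes the root at least
  \<open>u\<close>.\<close>

lemma floor_root_ratio:
  assumes "d > 0" "x \<ge> 3"
  defines "u \<equiv> 3 powr (1 / real d)"
  shows "x powr (1 / real d) / real (floor_root d x) \<le> u / (u - 1)"
proof -
  let ?z = "x powr (1 / real d)" and ?r = "real (floor_root d x)"
  have u: "u > 1" unfolding u_def using assms(1) by (intro gr_one_powr) simp_all
  have zu: "u \<le> ?z" unfolding u_def using assms by (intro powr_mono2) simp_all
  have r: "?r > 0" "?z - 1 < ?r" using floor_root_bounds[of d x] assms by simp_all
  have "?z * (u - 1) \<le> u * (?z - 1)" using zu by (simp add: algebra_simps)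
  also have "\<dots> \<le> u * ?r" using r u by (intro mult_left_mono) simp_all
  finally show ?thesis using r u by (simp add: field_simps)
qed

locale LV_analysis =
  fixes d :: nat and a p A x0 :: real and n :: nat
  assumes d: "d > 0" and a: "a > 0"
    and p: "p = 9 / 4 * (2 + a / real d)"
    and A: "A = 3 / 4 * (2 + a / real d)"
    and x0: "x0 \<ge> 3" "x0 / (p * ln x0) = 3" and n: "real n \<ge> x0"
begin

abbreviation "N \<equiv> real n"
abbreviation "L \<equiv> ln (real n)"
abbreviation "e \<equiv> a / real d"
abbreviation "k \<equiv> floor_root d (N / (p * L))"
abbreviation "m \<equiv> floor_root d (A * L)"
abbreviation "M \<equiv> floor_root d N"

lemma e: "e > 0" using a d by simp

lemma pA: "p = 3 * A" "A \<ge> 3 / 2" "p \<ge> 9 / 2"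
  using e by (simp_all add: p A)

text \<open>\<open>ln x / x\<close> decreases beyond \<open>exp 1\<close>, so the equation for
  \<open>x0\<close> becomes \<open>N / (p * L) \<ge> 3\<close> for all \<open>N \<ge> x0\<close>.
  The same equation with \<open>p \<ge> 9 / 2\<close> and \<open>ln x0 \<ge> 1\<close> forces
  \<open>x0 \<ge> 9\<close>, whence \<open>L \<ge> 2\<close> because
  \<open>exp 2 \<le> 9\<close>.\<close>

lemma size: "x0 \<ge> 9" "N \<ge> 9" "L \<ge> 2" "N / (p * L) \<ge> 3" "A * L \<ge> 3" "p * L > 0"
proof -
  have "ln x0 \<ge> 1" using exp_le x0(1) by (subst ln_ge_iff) simp_all
  have "x0 = 3 * (p * ln x0)" using x0 pA \<open>ln x0 \<ge> 1\<close> by (simp add: field_simps)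
  moreover have "p * ln x0 \<ge> (9 / 2) * 1"
    using pA \<open>ln x0 \<ge> 1\<close> by (intro mult_mono) simp_all
  ultimately show x9: "x0 \<ge> 9" by linarith
  then show N: "N \<ge> 9" using n by simp
  have "exp 2 = exp 1 * exp (1 :: real)" by (simp flip: exp_add)
  also have "\<dots> \<le> 3 * 3" using exp_le by (intro mult_mono) simp_all
  finally have "exp 2 \<le> N" using N by simp
  then show L: "L \<ge> 2" using N by (subst ln_ge_iff) simp_all
  show pL: "p * L > 0" using pA L by simp
  have "(3 / 2) * 2 \<le> A * L" using pA L by (intro mult_mono) simp_all
  then show "A * L \<ge> 3" by simp
  have "L / N \<le> ln x0 / x0"
    using x0 n exp_le by (intro ln_x_over_x_mono) simp_all
  also have "\<dots> = 1 / (3 * p)"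
    using x0 pA \<open>ln x0 \<ge> 1\<close> by (simp add: field_simps)
  finally show "N / (p * L) \<ge> 3" using N pL pA L by (simp add: field_simps)
qed

lemma ge1: "N / (p * L) \<ge> 1" "A * L \<ge> 1" "N \<ge> 1"
  using size(2,4,5) by linarith+

lemma kd: "real k ^ d \<le> N / (p * L)" and md: "real m ^ d \<le> A * L" and Md: "real M ^ d \<le> N"
  by (rule floor_root_bounds(2)[OF d ge1(1)], rule floor_root_bounds(2)[OF d ge1(2)],
      rule floor_root_bounds(2)[OF d ge1(3)])

lemma pos: "k > 0" "m > 0" "M > 0"
  by (rule floor_root_bounds(1)[OF d ge1(1)], rule floor_root_bounds(1)[OF d ge1(2)],
      rule floor_root_bounds(1)[OF d ge1(3)])

text \<open>A third of this mean occupation is at least \<open>A * L \<ge> m ^ d\<close>, which is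
  the condition \<open>enough\<close>.\<close>

lemma per_cell: "p * L \<le> N / real k ^ d"
  using kd pos size by (simp add: field_simps)

sublocale LV_parameters d n k m M p A a
proof
  have "M ^ d \<le> n \<longleftrightarrow> real M ^ d \<le> N"
    by (simp flip: of_nat_power)
  then show "M ^ d \<le> n" using Md by simp
  show "real (m ^ d) \<le> 1 / 3 * (N / real k ^ d)"
    using md per_cell pA by simp
qed (use d a pos in simp_all)

lemma covering_radius:
  assumes "f \<ge> 3 powr (3 / real d) / (3 powr (1 / real d) - 1)\<^sup>2"
  defines "r \<equiv> f / (2 * N powr (1 / real d))"
  shows "1 / (2 * real M) \<le> r" "1 / (2 * real k * real m) \<le> r"
proof -
  define u :: real where "u = 3 powr (1 / real d)"
  let ?Z = "N powr (1 / real d)"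
  have u: "u > 1" unfolding u_def using d by (intro gr_one_powr) simp_all
  have "3 powr (3 / real d) = u ^ 3"
    by (simp add: u_def powr_powr flip: powr_numeral)
  \<comment> \<open>\<open>u ^ 3 / (u - 1)\<^sup>2\<close> regrouped as two rounding losses
    \<open>u / (u - 1)\<close> and one further factor \<open>u\<close>.\<close>
  then have f: "u * (u / (u - 1)) ^ 2 \<le> f"
    using assms(1) by (simp add: u_def[symmetric] power_divide power3_eq_cube power2_eq_square)
  have Z: "?Z > 0" using size by simp
  have "?Z / real M \<le> u / (u - 1)"
    unfolding u_def by (rule floor_root_ratio[OF d]) (use size in simp)
  also have "\<dots> \<le> u * (u / (u - 1)) ^ 2"
  proof -
    have "1 \<le> u / (u - 1)" using u by simp
    then have "1 * 1 \<le> u * (u / (u - 1))" using u by (intro mult_mono) simp_all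
    then have "1 * (u / (u - 1)) \<le> u * (u / (u - 1)) * (u / (u - 1))"
      using u by (intro mult_right_mono) simp_all
    then show ?thesis by (simp add: power2_eq_square mult.assoc)
  qed
  finally have "?Z / real M \<le> f" using f by simp
  then show "1 / (2 * real M) \<le> r" using Z pos by (simp add: r_def field_simps)
  let ?v = "(N / (p * L)) powr (1 / real d)" and ?w = "(A * L) powr (1 / real d)"
  \<comment> \<open>This is \<open>p = 3 * A\<close>: the grid in a cell is sized for a third of
    \<open>p * L\<close>, and the 3 becomes the further factor \<open>u\<close> in the bound on
    \<open>f\<close>.\<close>
  have "N = 3 * (N / (p * L)) * (A * L)" using size pA by (simp add: field_simps)
  then have "?Z = (3 * (N / (p * L)) * (A * L)) powr (1 / real d)" by simp
  also have "\<dots> = u * ?v * ?w"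
  proof -
    have "0 \<le> N / (p * L)" "0 \<le> A * L" using size by linarith+
    then show ?thesis unfolding u_def by (simp only: powr_mult mult_nonneg_nonneg zero_le_numeral)
  qed
  finally have "?Z / (real k * real m) = u * ((?v / real k) * (?w / real m))" by simp
  also have "\<dots> \<le> u * ((u / (u - 1)) * (u / (u - 1)))"
  proof (intro mult_left_mono mult_mono)
    show "?v / real k \<le> u / (u - 1)" "?w / real m \<le> u / (u - 1)"
      unfolding u_def by (rule floor_root_ratio[OF d]; use size in simp)+
  qed (use u in simp_all)
  also have "\<dots> \<le> f" using f by (simp add: power2_eq_square)
  finally show "1 / (2 * real k * real m) \<le> r" using Z pos by (simp add: r_def field_simps)
qed

lemma N_powr: "N powr s = exp (s * L)"
  using size by (simp add: powr_def)

abbreviation "T \<equiv> N powr (1 - e) * L powr (e / 2)"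

lemma target: "N powr (1 - a / (2 * real d)) * (L / N) powr (a / (2 * real d)) = T"
proof -
  have "(L / N) powr (e / 2) = L powr (e / 2) / N powr (e / 2)"
    using size by (simp add: powr_divide)
  moreover have "N powr (1 - e / 2) / N powr (e / 2) = N powr (1 - e)"
    by (simp flip: powr_diff)
  moreover have "a / (2 * real d) = e / 2" by simp
  moreover have "x * (y / z) = x / z * y" for x y z :: real by simp
  ultimately show ?thesis by (simp only:)
qed

lemma T_ge: "N powr (1 - e) \<le> T"
proof -
  have "1 \<le> L powr (e / 2)" using size e by (intro ge_one_powr_ge_zero) simp_all
  then show ?thesis by (simp add: mult_le_cancel_left1)
qed

text \<open>A real number at least 1 is at most twice its floor, which is good enough up to
  constants.\<close>

lemma inverse_powr_floor_root:
  assumes "x \<ge> 1" "s > 0"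
  shows "real (floor_root d x) powr (- s) \<le> 2 powr s * x powr (- s / real d)"
proof -
  have z: "x powr (1 / real d) > 0" using assms by simp
  have "real (floor_root d x) powr (- s) \<le> (x powr (1 / real d) / 2) powr (- s)"
    using floor_root_bounds(3)[OF d assms(1)] assms(2) z by (intro powr_mono2') simp_all
  also have "\<dots> = 2 powr s * x powr (- s / real d)"
    using assms(1) by (simp add: powr_divide powr_powr powr_minus_divide)
  finally show ?thesis .
qed

text \<open>At most \<open>k ^ d * m ^ d \<le> N\<close> sensors move, each by about
  \<open>m powr (- 1 / 2) / k\<close>. As \<open>k\<close> is of order
  \<open>(N / L) powr (1 / d)\<close> and \<open>m\<close> of order \<open>L powr (1 / d)\<close>,
  the powers of \<open>L\<close> combine to \<open>e - e / 2\<close>.\<close>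

lemma dense_term:
  "real (k ^ d) * ((1 / real k) powr a * (MV_const a d * (real m ^ d * real m powr (- a / 2))))
    \<le> MV_const a d * (2 powr a * p powr e * 2 powr (a / 2)) * T"
proof -
  have "real k ^ d * real m ^ d \<le> (N / (p * L)) * (A * L)"
    by (intro mult_mono kd md) (use size in simp_all)
  also have "\<dots> \<le> N" using size pA by (simp add: field_simps)
  finally have km: "real k ^ d * real m ^ d \<le> N" .
  have "(1 / real k) powr a = real k powr (- a)"
    using pos by (simp add: powr_divide powr_minus_divide)
  also have "\<dots> \<le> 2 powr a * (N / (p * L)) powr (- a / real d)"
    by (rule inverse_powr_floor_root[OF ge1(1) a])
  also have "(N / (p * L)) powr (- a / real d) = N powr (- e) * p powr e * L powr e"
    using size pA by (simp add: powr_divide powr_mult powr_minus_divide)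
  finally have k': "(1 / real k) powr a \<le> 2 powr a * (N powr (- e) * p powr e * L powr e)" .
  have "real m powr (- (a / 2)) \<le> 2 powr (a / 2) * (A * L) powr (- (a / 2) / real d)"
    by (rule inverse_powr_floor_root[OF ge1(2)]) (use a in simp)
  also have "(A * L) powr (- (a / 2) / real d) \<le> L powr (- (a / 2) / real d)"
  proof (rule powr_mono2')
    have "1 * L \<le> A * L" using pA size by (intro mult_right_mono) simp_all
    then show "L \<le> A * L" by simp
  qed (use size a d in simp_all)
  finally have m': "real m powr (- a / 2) \<le> 2 powr (a / 2) * L powr (- e / 2)" by (simp add: mult.commute)
  have "real (k ^ d) * ((1 / real k) powr a * (MV_const a d * (real m ^ d * real m powr (- a / 2))))
      = MV_const a d * ((real k ^ d * real m ^ d) * (1 / real k) powr a * real m powr (- a / 2))"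
    by simp
  also have "\<dots> \<le> MV_const a d * (N * (2 powr a * (N powr (- e) * p powr e * L powr e)) * (2 powr (a / 2) * L powr (- e / 2)))"
    by (intro mult_left_mono mult_mono km k' m' MV_const_nonneg) simp_all
  also have "\<dots> = MV_const a d * (2 powr a * p powr e * 2 powr (a / 2)) * ((N * N powr (- e)) * (L powr e * L powr (- e / 2)))"
    by (simp only: mult_ac)
  also have "N * N powr (- e) = N powr (1 - e)"
    using size by (simp add: powr_diff powr_minus_divide)
  also have "L powr e * L powr (- e / 2) = L powr (e / 2)"
    by (simp add: mult.commute flip: powr_add)
  finally show ?thesis .
qed

text \<open>On the rare event that some cell holds few sensors, displacements below the cut-off are
  bounded by it, and those above it by their moment of order \<open>6 * a\<close>. The exponent \<open>2 / 5\<close> is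
  the one for which both contributions stay below \<open>N powr (1 - e)\<close>.\<close>

definition cutoff :: real where
  "cutoff = N powr (- 2 / (5 * real d))"

lemma cutoff_powr: "cutoff powr s = N powr (- 2 * s / (5 * real d))"
  by (simp add: cutoff_def powr_powr)

text \<open>The exponents of \<open>N\<close> are \<open>1\<close> for the sensors,
  \<open>- 2 * e / 5\<close> from the cut-off, \<open>1\<close> for the number of cells and
  \<open>- (4 / 15) * (9 / 4) * (2 + e) = - 6 / 5 - 3 * e / 5\<close> from Chernoff; they add up to
  \<open>4 / 5 - e\<close>.\<close>

lemma rare_term:
  "N * cutoff powr a * (real (k ^ d) * exp (- (4 / 15) * (N / real k ^ d))) \<le> T"
proof -
  have "real (k ^ d) \<le> N"
  proof -
    have "N / (p * L) \<le> N / 1"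
    proof (rule divide_left_mono)
      have "1 * 1 \<le> p * L" using pA size by (intro mult_mono) simp_all
      then show "1 \<le> p * L" by simp
    qed (use size in simp_all)
    then show ?thesis unfolding of_nat_power div_by_1 by (rule order_trans[OF kd])
  qed
  moreover have "exp (- (4 / 15) * (N / real k ^ d)) \<le> exp (- (4 / 15) * (p * L))"
    using per_cell by simp
  ultimately have "real (k ^ d) * exp (- (4 / 15) * (N / real k ^ d)) \<le> N * exp (- (4 / 15) * (p * L))"
    by (intro mult_mono) simp_all
  then have "N * cutoff powr a * (real (k ^ d) * exp (- (4 / 15) * (N / real k ^ d)))
      \<le> N * cutoff powr a * (N * exp (- (4 / 15) * (p * L)))"
    by (intro mult_left_mono) simp_all
  also have "\<dots> = N powr (4 / 5 - e)"
  proof -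
    have N: "N = exp L" using size by simp
    have "N * cutoff powr a * (N * exp (- (4 / 15) * (p * L)))
        = exp L * exp (- 2 * a / (5 * real d) * L) * (exp L * exp (- (4 / 15) * (p * L)))"
      unfolding cutoff_powr N_powr N[symmetric] ..
    also have "\<dots> = exp ((4 / 5 - e) * L)"
      unfolding mult_exp_exp p by (rule arg_cong[where f = exp]) (use d in \<open>simp add: field_simps\<close>)
    finally show ?thesis by (simp add: N_powr)
  qed
  also have "\<dots> \<le> N powr (1 - e)"
    using size by (intro powr_mono) simp_all
  also note T_ge
  finally show ?thesis .
qed

text \<open>The exponents of \<open>N\<close> are \<open>2 * e\<close> from the cut-off,
  \<open>1\<close> for the sensors and \<open>- 3 * e\<close> from the moment, so this term meets
  \<open>1 - e\<close> exactly, whereas \<open>rare_term\<close> has a margin of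
  \<open>1 / 5\<close>.\<close>

lemma tail_term:
  "cutoff powr (- 5 * a) * (MV_const (6 * a) d * (real M ^ d * real M powr (- 3 * a)))
    \<le> MV_const (6 * a) d * 2 powr (3 * a) * T"
proof -
  have "real M powr (- (3 * a)) \<le> 2 powr (3 * a) * N powr (- (3 * a) / real d)"
    by (rule inverse_powr_floor_root) (use size a in simp_all)
  then have M': "real M powr (- 3 * a) \<le> 2 powr (3 * a) * N powr (- 3 * e)" by simp
  have c: "cutoff powr (- 5 * a) = N powr (2 * e)"
    unfolding cutoff_powr by simp
  have "cutoff powr (- 5 * a) * (MV_const (6 * a) d * (real M ^ d * real M powr (- 3 * a)))
      \<le> N powr (2 * e) * (MV_const (6 * a) d * (N * (2 powr (3 * a) * N powr (- 3 * e))))"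
    unfolding c by (intro mult_left_mono mult_mono Md M' MV_const_nonneg) simp_all
  also have "\<dots> = MV_const (6 * a) d * 2 powr (3 * a) * (N powr (2 * e) * N powr (- 3 * e) * N)"
    by (simp only: mult_ac)
  also have "N powr (2 * e) * N powr (- 3 * e) * N = N powr (1 - e)"
  proof -
    have "N powr (2 * e) * N powr (- 3 * e) * N powr 1 = N powr (1 - e)"
      unfolding powr_add[symmetric] by simp
    then show ?thesis using size by simp
  qed
  also have "MV_const (6 * a) d * 2 powr (3 * a) * N powr (1 - e) \<le> MV_const (6 * a) d * 2 powr (3 * a) * T"
    by (intro mult_left_mono T_ge mult_nonneg_nonneg MV_const_nonneg) simp
  finally show ?thesis .
qed

lemma expected_movement_bound:
  "integrable (placement d n) (mean_movement d p A a n)"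
  "expected_movement d p A a n \<le> (1 + MV_const (6 * a) d * 2 powr (3 * a)
      + MV_const a d * (2 powr a * p powr e * 2 powr (a / 2))) *
      (N powr (1 - a / (2 * real d)) * (L / N) powr (a / (2 * real d)))"
proof -
  have t: "cutoff > 0" using size by (simp add: cutoff_def)
  show "integrable (placement d n) (mean_movement d p A a n)"
    by (rule mean_movement_bound(1)[OF t])
  have "expected_movement d p A a n \<le> T + MV_const (6 * a) d * 2 powr (3 * a) * T
      + MV_const a d * (2 powr a * p powr e * 2 powr (a / 2)) * T"
    by (rule order_trans[OF mean_movement_bound(2)[OF t]]) (intro add_mono rare_term tail_term dense_term)
  then show "expected_movement d p A a n \<le> (1 + MV_const (6 * a) d * 2 powr (3 * a)
      + MV_const a d * (2 powr a * p powr e * 2 powr (a / 2))) *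
      (N powr (1 - a / (2 * real d)) * (L / N) powr (a / (2 * real d)))"
    unfolding target by (simp only: distrib_right mult_1_left)
qed

end

theorem theorem4:
  fixes d :: nat and a p A x0 :: real
  assumes "d \<ge> 2" and "a > 0"
    and "p = 9 / 4 * (2 + a / real d)"
    and "A = 3 / 4 * (2 + a / real d)"
    and "x0 \<ge> 3" and "x0 / (p * ln x0) = 3"
  shows "\<exists>C>0. \<forall>(f::real) (n::nat).
           f \<ge> 3 powr (3 / real d) / (3 powr (1 / real d) - 1)\<^sup>2 \<longrightarrow> int n \<ge> \<lceil>x0\<rceil> \<longrightarrow>
           (\<forall>X \<in> {..<n} \<rightarrow>\<^sub>E unit_cube d. \<forall>S \<in> set_pmf (LV d p A n X).
              covers d n (f / (2 * real n powr (1 / real d))) (positions S)) \<and>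
           integrable (placement d n) (mean_movement d p A a n) \<and>
           expected_movement d p A a n
             \<le> C * (real n powr (1 - a / (2 * real d)) *
                     (ln (real n) / real n) powr (a / (2 * real d)))"
proof -
  \<comment> \<open>Built from \<open>d\<close> and \<open>a\<close> alone, since \<open>p\<close>
    is a function of them; neither \<open>n\<close> nor \<open>f\<close> enters.\<close>
  let ?C = "1 + MV_const (6 * a) d * 2 powr (3 * a)
      + MV_const a d * (2 powr a * p powr (a / real d) * 2 powr (a / 2))"
  have "?C > 0"
    by (intro add_pos_nonneg mult_nonneg_nonneg MV_const_nonneg) simp_all
  moreover have "(\<forall>X \<in> {..<n} \<rightarrow>\<^sub>E unit_cube d. \<forall>S \<in> set_pmf (LV d p A n X).
        covers d n (f / (2 * real n powr (1 / real d))) (positions S)) \<and>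
      integrable (placement d n) (mean_movement d p A a n) \<and>
      expected_movement d p A a n \<le> ?C * (real n powr (1 - a / (2 * real d)) *
        (ln (real n) / real n) powr (a / (2 * real d)))"
    if f: "f \<ge> 3 powr (3 / real d) / (3 powr (1 / real d) - 1)\<^sup>2" and n: "int n \<ge> \<lceil>x0\<rceil>" for f n
  proof -
    interpret LV_analysis d a p A x0 n
      by unfold_locales (use assms n in \<open>simp_all add: ceiling_le_iff\<close>)
    show ?thesis
      using LV_covers covering_radius[OF f] expected_movement_bound by blast
  qed
  ultimately show ?thesis by blast
qed

end
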